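(* Let $D\subset\mathbb{R}^2$ be a closed subset homeomorphic to the closed unit disk, let $f:D\to\mathbb{R}$ be a regular function on $D$, and let $\gamma_1,\dots,\gamma_4$ be the corresponding arcs of $\operatorname{Fr}D$ from the definition of a weakly regular function. Put $D'=[0,1]^2$ if $\mathring\gamma_2\neq\emptyset$ and $\mathring\gamma_4\neq\emptyset$; $D'=D^2=\{z: |z|\le 1\}$ if $\mathring\gamma_2\cup\mathring\gamma_4=\emptyset$; and $D'=\overline{D}^2_+=\{z: |z|\le 1,\ \operatorname{Im}z\ge 0\}$ if exactly one of the sets $\mathring\gamma_2,\mathring\gamma_4$ is empty. Let $$K=f^{-1}\bigl(\{\min_{z\in D}f(z),\ \max_{z\in D}f(z)\}\bigr),\qquad K'=\Bigl\{(x,y)\in D' : y\in\bigl\{\min_{(x,y)\in D'}y,\ \max_{(x,y)\in D'}y\bigr\}\Bigr\},$$ and let $\phi:\operatorname{Fr}D\to\operatorname{Fr}D'$ be a homeomorphism such that $\phi(K)=K'$. Then there exists a homeomorphism $H_f$ of $D$ onto $D'$ such that $H_f|_K=\phi|_K$ and, for certain $a,b\in\mathbb{R}$ with $a\ne 0$, $f\circ H_f^{-1}(x,y)=ay+b$ for all $(x,y)\in D'$.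
   Context: $\mathbb{R}^2$ is identified with $\mathbb{C}$; $\operatorname{Int}$ and $\operatorname{Fr}$ denote interior and frontier. Regular points. Let $W\subset\mathbb{R}^2$ be a domain and $f:\overline W\to\mathbb{R}$ continuous. A point $z_0\in W$ is a regular point of $f$ if there are an open neighbourhood $U\subseteq W$ of $z_0$, a number $r>0$ and a homeomorphism $\varphi:U\to\{z:|z|<r\}$ with $\varphi(z_0)=0$ and $f\circ\varphi^{-1}(z)=\operatorname{Re}z+f(z_0)$ for all $|z|<r$. A point $z_0\in\operatorname{Fr}W$ is a regular boundary point of $f$ if there are an open neighbourhood $U$ of $z_0$ in the space $\overline W$ and a homeomorphism $\psi:U\to D^2_+=\{z:|z|<1,\ \operatorname{Im}z\ge0\}$ such that $\psi(z_0)=0$, $\psi(U\cap f^{-1}(f(z_0)))=\{0\}\times[0,1)$, $\psi(U\cap\operatorname{Fr}W)=(-1,1)\times\{0\}$ and $f\circ\psi^{-1}$ is strictly monotone on $(-1,1)\times\{0\}$. Weakly regular functions. Let $D\subset\mathbb{R}^2$ be closed and homeomorphic to the closed unit disk (so $W=\operatorname{Int}D$), and fix an orientation of the circle $\operatorname{Fr}D$. A continuous $f:D\to\mathbb{R}$ is weakly regular on $D$ if there are $n\ge2$ and points $z_1,\dots,z_{2n}\in\operatorname{Fr}D$, passed through consecutively in this order when $\operatorname{Fr}D$ is traversed once in the positive direction (consecutive points may coincide), with the following properties. Let $z_{2n+1}=z_1$, let $\gamma_k$ be the closed arc of $\operatorname{Fr}D$ going in the positive direction from $z_k$ to $z_{k+1}$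 (with $\gamma_k=\{z_k\}$ if $z_k=z_{k+1}$), and $\mathring\gamma_k=\gamma_k\setminus\{z_k,z_{k+1}\}$. Then: (1) every point of $\operatorname{Int}D=D\setminus\operatorname{Fr}D$ is a regular point of $f$; (2) for $k=1,\dots,n$, $\mathring\gamma_{2k-1}\ne\emptyset$ and every point of $\mathring\gamma_{2k-1}$ is a regular boundary point of $f$ (in particular $f|_{\gamma_{2k-1}}$ is strictly monotone); (3) for $k=1,\dots,n$, $\gamma_{2k}$ is a connected component of a level set of $f$. One always has $n=2$. Regular functions. A $U$-trajectory is a simple continuous curve $\gamma:[0,1]\to D$ such that $f\circ\gamma$ is strictly monotone on $[0,1]$; it passes through a point if the point lies in $\gamma([0,1])$. A weakly regular function $f$ on $D$ (with $n=2$ and arcs $\gamma_1,\dots,\gamma_4$) is regular on $D$ if there is a dense subset $\Gamma$ of $\mathring\gamma_2\cup\mathring\gamma_4$ such that through every point of $\Gamma$ passes a $U$-trajectory. *)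

theory Defs
  imports "HOL-Analysis.Analysis"
begin

definition strictly_monotone_on :: "real set \<Rightarrow> (real \<Rightarrow> real) \<Rightarrow> bool" where
  "strictly_monotone_on A g \<longleftrightarrow> strict_mono_on A g \<or> strict_antimono_on A g"

definition regular_point :: "complex set \<Rightarrow> (complex \<Rightarrow> real) \<Rightarrow> complex \<Rightarrow> bool" where
  "regular_point W f z0 \<longleftrightarrow> z0 \<in> W \<and>
    (\<exists>U r \<phi> \<phi>'. open U \<and> z0 \<in> U \<and> U \<subseteq> W \<and> r > 0 \<and>
       homeomorphism U (ball 0 r) \<phi> \<phi>' \<and> \<phi> z0 = 0 \<and>
       (\<forall>z\<in>ball 0 r. f (\<phi>' z) = Re z + f z0))"

definition regular_boundary_point :: "complex set \<Rightarrow> (complex \<Rightarrow> real) \<Rightarrow> complex \<Rightarrow> bool" where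
  "regular_boundary_point W f z0 \<longleftrightarrow> z0 \<in> frontier W \<and>
    (\<exists>U \<psi> \<psi>'. openin (top_of_set (closure W)) U \<and> z0 \<in> U \<and>
       homeomorphism U {z. cmod z < 1 \<and> Im z \<ge> 0} \<psi> \<psi>' \<and> \<psi> z0 = 0 \<and>
       \<psi> ` (U \<inter> {w \<in> closure W. f w = f z0}) = {z. Re z = 0 \<and> 0 \<le> Im z \<and> Im z < 1} \<and>
       \<psi> ` (U \<inter> frontier W) = {z. -1 < Re z \<and> Re z < 1 \<and> Im z = 0} \<and>
       strictly_monotone_on {-1<..<1} (\<lambda>x. f (\<psi>' (complex_of_real x))))"

text \<open>
  An orientation of the circle \<open>frontier D\<close> is given by a homeomorphism \<open>c\<close> from the unit circle
  onto it: the positive direction on \<open>frontier D\<close> is the image under \<open>c\<close> of the counterclockwise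
  one. Both orientations arise in this way.
\<close>

definition consecutive_points :: "(complex \<Rightarrow> complex) \<Rightarrow> nat \<Rightarrow> (nat \<Rightarrow> complex) \<Rightarrow> bool" where
  "consecutive_points c m z \<longleftrightarrow>
    (\<exists>t. (\<forall>k\<in>{1..m}. z k = c (cis (t k))) \<and> mono_on {1..m} t \<and> t m \<le> t 1 + 2 * pi)"

text \<open>
  The closed arc going in the positive direction from \<open>u\<close> to \<open>v\<close>. The strict bound
  \<open>b < a + 2 * pi\<close> forces \<open>a = b\<close> if \<open>u = v\<close>, so that the arc is then \<open>{u}\<close> and not the whole
  circle.
\<close>

definition positive_arc :: "(complex \<Rightarrow> complex) \<Rightarrow> complex \<Rightarrow> complex \<Rightarrow> complex set" where
  "positive_arc c u v =
    {c (cis s) | s a b. u = c (cis a) \<and> v = c (cis b) \<and> a \<le> s \<and> s \<le> b \<and> b < a + 2 * pi}"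

definition bd_arc :: "(complex \<Rightarrow> complex) \<Rightarrow> (nat \<Rightarrow> complex) \<Rightarrow> nat \<Rightarrow> complex set" where
  "bd_arc c z k = positive_arc c (z k) (z (k + 1))"

definition open_bd_arc :: "(complex \<Rightarrow> complex) \<Rightarrow> (nat \<Rightarrow> complex) \<Rightarrow> nat \<Rightarrow> complex set" where
  "open_bd_arc c z k = bd_arc c z k - {z k, z (k + 1)}"

text \<open>
  \<open>f\<close> is weakly regular on \<open>D\<close>, as witnessed by the number \<open>n\<close> and the points
  \<open>z 1, \<dots>, z (2 * n)\<close>, with respect to the orientation \<open>c\<close> of \<open>frontier D\<close>.
\<close>

definition weakly_regular_with ::
  "(complex \<Rightarrow> complex) \<Rightarrow> complex set \<Rightarrow> (complex \<Rightarrow> real) \<Rightarrow> nat \<Rightarrow> (nat \<Rightarrow> complex) \<Rightarrow> bool" where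
  "weakly_regular_with c D f n z \<longleftrightarrow>
    continuous_on D f \<and> n \<ge> 2 \<and>
    consecutive_points c (2 * n) z \<and> z (2 * n + 1) = z 1 \<and>
    (\<forall>w\<in>interior D. regular_point (interior D) f w) \<and>
    (\<forall>k\<in>{1..n}. open_bd_arc c z (2 * k - 1) \<noteq> {} \<and>
       (\<forall>w\<in>open_bd_arc c z (2 * k - 1). regular_boundary_point (interior D) f w)) \<and>
    (\<forall>k\<in>{1..n}. \<exists>y. bd_arc c z (2 * k) \<in> components {w \<in> D. f w = y})"

definition U_trajectory :: "complex set \<Rightarrow> (complex \<Rightarrow> real) \<Rightarrow> (real \<Rightarrow> complex) \<Rightarrow> bool" where
  "U_trajectory D f \<gamma> \<longleftrightarrow>
    arc \<gamma> \<and> path_image \<gamma> \<subseteq> D \<and> strictly_monotone_on {0..1} (f \<circ> \<gamma>)"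

definition regular_with ::
  "(complex \<Rightarrow> complex) \<Rightarrow> complex set \<Rightarrow> (complex \<Rightarrow> real) \<Rightarrow> (nat \<Rightarrow> complex) \<Rightarrow> bool" where
  "regular_with c D f z \<longleftrightarrow>
    weakly_regular_with c D f 2 z \<and>
    (\<exists>\<Gamma>. \<Gamma> \<subseteq> open_bd_arc c z 2 \<union> open_bd_arc c z 4 \<and>
         open_bd_arc c z 2 \<union> open_bd_arc c z 4 \<subseteq> closure \<Gamma> \<and>
         (\<forall>p\<in>\<Gamma>. \<exists>\<gamma>. U_trajectory D f \<gamma> \<and> p \<in> path_image \<gamma>))"

definition model_domain :: "complex set \<Rightarrow> complex set \<Rightarrow> complex set" where
  "model_domain A B =
    (if A \<noteq> {} \<and> B \<noteq> {} then {w. 0 \<le> Re w \<and> Re w \<le> 1 \<and> 0 \<le> Im w \<and> Im w \<le> 1}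
     else if A \<union> B = {} then cball 0 1
     else {w. cmod w \<le> 1 \<and> Im w \<ge> 0})"

text \<open>
  The set where \<open>g\<close> attains its minimum or maximum over \<open>S\<close>. It is used for continuous \<open>g\<close> and
  nonempty compact \<open>S\<close>, where infimum and supremum are minimum and maximum.
\<close>

definition extremal_set :: "complex set \<Rightarrow> (complex \<Rightarrow> real) \<Rightarrow> complex set" where
  "extremal_set S g = {w \<in> S. g w \<in> {INF u\<in>S. g u, SUP u\<in>S. g u}}"

end

theory Submission
  imports Defs
begin

text \<open>
  After a homeomorphism \<open>D\<close> is the closed unit disc; \<open>f\<close> has its minimum \<open>m\<close> and maximum \<open>M\<close> on two
  boundary arcs, and the two other arcs are sections \<open>a, b\<close> of \<open>f\<close>. As \<open>f\<close> has no other local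
  extrema, sub- and superlevel sets are connected, so by unicoherence every level set is connected.
  By Janiszewski's theorem a point of the level set of \<open>y\<close> separates \<open>a y\<close> from \<open>b y\<close> in it, so
  the level set is linearly ordered from \<open>a y\<close> to \<open>b y\<close>. The relation \<open><\<close> on points of equal level is
  open: between two points lies a third one through which a curve passes on which \<open>f\<close> is injective
  (on the end levels this is where the U-trajectories enter), and neither of the two points can
  change sides with respect to this curve. Hence there is a continuous function that increases
  strictly along every level set. Normalised, and corrected so as to extend \<open>\<phi>\<close> on the end levels, it
  is the horizontal coordinate of \<open>H\<close>, while the vertical one is an affine function of \<open>f\<close>.
\<close>

text \<open>Interior charts describe a level only near one point, and on the end levels none is
  available, so the order along a level and its continuity have to come from plane separation. One
  crossing principle serves twice: for a level with a short arc removed it produces the two sides of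
  a point, and for two neighbouring levels joined by a small convex set it shows that a point cannot
  change sides with respect to a transversal. Openness of the order is the delicate property:
  without transversals at the end levels nothing in the argument would stop nearby levels from
  running back and forth along an end arc. It is openness that makes the distance from a fixed point
  to the part of the level preceding \<open>w\<close> continuous in \<open>w\<close>. A second
  obstacle is an end arc that is a single point: the normalised horizontal coordinate may be
  discontinuous there, but it is multiplied by the width of the model domain, which tends to 0. The
  setting is symmetric under exchange of \<open>a\<close> and \<open>b\<close> and under passing to
  \<open>-f\<close>, so one-sided statements are proved once.\<close>

section \<open>Separation and crossing in the closed disc\<close>

text \<open>In a compact set a component is the intersection of its clopen neighbourhoods
  (Sura-Bura), so some clopen piece contains the component of \<open>a\<close> and still misses
  \<open>b\<close>.\<close>

lemma compact_separation:
  fixes S :: "'a::euclidean_space set"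
  assumes "compact S" "a \<in> S" "b \<in> S"
    and ncon: "\<And>C. compact C \<Longrightarrow> connected C \<Longrightarrow> C \<subseteq> S \<Longrightarrow> a \<in> C \<Longrightarrow> b \<in> C \<Longrightarrow> False"
  obtains P Q where "closed P" "closed Q" "P \<union> Q = S" "P \<inter> Q = {}" "a \<in> P" "b \<in> Q"
proof -
  let ?C = "connected_component_set S a"
  have C: "?C \<in> components S" "compact ?C" "connected ?C" "?C \<subseteq> S" "a \<in> ?C"
    using assms(1,2) by (auto simp: componentsI connected_component_subset
        intro: compact_components)
  have "b \<notin> ?C" using ncon C by blast
  then have "?C \<subseteq> - {b}" by blast
  then obtain K where K: "openin (top_of_set S) K" "compact K" "?C \<subseteq> K" "K \<subseteq> - {b}"
    using Sura_Bura_clopen_subset[of S ?C "- {b}"] C(1,2) \<open>compact S\<close>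
    by (metis closed_singleton closed_imp_locally_compact compact_imp_closed open_Compl)
  show thesis
  proof
    show "closed K" using K(2) compact_imp_closed by blast
    have "closedin (top_of_set S) (S - K)" using K(1) by (simp add: closedin_diff)
    then show "closed (S - K)" using \<open>compact S\<close> closedin_closed_trans compact_imp_closed by blast
    show "K \<union> (S - K) = S" using openin_imp_subset[OF K(1)] by blast
    show "a \<in> K" "b \<in> S - K" using K C assms by auto
  qed auto
qed

text \<open>
  If \<open>G\<close> and \<open>H\<close> were disjoint, one could prolong both by radial segments beyond the disc; then a
  point of \<open>H\<close> would be connected to infinity outside \<open>G\<close> together with either one of the two arcs of
  a larger circle, hence outside \<open>G\<close> together with the whole larger circle.
\<close>

lemma crossing_in_disc:
  fixes G H X Y :: "complex set"
  assumes "compact G" "connected G" "G \<subseteq> cball 0 1"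
    and "connected H" "H \<subseteq> cball 0 1"
    and "closed X" "closed Y" "X \<union> Y = sphere 0 1" "X \<inter> Y \<subseteq> G"
    and p: "p \<in> H" "p \<in> X" and q: "q \<in> H" "q \<in> Y"
  shows "G \<inter> H \<noteq> {}"
proof
  assume disj: "G \<inter> H = {}"
  \<comment> \<open>Used with ends 2 and 3: \<open>ray 2\<close> prolongs \<open>G\<close> up to the
    circle of radius 2, \<open>ray 3\<close> leads from \<open>p\<close> and \<open>q\<close> past
    that circle.\<close>
  define ray where "ray s x = (\<lambda>r::real. r *\<^sub>R x) ` {1..s}" for s and x :: complex
  have ray_con: "connected (ray s x)" for s x
    unfolding ray_def by (intro connected_continuous_image continuous_intros) auto
  have ray_start: "x \<in> ray s x" if "s \<ge> 1" for s x
    unfolding ray_def using that by (auto intro!: image_eqI[of _ _ 1])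
  have ray_end: "s *\<^sub>R x \<in> ray s x" if "s \<ge> 1" for s x
    unfolding ray_def using that by auto
  have unit_eq: "r = r' \<and> x = y" if "norm x = 1" "norm y = 1" "r *\<^sub>R x = r' *\<^sub>R y" "r \<ge> 1" "r' \<ge> 1"
    for r r' :: real and x y :: complex
  proof -
    have "r * norm x = r' * norm y" using that(3-5)
      by (metis abs_of_nonneg norm_scaleR order_trans zero_le_one)
    then have "r = r'" using that by simp
    then show ?thesis using that by auto
  qed
  have pq: "norm p = 1" "norm q = 1" using assms by (auto simp: set_eq_iff)
  have nX: "norm x = 1" if "x \<in> X" for x using that assms(8) by auto
  have nY: "norm x = 1" if "x \<in> Y" for x using that assms(8) by auto
  have pG: "p \<notin> G" "q \<notin> G" using disj p q by auto
  define R where "R = (\<lambda>(r::real, x). r *\<^sub>R x) ` ({1..2} \<times> (G \<inter> sphere 0 1))"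
  define G' where "G' = G \<union> R"
  have "compact R" unfolding R_def
    by (intro compact_continuous_image compact_Times compact_Int_closed \<open>compact G\<close>)
       (auto intro!: continuous_intros simp: case_prod_unfold)
  then have "compact G'" unfolding G'_def using \<open>compact G\<close> by blast
  have RU: "R = (\<Union>x\<in>G \<inter> sphere 0 1. ray 2 x)" unfolding R_def ray_def by auto
  have "connected G'"
  proof -
    have eq: "G' = \<Union> (insert G ((\<lambda>x. G \<union> ray 2 x) ` (G \<inter> sphere 0 1)))"
      unfolding G'_def RU by auto
    have con: "connected (G \<union> ray 2 x)" if "x \<in> G" for x
      using that ray_start[of 2 x] by (intro connected_Un \<open>connected G\<close> ray_con) auto
    show ?thesis
    proof (cases "G = {}")
      case True
      then show ?thesis unfolding eq by simp
    next
      case False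
      then obtain x0 where "x0 \<in> G" by blast
      show ?thesis unfolding eq
        by (rule connected_Union) (use con \<open>connected G\<close> \<open>x0 \<in> G\<close> in auto)
    qed
  qed
  define X' Y' where "X' = (\<lambda>x. 2 *\<^sub>R x) ` X" and "Y' = (\<lambda>x. 2 *\<^sub>R x) ` Y"
  have "compact X" "compact Y"
    using assms(6,7,8) by (metis closed_subset compact_sphere closedin_compact sup_ge1 sup_ge2)+
  then have "compact X'" "compact Y'" unfolding X'_def Y'_def
    by (auto intro!: compact_continuous_image continuous_intros)
  have XY': "X' \<union> Y' = sphere 0 2"
  proof -
    have "X' \<union> Y' = (\<lambda>x. 2 *\<^sub>R x) ` sphere 0 1" unfolding X'_def Y'_def using assms(8) by blast
    also have "\<dots> = sphere 0 2" using sphere_scale[of 2 "0::complex" 1] by simp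
    finally show ?thesis .
  qed
  have "X' \<inter> Y' \<subseteq> R" unfolding X'_def Y'_def R_def using assms(8,9)
    by (fastforce intro!: image_eqI[of _ _ "(2, _)"])
  have avoid: "r *\<^sub>R x \<notin> G'" if "x \<notin> G" "norm x = 1" "r \<ge> 1" for r and x :: complex
  proof
    assume "r *\<^sub>R x \<in> G'"
    then consider "r *\<^sub>R x \<in> G" | r' y where "r *\<^sub>R x = r' *\<^sub>R y" "y \<in> G" "norm y = 1" "r' \<ge> 1"
      unfolding G'_def R_def by auto
    then show False
    proof cases
      case 1
      then have "norm (r *\<^sub>R x) \<le> 1" using assms(3) by (metis mem_cball_0 subsetD)
      then have "r = 1" using that by simp
      then show False using 1 that by simp
    next
      case 2
      then show False using unit_eq[of x y r r'] that by auto
    qed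
  qed
  have H_avoid: "x \<notin> G'" "x \<notin> X'" "x \<notin> Y'" if "x \<in> H" for x
  proof -
    have "norm x \<le> 1" using that assms(5) by auto
    then have "x \<notin> X' \<union> Y'" unfolding XY' by simp
    then show "x \<notin> X'" "x \<notin> Y'" by auto
    show "x \<notin> G'"
    proof
      assume "x \<in> G'"
      moreover have "x \<notin> G" using disj that by blast
      ultimately obtain r y where ry: "x = r *\<^sub>R y" "y \<in> G" "norm y = 1" "r \<ge> 1"
        unfolding G'_def R_def by auto
      with \<open>norm x \<le> 1\<close> have "r = 1" by simp
      then show False using ry disj that by auto
    qed
  qed
  have rayX: "r *\<^sub>R x \<notin> X'" if "x \<in> Y" "x \<notin> G" "r \<ge> 1" for r x
    using that unit_eq[of x _ r 2] nX nY assms(9) unfolding X'_def by fastforce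
  have rayY: "r *\<^sub>R x \<notin> Y'" if "x \<in> X" "x \<notin> G" "r \<ge> 1" for r x
    using that unit_eq[of x _ r 2] nX nY assms(9) unfolding Y'_def by fastforce
  have out: "connected (- cball (0::complex) 2)"
    by (rule connected_complement_bounded_convex) auto
  have out_avoid: "x \<notin> G' \<and> x \<notin> X' \<and> x \<notin> Y'" if "x \<notin> cball 0 2" for x
  proof -
    have "G' \<subseteq> cball 0 2" unfolding G'_def R_def using assms(3) by auto
    moreover have "X' \<union> Y' \<subseteq> cball 0 2" using XY' by simp
    ultimately show ?thesis using that by blast
  qed
  have ccY: "connected_component (- (G' \<union> Y')) p (3 *\<^sub>R p)"
    unfolding connected_component_def
  proof (intro exI conjI)
    show "connected (ray 3 p)" by (rule ray_con)
    show "ray 3 p \<subseteq> - (G' \<union> Y')" unfolding ray_def using avoid rayY p pG pq by auto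
    show "p \<in> ray 3 p" "3 *\<^sub>R p \<in> ray 3 p" using ray_start ray_end by auto
  qed
  have ccX: "connected_component (- (G' \<union> X')) p (3 *\<^sub>R p)"
    unfolding connected_component_def
  proof (intro exI conjI)
    have 1: "connected (H \<union> ray 3 q)"
      using q ray_start[of 3 q] by (intro connected_Un \<open>connected H\<close> ray_con) auto
    have 2: "3 *\<^sub>R q \<in> - cball 0 2" using pq by simp
    show "connected (H \<union> ray 3 q \<union> - cball 0 2)"
      using ray_end[of 3 q] 2 by (intro connected_Un[OF 1 out]) auto
    have "ray 3 q \<subseteq> - (G' \<union> X')" using avoid rayX q pG pq unfolding ray_def by auto
    moreover have "- cball 0 2 \<subseteq> - (G' \<union> X')" using out_avoid by blast
    ultimately show "H \<union> ray 3 q \<union> - cball 0 2 \<subseteq> - (G' \<union> X')"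
      using H_avoid by blast
    show "p \<in> H \<union> ray 3 q \<union> - cball 0 2" using p by auto
    show "3 *\<^sub>R p \<in> H \<union> ray 3 q \<union> - cball 0 2" using pq by auto
  qed
  \<comment> \<open>Janiszewski's theorem needs the two obstacles to meet in a connected set. The
    scaled arcs meet only inside the rays already added to \<open>G'\<close>, so the intersection is
    \<open>G'\<close> itself.\<close>
  have "(G' \<union> Y') \<inter> (G' \<union> X') = G'" using \<open>X' \<inter> Y' \<subseteq> R\<close> unfolding G'_def by blast
  then have "connected_component (- ((G' \<union> Y') \<union> (G' \<union> X'))) p (3 *\<^sub>R p)"
    using Janiszewski[OF _ _ _ ccY ccX] \<open>compact G'\<close> \<open>compact X'\<close> \<open>compact Y'\<close> \<open>connected G'\<close>
    by (simp add: compact_Un compact_imp_closed)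
  then obtain T where T: "connected T" "T \<subseteq> - ((G' \<union> Y') \<union> (G' \<union> X'))" "p \<in> T" "3 *\<^sub>R p \<in> T"
    unfolding connected_component_def by blast
  \<comment> \<open>\<open>T\<close> runs from norm 1 to norm 3, so it hits the circle of radius 2,
    which is \<open>X' \<union> Y'\<close>.\<close>
  have "connected (norm ` T)" by (intro connected_continuous_image continuous_intros T)
  moreover have "norm p \<in> norm ` T" "norm (3 *\<^sub>R p) \<in> norm ` T" using T by blast+
  ultimately have "2 \<in> norm ` T" using pq
    by (intro connectedD_interval[of "norm ` T" 1 3 2]) auto
  then show False using T(2) XY' by auto
qed

section \<open>Linear orders on continua given by cut points\<close>

definition splits :: "'a::topological_space set \<Rightarrow> 'a \<Rightarrow> 'a \<Rightarrow> 'a \<Rightarrow> 'a set \<Rightarrow> 'a set \<Rightarrow> bool" where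
  "splits L a b p P Q \<longleftrightarrow> closed P \<and> closed Q \<and> P \<union> Q = L \<and> P \<inter> Q = {p} \<and> a \<in> P \<and> b \<in> Q"

text \<open>The end points are exempt because they are split by \<open>{a}\<close> or
  \<open>{b}\<close> together with the whole set. The case \<open>a = b\<close> is allowed and
  forces \<open>L = {a}\<close>, since a splitting would put \<open>a\<close> into
  \<open>P \<inter> Q = {p}\<close>; this covers end arcs reduced to a point.\<close>

definition cut_chain :: "'a::topological_space set \<Rightarrow> 'a \<Rightarrow> 'a \<Rightarrow> bool" where
  "cut_chain L a b \<longleftrightarrow> closed L \<and> connected L \<and> a \<in> L \<and> b \<in> L \<and>
     (\<forall>p\<in>L - {a, b}. \<exists>P Q. splits L a b p P Q)"

text \<open>A description of the \<open>a\<close>-side of \<open>p\<close> that mentions no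
  splitting, which makes this side unique. It is read as a down-set:
  \<open>q \<in> segment_from L a p\<close> says that \<open>q\<close> does not come after
  \<open>p\<close> on the way from \<open>a\<close> to \<open>b\<close>.\<close>

definition segment_from :: "'a::topological_space set \<Rightarrow> 'a \<Rightarrow> 'a \<Rightarrow> 'a set" where
  "segment_from L a p = \<Inter> {C. connected C \<and> C \<subseteq> L \<and> a \<in> C \<and> p \<in> C}"

lemma splits_sym: "splits L a b p P Q \<Longrightarrow> splits L b a p Q P"
  unfolding splits_def by blast

lemma cut_chain_sym: "cut_chain L a b \<Longrightarrow> cut_chain L b a"
  unfolding cut_chain_def using splits_sym by (metis insert_commute)

text \<open>A part of \<open>P\<close> split off from \<open>p\<close> would also be split off from
  \<open>Q\<close>, hence from all of \<open>L\<close>.\<close>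

lemma splits_connected:
  assumes "connected L" "splits L a b p P Q"
  shows "connected P"
proof -
  have PQ: "closed P" "closed Q" "P \<union> Q = L" "P \<inter> Q = {p}" using assms(2) unfolding splits_def by auto
  show ?thesis
  proof (rule ccontr)
    assume "\<not> connected P"
    then obtain A B where AB: "closed A" "closed B" "A \<union> B = P" "A \<inter> B = {}" "A \<noteq> {}" "B \<noteq> {}"
      using PQ(1) by (auto simp: connected_closed_set)
    have *: False if "closed A" "closed B" "A \<union> B = P" "A \<inter> B = {}" "B \<noteq> {}" "p \<in> A" for A B
    proof -
      have "B \<inter> (A \<union> Q) = {}" using that PQ by blast
      moreover have "closed (A \<union> Q)" using that PQ by blast
      moreover have "L = B \<union> (A \<union> Q)" using that PQ by blast
      ultimately show False
        using assms(1) that connected_closed_set[of L] PQ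
        by (metis UnCI closed_Un empty_iff)
    qed
    have "p \<in> A \<or> p \<in> B" using AB PQ by blast
    then show False using *[of A B] *[of B A] AB by (metis Un_commute Int_commute)
  qed
qed

lemma connected_meets_split:
  assumes "splits L a b p P Q" "connected C" "C \<subseteq> L" "x \<in> C" "x \<in> P" "y \<in> C" "y \<in> Q"
  shows "p \<in> C"
proof (rule ccontr)
  assume "p \<notin> C"
  have "closed P" "closed Q" "C \<subseteq> P \<union> Q" "P \<inter> Q \<inter> C = {}"
    using assms \<open>p \<notin> C\<close> unfolding splits_def by auto
  then show False using assms connected_closedD[of C P Q] by blast
qed

lemma cut_chain_splits:
  fixes L :: "'a::t1_space set"
  assumes "cut_chain L a b" "p \<in> L"
  obtains P Q where "splits L a b p P Q"
proof -
  have "splits L a b p {a} L" if "p = a" using that assms unfolding cut_chain_def splits_def by auto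
  moreover have "splits L a b p L {b}" if "p = b" using that assms unfolding cut_chain_def splits_def by auto
  ultimately show thesis using that assms unfolding cut_chain_def by blast
qed

text \<open>The connected side \<open>P\<close> is one of the sets intersected, which gives one
  inclusion. For the other, a point \<open>q \<noteq> p\<close> of \<open>P\<close> is itself a cut
  point: \<open>Q\<close> joins \<open>p\<close> to \<open>b\<close> without \<open>q\<close>, so
  \<open>p\<close> lies on the \<open>b\<close>-side of \<open>q\<close>, and every connected set
  from \<open>a\<close> to \<open>p\<close> must pass through \<open>q\<close>.\<close>

lemma segment_from_eq:
  fixes L :: "'a::t1_space set"
  assumes ch: "cut_chain L a b" and s: "splits L a b p P Q"
  shows "segment_from L a p = P"
proof
  have L: "connected L" using ch unfolding cut_chain_def by blast
  have PQ: "P \<union> Q = L" "P \<inter> Q = {p}" "a \<in> P" "b \<in> Q" using s unfolding splits_def by auto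
  show "segment_from L a p \<subseteq> P" unfolding segment_from_def
    using splits_connected[OF L s] PQ by blast
  show "P \<subseteq> segment_from L a p"
    unfolding segment_from_def
  proof clarify
    fix q C assume q: "q \<in> P" and C: "connected C" "C \<subseteq> L" "a \<in> C" "p \<in> C"
    show "q \<in> C"
    proof (cases "q = p")
      case False
      have "q \<in> L" using q PQ by blast
      then obtain P' Q' where s': "splits L a b q P' Q'" using cut_chain_splits[OF ch] by blast
      have PQ': "P' \<union> Q' = L" "P' \<inter> Q' = {q}" "a \<in> P'" "b \<in> Q'" using s' unfolding splits_def by auto
      have Q: "connected Q" "Q \<subseteq> L" "p \<in> Q" using splits_connected[OF L splits_sym[OF s]] PQ by auto
      show ?thesis
      proof (cases "p \<in> P'")
        case True
        then have "q \<in> Q" using connected_meets_split[OF s' Q(1,2,3) True] PQ PQ' by blast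
        then show ?thesis using False q PQ by blast
      next
        case False
        then have "p \<in> Q'" using PQ PQ' by blast
        then show ?thesis using connected_meets_split[OF s' C(1,2,3)] PQ' C by blast
      qed
    qed (use C in auto)
  qed
qed

lemma cut_chain_segment:
  fixes L :: "'a::t1_space set"
  assumes "cut_chain L a b" "p \<in> L"
  shows "splits L a b p (segment_from L a p) (segment_from L b p)"
proof -
  obtain P Q where "splits L a b p P Q" using cut_chain_splits[OF assms] .
  then show ?thesis
    using segment_from_eq[OF assms(1)] segment_from_eq[OF cut_chain_sym[OF assms(1)] splits_sym] by metis
qed

lemma segment_from_mono:
  fixes L :: "'a::t1_space set"
  assumes "cut_chain L a b" "p \<in> L" "q \<in> segment_from L a p"
  shows "segment_from L a q \<subseteq> segment_from L a p"
proof -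
  note s = cut_chain_segment[OF assms(1,2)]
  have "connected L" using assms(1) unfolding cut_chain_def by blast
  with s have "connected (segment_from L a p)" by (rule splits_connected[rotated])
  then show ?thesis using s assms(3) unfolding splits_def segment_from_def[of L a q] by blast
qed

text \<open>If \<open>p\<close> were not on the \<open>b\<close>-side of \<open>q\<close>, the
  connected \<open>b\<close>-side of \<open>p\<close> would lead from the \<open>a\<close>-side of
  \<open>q\<close> to \<open>b\<close> and contain \<open>q\<close>, which forces
  \<open>q = p\<close>. So the order read from \<open>b\<close> is the reverse of the one read from
  \<open>a\<close>.\<close>

lemma segment_from_swap:
  fixes L :: "'a::t1_space set"
  assumes ch: "cut_chain L a b" and "p \<in> L" "q \<in> L"
  shows "q \<in> segment_from L a p \<longleftrightarrow> p \<in> segment_from L b q"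
proof -
  have *: "p \<in> segment_from L b q"
    if ch: "cut_chain L a b" and "p \<in> L" "q \<in> L" and qp: "q \<in> segment_from L a p" for a b p q
  proof -
    note sp = cut_chain_segment[OF ch that(2)] and sq = cut_chain_segment[OF ch that(3)]
    have con: "connected L" using ch unfolding cut_chain_def by blast
    show ?thesis
    proof (rule ccontr)
      assume n: "p \<notin> segment_from L b q"
      then have 1: "p \<in> segment_from L a q" using sq that unfolding splits_def by blast
      have "connected (segment_from L b p)" "segment_from L b p \<subseteq> L" "p \<in> segment_from L b p" "b \<in> segment_from L b p"
        using splits_connected[OF con splits_sym[OF sp]] sp unfolding splits_def by auto
      then have "q \<in> segment_from L b p"
        using connected_meets_split[OF sq _ _ _ 1] sq unfolding splits_def by blast
      then have "q = p" using qp sp unfolding splits_def by blast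
      then show False using n sq unfolding splits_def by blast
    qed
  qed
  show ?thesis using *[OF ch assms(2,3)] *[OF cut_chain_sym[OF ch] assms(3,2)] by blast
qed

lemma segment_from_closed_connected:
  fixes L :: "'a::t1_space set"
  assumes "cut_chain L a b" "p \<in> L"
  shows "closed (segment_from L a p)" "connected (segment_from L a p)" "segment_from L a p \<subseteq> L"
    "a \<in> segment_from L a p" "p \<in> segment_from L a p"
proof -
  note s = cut_chain_segment[OF assms]
  have "connected L" using assms(1) unfolding cut_chain_def by blast
  with s show "connected (segment_from L a p)" by (rule splits_connected[rotated])
  show "closed (segment_from L a p)" "segment_from L a p \<subseteq> L" "a \<in> segment_from L a p" "p \<in> segment_from L a p"
    using s unfolding splits_def by auto
qed

lemma segment_from_disjoint:
  fixes L :: "'a::t1_space set"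
  assumes ch: "cut_chain L a b" and "p \<in> L" "q \<in> L" "q \<notin> segment_from L a p"
  shows "segment_from L a p \<inter> segment_from L b q = {}"
proof (rule ccontr)
  assume "\<not> ?thesis"
  then obtain t where t: "t \<in> segment_from L a p" "t \<in> segment_from L b q" by blast
  have "t \<in> L" using segment_from_closed_connected(3)[OF ch assms(2)] t by blast
  then have "q \<in> segment_from L a t" using t(2) segment_from_swap[OF ch] assms by blast
  then show False using segment_from_mono[OF ch assms(2) t(1)] assms(4) by blast
qed

text \<open>Otherwise the connected set \<open>L\<close> would be the union of two disjoint nonempty
  closed sets. This density of the order makes room for a transversal between two points.\<close>

lemma segment_from_between:
  fixes L :: "'a::t1_space set"
  assumes ch: "cut_chain L a b" and "p \<in> L" "q \<in> L" "q \<notin> segment_from L a p"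
  shows "\<exists>s\<in>L. s \<notin> segment_from L a p \<and> s \<notin> segment_from L b q"
proof (rule ccontr)
  assume "\<not> ?thesis"
  then have "L = segment_from L a p \<union> segment_from L b q"
    using segment_from_closed_connected(3)[OF ch assms(2)]
      segment_from_closed_connected(3)[OF cut_chain_sym[OF ch] assms(3)] by blast
  moreover have "connected L" using ch unfolding cut_chain_def by blast
  ultimately show False
    using segment_from_disjoint[OF assms] connected_closed_set[of L]
      segment_from_closed_connected(1,4)[OF ch assms(2)]
      segment_from_closed_connected(1,4)[OF cut_chain_sym[OF ch] assms(3)]
    by (metis closed_Un empty_iff)
qed

section \<open>Level sets of a function on the disc with two boundary sections\<close>

definition level :: "(complex \<Rightarrow> real) \<Rightarrow> real \<Rightarrow> complex set" where
  "level f y = {p \<in> cball 0 1. f p = y}"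

definition section_through :: "(complex \<Rightarrow> real) \<Rightarrow> complex \<Rightarrow> complex set \<Rightarrow> bool" where
  "section_through f s S \<longleftrightarrow>
    compact S \<and> connected S \<and> S \<subseteq> cball 0 1 \<and> inj_on f S \<and> s \<in> S \<and> (\<exists>q\<in>S. f q < f s)"

text \<open>In contrast to \<open>section_through\<close> no direction is prescribed: through a
  point of the maximal level such a set can only descend, through one of the minimal level only
  ascend.\<close>

definition transversal :: "(complex \<Rightarrow> real) \<Rightarrow> complex \<Rightarrow> complex set \<Rightarrow> bool" where
  "transversal f s S \<longleftrightarrow>
    compact S \<and> connected S \<and> S \<subseteq> cball 0 1 \<and> inj_on f S \<and> s \<in> S \<and> S \<noteq> {s}"

definition initial :: "(complex \<Rightarrow> real) \<Rightarrow> (real \<Rightarrow> complex) \<Rightarrow> complex \<Rightarrow> complex set" where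
  "initial f a w = segment_from (level f (f w)) (a (f w)) w"

lemma level_uminus: "level (\<lambda>z. - f z) y = level f (- y)"
  unfolding level_def by auto

lemma initial_uminus: "initial (\<lambda>z. - f z) (\<lambda>y. a (- y)) = initial f a"
  unfolding initial_def level_uminus by auto

lemma regular_point_uminus:
  assumes "regular_point W f p"
  shows "regular_point W (\<lambda>z. - f z) p"
proof -
  obtain U r \<phi> \<phi>' where *: "p \<in> W" "open U" "p \<in> U" "U \<subseteq> W" "r > 0"
      "homeomorphism U (ball 0 r) \<phi> \<phi>'" "\<phi> p = 0" "\<And>z. z \<in> ball 0 r \<Longrightarrow> f (\<phi>' z) = Re z + f p"
    using assms unfolding regular_point_def by blast
  have neg: "homeomorphism (ball 0 r) (ball 0 r) uminus (uminus :: complex \<Rightarrow> complex)"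
    by (rule homeomorphismI) (auto intro!: continuous_intros)
  have "homeomorphism U (ball 0 r) (uminus \<circ> \<phi>) (\<phi>' \<circ> uminus)"
    by (rule homeomorphism_compose[OF *(6) neg])
  then show ?thesis unfolding regular_point_def using *
    by (intro conjI exI[of _ U] exI[of _ r] exI[of _ "uminus \<circ> \<phi>"] exI[of _ "\<phi>' \<circ> uminus"]) auto
qed

text \<open>The circle is normalised into four arcs: \<open>a\<close> and \<open>b\<close> are the
  two monotone arcs, parametrised by the value of \<open>f\<close>, and the end levels are the other
  two. Coincidence of \<open>a y\<close> and \<open>b y\<close> is excluded only for intermediate
  \<open>y\<close>, so that an end arc may be a point. The assumptions are invariant under
  \<open>swap\<close> and \<open>flip\<close>, which turn each one-sided lemma into its mirror
  images.\<close>

locale disc_flow =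
  fixes f :: "complex \<Rightarrow> real" and m M :: real and a b :: "real \<Rightarrow> complex"
  assumes mM: "m < M"
    and cont_f: "continuous_on (cball 0 1) f"
    and cont_a: "continuous_on {m..M} a"
    and cont_b: "continuous_on {m..M} b"
    and a_on: "y \<in> {m..M} \<Longrightarrow> norm (a y) = 1 \<and> f (a y) = y"
    and b_on: "y \<in> {m..M} \<Longrightarrow> norm (b y) = 1 \<and> f (b y) = y"
    and circle_cover: "norm p = 1 \<Longrightarrow> p \<in> a ` {m..M} \<or> p \<in> b ` {m..M} \<or> f p = m \<or> f p = M"
    and a_neq_b: "m < y \<Longrightarrow> y < M \<Longrightarrow> a y \<noteq> b y"
    and regular: "norm p < 1 \<Longrightarrow> regular_point (ball 0 1) f p"
    and end_chain: "y \<in> {m, M} \<Longrightarrow> cut_chain {p \<in> sphere 0 1. f p = y} (a y) (b y)"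
    and end_sections: "y \<in> {m, M} \<Longrightarrow> norm p = 1 \<Longrightarrow> f p = y \<Longrightarrow> p \<notin> {a y, b y} \<Longrightarrow> open V \<Longrightarrow> p \<in> V \<Longrightarrow>
      \<exists>s\<in>V. f s = y \<and> (\<exists>S. transversal f s S)"
begin

lemma swap: "disc_flow f m M b a"
proof
  show "y \<in> {m, M} \<Longrightarrow> norm p = 1 \<Longrightarrow> f p = y \<Longrightarrow> p \<notin> {b y, a y} \<Longrightarrow> open V \<Longrightarrow> p \<in> V \<Longrightarrow>
      \<exists>s\<in>V. f s = y \<and> (\<exists>S. transversal f s S)" for y p V using end_sections[of y p V] by auto
  show "norm p = 1 \<Longrightarrow> p \<in> b ` {m..M} \<or> p \<in> a ` {m..M} \<or> f p = m \<or> f p = M" for p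
    using circle_cover by blast
  show "y \<in> {m, M} \<Longrightarrow> cut_chain {p \<in> sphere 0 1. f p = y} (b y) (a y)" for y
    using cut_chain_sym[OF end_chain] .
  show "m < y \<Longrightarrow> y < M \<Longrightarrow> b y \<noteq> a y" for y using a_neq_b[of y] by metis
qed (use mM cont_f cont_a cont_b a_on b_on regular in auto)

lemma flip: "disc_flow (\<lambda>z. - f z) (- M) (- m) (\<lambda>y. a (- y)) (\<lambda>y. b (- y))"
proof
  have im: "uminus ` {-M..-m} = {m..M}" by simp
  show "continuous_on {- M..- m} (\<lambda>y. a (- y))"
    by (rule continuous_on_compose2[OF cont_a]) (auto intro!: continuous_intros)
  show "continuous_on {- M..- m} (\<lambda>y. b (- y))"
    by (rule continuous_on_compose2[OF cont_b]) (auto intro!: continuous_intros)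
  show "norm p = 1 \<Longrightarrow> p \<in> (\<lambda>y. a (- y)) ` {- M..- m} \<or> p \<in> (\<lambda>y. b (- y)) ` {- M..- m} \<or> - f p = - M \<or> - f p = - m" for p
    using circle_cover[of p] im by (metis image_image)
  show "y \<in> {- M, - m} \<Longrightarrow> cut_chain {p \<in> sphere 0 1. - f p = y} (a (- y)) (b (- y))" for y
  proof -
    assume "y \<in> {- M, - m}"
    moreover have "{p \<in> sphere 0 1. - f p = y} = {p \<in> sphere 0 1. f p = - y}" by auto
    ultimately show ?thesis using end_chain[of "- y"] by auto
  qed
  have tr: "transversal (\<lambda>z. - f z) = transversal f" by (auto simp: transversal_def inj_on_def fun_eq_iff)
  show "y \<in> {- M, - m} \<Longrightarrow> norm p = 1 \<Longrightarrow> - f p = y \<Longrightarrow> p \<notin> {a (- y), b (- y)} \<Longrightarrow> open V \<Longrightarrow> p \<in> V \<Longrightarrow>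
      \<exists>s\<in>V. - f s = y \<and> (\<exists>S. transversal (\<lambda>z. - f z) s S)" for y p V
    using end_sections[of "- y" p V] unfolding tr by force
qed (use mM cont_f a_on b_on regular regular_point_uminus a_neq_b in \<open>auto intro!: continuous_intros\<close>)

lemma chart:
  assumes "norm p < 1"
  obtains r \<phi>' where "r > 0" "continuous_on (ball 0 r) \<phi>'" "inj_on \<phi>' (ball 0 r)" "\<phi>' 0 = p"
    "\<And>V. open V \<Longrightarrow> V \<subseteq> ball 0 r \<Longrightarrow> open (\<phi>' ` V)" "\<phi>' ` ball 0 r \<subseteq> ball 0 1"
    "\<And>z. z \<in> ball 0 r \<Longrightarrow> f (\<phi>' z) = Re z + f p"
proof -
  obtain U r \<phi> \<phi>' where *: "open U" "p \<in> U" "U \<subseteq> ball 0 1" "r > 0"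
      "homeomorphism U (ball 0 r) \<phi> \<phi>'" "\<phi> p = 0" "\<And>z. z \<in> ball 0 r \<Longrightarrow> f (\<phi>' z) = Re z + f p"
    using regular[OF assms] unfolding regular_point_def by blast
  show thesis
  proof
    show "r > 0" by fact
    show "continuous_on (ball 0 r) \<phi>'" "\<phi>' ` ball 0 r \<subseteq> ball 0 1" using * by (auto simp: homeomorphism_def)
    show "inj_on \<phi>' (ball 0 r)" using *(5) by (metis homeomorphism_apply2 inj_on_inverseI)
    show "\<phi>' 0 = p" using * by (metis homeomorphism_apply1)
    show "open (\<phi>' ` V)" if "open V" "V \<subseteq> ball 0 r" for V
    proof -
      have "openin (top_of_set (ball 0 r)) V" using that by (simp add: open_subset)
      then have "openin (top_of_set U) (\<phi>' ` V)"
        using homeomorphism_imp_open_map[OF homeomorphism_symD[OF *(5)]] by blast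
      then show ?thesis using *(1) by (metis openin_open_trans)
    qed
  qed (use * in auto)
qed

text \<open>In a chart \<open>f\<close> is the real part up to a constant, so a small step in the
  positive real direction raises it.\<close>

lemma above_in_ball:
  assumes "norm p < 1" "open V" "p \<in> V"
  shows "\<exists>q\<in>V. norm q < 1 \<and> f p < f q"
proof -
  obtain r \<phi>' where *: "r > 0" "continuous_on (ball 0 r) \<phi>'" "\<phi>' 0 = p" "\<phi>' ` ball 0 r \<subseteq> ball 0 1"
    "\<And>z. z \<in> ball 0 r \<Longrightarrow> f (\<phi>' z) = Re z + f p" using chart[OF assms(1)] by metis
  have "open (ball 0 r \<inter> \<phi>' -` V)" using *(2) assms(2) by (simp add: continuous_open_preimage)
  moreover have "0 \<in> ball 0 r \<inter> \<phi>' -` V" using * assms by auto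
  ultimately obtain e where "e > 0" "ball 0 e \<subseteq> ball 0 r \<inter> \<phi>' -` V" using openE by blast
  moreover have "complex_of_real (e/2) \<in> ball 0 e" using \<open>e > 0\<close> by (simp add: norm_divide)
  ultimately have e: "complex_of_real (e/2) \<in> ball 0 r" "\<phi>' (of_real (e/2)) \<in> V" by blast+
  then have "\<phi>' (of_real (e/2)) \<in> ball 0 1" using *(4) by blast
  then show ?thesis using *(5)[OF e(1)] e \<open>e > 0\<close> by (intro bexI[of _ "\<phi>' (of_real (e/2))"]) auto
qed

lemma f_le: assumes "norm p \<le> 1" shows "f p \<le> M"
proof -
  obtain q where q: "q \<in> cball 0 1" "\<And>x. x \<in> cball 0 1 \<Longrightarrow> f x \<le> f q"
    using continuous_attains_sup[OF compact_cball _ cont_f] by auto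
  have "\<not> norm q < 1"
  proof
    assume "norm q < 1"
    then obtain x where "norm x < 1" "f q < f x" using above_in_ball[of q UNIV] by auto
    then show False using q(2)[of x] by simp
  qed
  then have "norm q = 1" using q by simp
  then have "f q \<le> M" using circle_cover[of q] a_on b_on mM by auto
  then show ?thesis using q(2)[of p] assms by simp
qed

lemma f_less: assumes "norm p < 1" shows "f p < M"
proof -
  obtain x where "norm x < 1" "f p < f x" using above_in_ball[OF assms, of UNIV] by auto
  then show ?thesis using f_le[of x] by simp
qed

lemma f_ge: "norm p \<le> 1 \<Longrightarrow> m \<le> f p"
  using disc_flow.f_le[OF flip, of p] by simp

lemma f_greater: "norm p < 1 \<Longrightarrow> m < f p"
  using disc_flow.f_less[OF flip, of p] by simp

text \<open>A chart gives a higher point inside; on the two sections one moves along the section; on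
  the bottom level every nearby interior point is higher. Together this excludes local maxima below
  \<open>M\<close> on the closed disc.\<close>

lemma above:
  assumes "norm p \<le> 1" "f p < M" "open V" "p \<in> V"
  shows "\<exists>q\<in>V. norm q \<le> 1 \<and> f p < f q"
proof -
  have ends: ?thesis if g: "continuous_on {m..M} g" "\<And>y. y \<in> {m..M} \<Longrightarrow> norm (g y) = 1 \<and> f (g y) = y"
      and y: "p = g y" "y \<in> {m..M}" for g y
  proof -
    have "y < M" using y g(2) assms(2) by auto
    have "(g \<longlongrightarrow> g y) (at y within {m..M})" using g y by (simp add: continuous_on_def)
    then have "\<forall>\<^sub>F x in at y within {m..M}. g x \<in> V" using assms y by (simp add: topological_tendstoD)
    then obtain d where d: "d > 0" "\<And>x. x \<in> {m..M} \<Longrightarrow> x \<noteq> y \<Longrightarrow> dist x y < d \<Longrightarrow> g x \<in> V"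
      unfolding eventually_at by blast
    define x where "x = min M (y + d/2)"
    have x: "x \<in> {m..M}" "x > y" "dist x y < d" using d \<open>y < M\<close> y by (auto simp: x_def dist_real_def)
    then show ?thesis using d(2)[of x] g(2)[of x] g(2)[OF y(2)] y by (intro bexI[of _ "g x"]) auto
  qed
  show ?thesis
  proof (cases "norm p < 1")
    case True
    then obtain q where "q \<in> V" "norm q < 1" "f p < f q" using above_in_ball[OF True assms(3,4)] by blast
    then show ?thesis by (intro bexI[of _ q]) auto
  next
    case False
    then have "norm p = 1" using assms by simp
    then consider "p \<in> a ` {m..M}" | "p \<in> b ` {m..M}" | "f p = m" using circle_cover assms by fastforce
    then show ?thesis
    proof cases
      case 1 then show ?thesis using ends[OF cont_a a_on] by blast
    next
      case 2 then show ?thesis using ends[OF cont_b b_on] by blast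
    next
      case 3
      have "p \<in> closure (ball 0 1)" using assms by simp
      then obtain q where "q \<in> V" "norm q < 1" using assms
        by (metis closure_iff_nhds_not_empty disjoint_iff mem_ball_0 order_refl)
      then show ?thesis using f_greater[of q] 3 by (intro bexI[of _ q]) auto
    qed
  qed
qed

lemma top_level: "level f M = {p \<in> sphere 0 1. f p = M}"
  unfolding level_def using f_less by (force simp: order_less_le)

lemma bottom_level: "level f m = {p \<in> sphere 0 1. f p = m}"
  unfolding level_def using f_greater by (force simp: order_less_le)

lemma closed_le: "closed {p \<in> cball 0 1. y \<le> f p}"
  using continuous_closed_preimage[OF cont_f closed_cball, of "{y..}"]
  by (auto simp: vimage_def Int_def)

lemma closed_ge: "closed {p \<in> cball 0 1. f p \<le> y}"
  using disc_flow.closed_le[OF flip, of "- y"] by simp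

lemma level_eq: "level f y = {p \<in> cball 0 1. y \<le> f p} \<inter> {p \<in> cball 0 1. f p \<le> y}"
  unfolding level_def by auto

lemma closed_level: "closed (level f y)"
  unfolding level_eq using closed_le closed_ge by blast

text \<open>A closed and relatively open piece of the superlevel set that misses the top level would
  attain its maximum at a local maximum below \<open>M\<close>. As the top level is connected, one
  of two separating pieces always misses it.\<close>

lemma connected_le: assumes "y \<le> M" shows "connected {p \<in> cball 0 1. y \<le> f p}"
proof (rule ccontr)
  let ?S = "{p \<in> cball 0 1. y \<le> f p}"
  assume "\<not> connected ?S"
  then obtain P Q where PQ: "closed P" "closed Q" "P \<union> Q = ?S" "P \<inter> Q = {}" "P \<noteq> {}" "Q \<noteq> {}"
    using closed_le by (auto simp: connected_closed_set)
  have *: False if PQ: "closed P" "closed Q" "P \<union> Q = ?S" "P \<inter> Q = {}" "Q \<noteq> {}" "Q \<inter> level f M = {}" for P Q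
  proof -
    have Q: "Q \<subseteq> cball 0 1" using PQ by blast
    then have "compact Q" using PQ(2) by (meson bounded_cball bounded_subset compact_eq_bounded_closed)
    then obtain q where q: "q \<in> Q" "\<And>x. x \<in> Q \<Longrightarrow> f x \<le> f q"
      using continuous_attains_sup[of Q f] PQ(5) continuous_on_subset[OF cont_f Q] by blast
    have "norm q \<le> 1" "f q \<noteq> M" "y \<le> f q" using q(1) PQ Q by (auto simp: level_def)
    then have "f q < M" using f_le[of q] by simp
    then obtain x where "x \<in> - P" "norm x \<le> 1" "f q < f x"
      using above[of q "- P"] q(1) PQ \<open>norm q \<le> 1\<close> by auto
    then have "x \<in> Q" using PQ \<open>y \<le> f q\<close> by auto
    then show False using q(2) \<open>f q < f x\<close> by fastforce
  qed
  have T: "connected (level f M)" "level f M \<subseteq> P \<union> Q"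
    using end_chain[of M] top_level assms PQ(3) unfolding cut_chain_def by (auto simp: level_def)
  then have "P \<inter> level f M = {} \<or> Q \<inter> level f M = {}"
    using connected_closedD[OF T(1), of P Q] PQ by blast
  then show False using *[of P Q] *[of Q P] PQ by (metis Un_commute Int_commute)
qed

lemma connected_ge: "m \<le> y \<Longrightarrow> connected {p \<in> cball 0 1. f p \<le> y}"
  using disc_flow.connected_le[OF flip, of "- y"] by simp

lemma connected_level: assumes "y \<in> {m..M}" shows "connected (level f y)"
proof -
  have 1: "unicoherent (cball (0::complex) 1)" by (rule convex_imp_unicoherent) simp
  show ?thesis unfolding level_eq
    using assms by (intro unicoherentD[OF 1] connected_le connected_ge closed_subset closed_le closed_ge) auto
qed

lemma connected_less: "connected {p \<in> cball 0 1. y < f p}"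
proof -
  have eq: "{p \<in> cball 0 1. y < f p} = \<Union> ((\<lambda>v. {p \<in> cball 0 1. v \<le> f p}) ` {y<..M})"
    using f_le by fastforce
  have "a M \<in> \<Inter> ((\<lambda>v. {p \<in> cball 0 1. v \<le> f p}) ` {y<..M})" using a_on[of M] mM by auto
  then show ?thesis unfolding eq
    by (intro connected_Union) (use connected_le in auto)
qed

lemma connected_greater: "connected {p \<in> cball 0 1. f p < y}"
  using disc_flow.connected_less[OF flip, of "- y"] by simp

text \<open>The crossing principle for the circle cut at \<open>a y'\<close> and \<open>b y\<close>:
  \<open>X\<close> is the part through the top level, \<open>Y\<close> the part through the bottom
  level. The two heights may differ, as the comparison of neighbouring levels requires;
  \<open>y' < M\<close> and \<open>m < y\<close> keep the end levels from contributing further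
  common points.\<close>

lemma crossing:
  assumes y: "m \<le> y'" "y' \<le> y" "y \<le> M" "y' < M" "m < y"
    and G: "compact G" "connected G" "G \<subseteq> cball 0 1" "a y' \<in> G" "b y \<in> G"
    and H: "connected H" "H \<subseteq> cball 0 1"
    and p: "p \<in> H" "p \<in> a ` {y'..M} \<union> level f M"
    and q: "q \<in> H" "q \<in> level f m"
  shows "G \<inter> H \<noteq> {}"
proof -
  define X where "X = a ` {y'..M} \<union> b ` {y..M} \<union> level f M"
  define Y where "Y = a ` {m..y'} \<union> b ` {m..y} \<union> level f m"
  have im: "closed (g ` I)" if "continuous_on {m..M} g" "compact I" "I \<subseteq> {m..M}" for g :: "real \<Rightarrow> complex" and I
    using that by (meson compact_continuous_image compact_imp_closed continuous_on_subset)
  have "closed X" "closed Y" unfolding X_def Y_def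
    using y by (auto intro!: closed_Un im cont_a cont_b closed_level)
  moreover have "X \<union> Y = sphere 0 1"
  proof
    show "X \<union> Y \<subseteq> sphere 0 1" unfolding X_def Y_def top_level bottom_level
      using y a_on b_on by auto
    show "sphere 0 1 \<subseteq> X \<union> Y"
    proof
      fix x :: complex assume x: "x \<in> sphere 0 1"
      then consider v where "x = a v" "v \<in> {m..M}" | v where "x = b v" "v \<in> {m..M}"
        | "x \<in> level f m" | "x \<in> level f M"
        using circle_cover[of x] by (auto simp: level_def)
      then show "x \<in> X \<union> Y"
      proof cases
        case 1 then show ?thesis by (cases "v \<le> y'") (auto simp: X_def Y_def)
      next
        case 2 then show ?thesis by (cases "v \<le> y") (auto simp: X_def Y_def)
      qed (auto simp: X_def Y_def)
    qed
  qed
  moreover have "X \<inter> Y \<subseteq> G"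
  proof
    fix x assume x: "x \<in> X \<inter> Y"
    have eq: "f (a v) = v" "f (b v) = v" if "v \<in> {m..M}" for v using a_on b_on that by auto
    have fX: "(x = a (f x) \<and> y' \<le> f x) \<or> (x = b (f x) \<and> y \<le> f x) \<or> f x = M"
      using x eq y unfolding X_def by (auto simp: level_def)
    have fY: "(x = a (f x) \<and> f x \<le> y') \<or> (x = b (f x) \<and> f x \<le> y) \<or> f x = m"
      using x eq y unfolding Y_def by (auto simp: level_def)
    have ab: "f x = m \<or> f x = M" if "x = a (f x)" "x = b (f x)"
    proof -
      have "norm x \<le> 1" using x y a_on b_on unfolding X_def level_def by fastforce
      then show ?thesis using f_le[of x] f_ge[of x] a_neq_b[of "f x"] that by force
    qed
    have "(x = a (f x) \<and> f x = y') \<or> (x = b (f x) \<and> f x = y)"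
      using fX fY ab y by (smt (verit))
    then show "x \<in> G" using G by auto
  qed
  ultimately show ?thesis
    using crossing_in_disc[OF G(1-3) H, of X Y p q] p q unfolding X_def Y_def by blast
qed

text \<open>The arc \<open>J\<close> bridges the gap between the two separated pieces, so cutting it
  at parameter 0 cuts the whole set.\<close>

lemma splits_insert_arc:
  fixes J :: "real \<Rightarrow> complex"
  assumes PQ: "closed P" "closed Q" "P \<inter> Q = {}" "a' \<in> P" "b' \<in> Q"
    and J: "continuous_on {-e..e} J" "inj_on J {-e..e}" "J 0 = p" "J (- e) \<in> P" "J e \<in> Q" "e > 0"
      "J ` {-e<..<e} \<inter> (P \<union> Q) = {}"
  shows "splits (P \<union> Q \<union> J ` {-e..e}) a' b' p (P \<union> J ` {-e..0}) (Q \<union> J ` {0..e})"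
proof -
  have cl: "closed (J ` I)" if "compact I" "I \<subseteq> {-e..e}" for I
    using that by (meson compact_continuous_image compact_imp_closed continuous_on_subset J(1))
  have notPQ: "J x \<notin> P \<and> J x \<notin> Q" if "x \<in> {-e<..<e}" for x
    using J(7) imageI[OF that, of J] by blast
  have "{-e..e} = {-e..0} \<union> {0..e}" using J by auto
  then have un: "J ` {-e..e} = J ` {-e..0} \<union> J ` {0..e}" by auto
  have "(P \<union> J ` {-e..0}) \<inter> (Q \<union> J ` {0..e}) \<subseteq> {p}"
  proof
    fix x assume x: "x \<in> (P \<union> J ` {-e..0}) \<inter> (Q \<union> J ` {0..e})"
    consider "x \<in> P" "x \<in> Q" | v where "x \<in> P" "x = J v" "v \<in> {0..e}"
      | v where "x \<in> Q" "x = J v" "v \<in> {-e..0}"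
      | v w where "x = J v" "x = J w" "v \<in> {-e..0}" "w \<in> {0..e}" using x by blast
    then show "x \<in> {p}"
    proof cases
      case 1 then show ?thesis using PQ by blast
    next
      case 2
      then have "v = e" using notPQ[of v] by fastforce
      then show ?thesis using 2 J(5) PQ by blast
    next
      case 3
      then have "v = -e" using notPQ[of v] by fastforce
      then show ?thesis using 3 J(4) PQ by blast
    next
      case 4
      then have "v = w" using inj_onD[OF J(2), of v w] by auto
      then show ?thesis using 4 J by auto
    qed
  qed
  moreover have "p \<in> J ` {-e..0}" "p \<in> J ` {0..e}" using J(3,6) by (auto intro!: image_eqI[of _ _ 0])
  ultimately show ?thesis unfolding splits_def un using PQ J(6) by (auto intro!: closed_Un cl)
qed

text \<open>A short open arc of the level around \<open>p\<close> is removed. A continuum in the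
  rest joining \<open>a y\<close> to \<open>b y\<close> would have to meet the union of
  \<open>p\<close> with the points above and below the level, a connected set that leads from the
  top to the bottom level and touches the level only in \<open>p\<close>. So the rest falls into two
  pieces, and the removed arc, put back, joins them through \<open>p\<close>.\<close>

lemma level_splits:
  assumes y: "m < y" "y < M" and p: "p \<in> level f y" "p \<notin> {a y, b y}"
  shows "\<exists>P Q. splits (level f y) (a y) (b y) p P Q"
proof -
  have fp: "norm p \<le> 1" "f p = y" using p by (auto simp: level_def)
  have "norm p \<noteq> 1"
  proof
    assume "norm p = 1"
    then have "p = a (f p) \<or> p = b (f p)" using circle_cover[of p] y fp a_on b_on by auto
    then show False using p fp by auto
  qed
  then have "norm p < 1" using fp by simp
  then obtain r \<phi> where r: "r > 0" and \<phi>: "continuous_on (ball 0 r) \<phi>" "inj_on \<phi> (ball 0 r)" "\<phi> 0 = p"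
    "\<And>V. open V \<Longrightarrow> V \<subseteq> ball 0 r \<Longrightarrow> open (\<phi> ` V)" "\<phi> ` ball 0 r \<subseteq> ball 0 1"
    "\<And>z. z \<in> ball 0 r \<Longrightarrow> f (\<phi> z) = Re z + f p" using chart[of p] by metis
  define e where "e = r/2"
  have e: "e > 0" "e < r" using r by (auto simp: e_def)
  \<comment> \<open>In the chart the level of \<open>p\<close> is the imaginary axis.\<close>
  define J where "J t = \<phi> (\<i> * of_real t)" for t :: real
  have inb: "\<i> * of_real t \<in> ball 0 r" if "t \<in> {-e..e}" for t :: real
  proof -
    have "\<bar>t\<bar> < r" using that e by auto
    then show ?thesis by (simp add: norm_mult)
  qed
  have Jc: "continuous_on {-e..e} J" unfolding J_def
    by (rule continuous_on_compose2[OF \<phi>(1)]) (use inb in \<open>auto intro!: continuous_intros\<close>)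
  have Ji: "inj_on J {-e..e}"
  proof (rule inj_onI)
    fix t v assume tv: "t \<in> {-e..e}" "v \<in> {-e..e}" "J t = J v"
    then have "\<i> * complex_of_real t = \<i> * of_real v"
      using inj_onD[OF \<phi>(2)] inb unfolding J_def by blast
    then show "t = v" by simp
  qed
  have Jl: "J t \<in> level f y" if "t \<in> {-e..e}" for t
    using \<phi>(5) \<phi>(6)[OF inb[OF that]] inb[OF that] fp unfolding J_def level_def
    by (auto simp: image_subset_iff less_imp_le)
  \<comment> \<open>Cutting the chart ball down to a strip makes the removed part of the level
    exactly the open arc of \<open>J\<close> over parameters between \<open>-e\<close> and
    \<open>e\<close>, so that the end points of the arc remain in \<open>S\<close>.\<close>
  define V where "V = ball 0 r \<inter> {z. \<bar>Im z\<bar> < e}"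
  have "open {z. \<bar>Im z\<bar> < e}" by (intro open_Collect_less continuous_intros)
  then have "open V" unfolding V_def by blast
  have VJ: "level f y \<inter> \<phi> ` V = J ` {-e<..<e}"
  proof
    show "level f y \<inter> \<phi> ` V \<subseteq> J ` {-e<..<e}"
    proof
      fix x assume "x \<in> level f y \<inter> \<phi> ` V"
      then obtain z where z: "x = \<phi> z" "z \<in> V" "f x = y" by (auto simp: level_def)
      then have "Re z = 0" using \<phi>(6)[of z] fp by (simp add: V_def)
      then have "z = \<i> * of_real (Im z)" by (simp add: complex_eq_iff)
      then show "x \<in> J ` {-e<..<e}" using z by (auto simp: J_def V_def intro!: image_eqI[of _ _ "Im z"])
    qed
    show "J ` {-e<..<e} \<subseteq> level f y \<inter> \<phi> ` V"
    proof clarify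
      fix t assume t: "t \<in> {-e<..<e}"
      then have "\<i> * of_real t \<in> V" using inb[of t] by (auto simp: V_def)
      then show "J t \<in> level f y \<inter> \<phi> ` V" using Jl[of t] t by (auto simp: J_def)
    qed
  qed
  define S where "S = level f y - \<phi> ` V"
  have S: "S = level f y - J ` {-e<..<e}" unfolding S_def using VJ by blast
  have "open (\<phi> ` V)" using \<phi>(4) \<open>open V\<close> by (simp add: V_def)
  then have "closed S" unfolding S_def using closed_level by blast
  moreover have S1: "S \<subseteq> cball 0 1" unfolding S_def level_def by blast
  ultimately have "compact S" by (meson bounded_cball bounded_subset compact_eq_bounded_closed)
  have ab: "a y \<in> S" "b y \<in> S"
    using a_on[of y] b_on[of y] y \<phi>(5) by (auto simp: S_def level_def V_def image_subset_iff)
  have pJ: "p \<in> J ` {-e<..<e}" using e \<phi>(3) by (auto simp: J_def intro!: image_eqI[of _ _ 0])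
  \<comment> \<open>As \<open>f\<close> has no local extremum at \<open>p\<close>, this point is in
    the closure of both halves and glues them together.\<close>
  define H where "H = insert p {x \<in> cball 0 1. y < f x} \<union> insert p {x \<in> cball 0 1. f x < y}"
  have ins: "connected (insert p C)" if "connected C" "p \<in> closure C" for C
    using connected_intermediate_closure[OF that(1), of "insert p C"] that(2) closure_subset by blast
  have "p \<in> closure {x \<in> cball 0 1. y < f x}"
    unfolding closure_iff_nhds_not_empty
  proof clarify
    fix A W assume "W \<subseteq> A" "open W" "p \<in> W" "{x \<in> cball 0 1. y < f x} \<inter> A = {}"
    then show False using above[OF fp(1), of W] fp y by auto
  qed
  moreover have "p \<in> closure {x \<in> cball 0 1. f x < y}"
    unfolding closure_iff_nhds_not_empty
  proof clarify
    fix A W assume "W \<subseteq> A" "open W" "p \<in> W" "{x \<in> cball 0 1. f x < y} \<inter> A = {}"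
    then show False using disc_flow.above[OF flip fp(1), of W] fp y by auto
  qed
  ultimately have "connected (insert p {x \<in> cball 0 1. y < f x})" "connected (insert p {x \<in> cball 0 1. f x < y})"
    using ins[OF connected_less] ins[OF connected_greater] by blast+
  then have "connected H" unfolding H_def by (rule connected_Un) blast
  have Hm: "a M \<in> H" "a m \<in> H" "a M \<in> level f M" "a m \<in> level f m"
    using a_on[of M] a_on[of m] mM y by (auto simp: H_def level_def)
  obtain P Q where PQ: "closed P" "closed Q" "P \<union> Q = S" "P \<inter> Q = {}" "a y \<in> P" "b y \<in> Q"
  proof (rule compact_separation[OF \<open>compact S\<close> ab])
    fix C assume C: "compact C" "connected C" "C \<subseteq> S" "a y \<in> C" "b y \<in> C"
    have "H \<subseteq> cball 0 1" using fp by (auto simp: H_def)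
    then have "C \<inter> H \<noteq> {}"
      using C S1 y \<open>connected H\<close> Hm by (intro crossing[of y y C H "a M" "a m"]) auto
    moreover have "C \<inter> H = {}"
      using C(3) pJ by (auto simp: H_def S level_def)
    ultimately show False by blast
  qed (rule that)
  have J0: "J 0 = p" using \<phi>(3) by (simp add: J_def)
  have ends: "J e \<in> P \<union> Q" "J (-e) \<in> P \<union> Q"
  proof -
    have "J v \<notin> J ` {-e<..<e}" if "v \<in> {e, -e}" for v
    proof
      assume "J v \<in> J ` {-e<..<e}"
      then obtain w where "J v = J w" "w \<in> {-e<..<e}" by blast
      then have "v = w" using inj_onD[OF Ji, of v w] that e by auto
      then show False using that \<open>w \<in> _\<close> by auto
    qed
    then show "J e \<in> P \<union> Q" "J (-e) \<in> P \<union> Q" unfolding PQ(3) S using Jl e by auto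
  qed
  have JPQ: "J ` {-e<..<e} \<inter> (P \<union> Q) = {}" unfolding PQ(3) S by blast
  have "{-e..e} = {-e<..<e} \<union> {-e, e}" using e by auto
  then have Jim: "J ` {-e..e} = J ` {-e<..<e} \<union> {J (-e), J e}" by (auto simp: image_Un)
  have "J ` {-e<..<e} \<subseteq> level f y" using VJ by blast
  then have cover: "level f y = P \<union> Q \<union> J ` {-e..e}"
    unfolding Jim using PQ(3) S ends by blast
  \<comment> \<open>If both ends of the arc were attached to the same piece, the level itself would
    be disconnected.\<close>
  have same: False if "closed P" "closed Q" "P \<union> Q = S" "P \<inter> Q = {}" "Q \<noteq> {}" "J (-e) \<in> P" "J e \<in> P" for P Q
  proof -
    have "closed (J ` {-e..e})" by (intro compact_imp_closed compact_continuous_image Jc) simp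
    then have "closed (P \<union> J ` {-e..e})" using that by blast
    moreover have "(P \<union> J ` {-e..e}) \<inter> Q = {}"
      unfolding Jim using that S by blast
    moreover have "level f y = S \<union> J ` {-e..e}" using cover PQ(3) by simp
    then have "(P \<union> J ` {-e..e}) \<union> Q = level f y" using that(3) by blast
    moreover have "P \<union> J ` {-e..e} \<noteq> {}" using that(6) by auto
    moreover have "connected (level f y)" using connected_level[of y] y by simp
    ultimately show False
      using that(2,5) connected_closed_set[OF closed_level, of y] by blast
  qed
  consider "J (-e) \<in> P" "J e \<in> Q" | "J (-e) \<in> Q" "J e \<in> P"
  proof -
    have "Q \<union> P = S" "Q \<inter> P = {}" using PQ by blast+
    then have 1: "\<not> (J (-e) \<in> P \<and> J e \<in> P)" "\<not> (J (-e) \<in> Q \<and> J e \<in> Q)"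
      using same[of P Q] same[of Q P] PQ by auto
    show thesis using 1 ends that by auto
  qed
  then show ?thesis
  proof cases
    case 1
    have "splits (P \<union> Q \<union> J ` {-e..e}) (a y) (b y) p (P \<union> J ` {-e..0}) (Q \<union> J ` {0..e})"
      by (rule splits_insert_arc[OF PQ(1,2,4,5,6) Jc Ji J0 1 e(1) JPQ])
    then show ?thesis unfolding cover by blast
  next
    case 2
    \<comment> \<open>The arc happens to run from \<open>Q\<close> to \<open>P\<close>; its reversal
      has the direction that \<open>splits_insert_arc\<close> expects.\<close>
    define J' where "J' t = J (- t)" for t
    have im: "uminus ` {-e..e} = {-e..e}" "uminus ` {-e<..<e} = {-e<..<e}" by auto
    have J': "continuous_on {-e..e} J'" unfolding J'_def
      by (rule continuous_on_compose2[OF Jc]) (auto intro!: continuous_intros)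
    have J'i: "inj_on J' {-e..e}"
    proof (rule inj_onI)
      fix t v assume tv: "t \<in> {-e..e}" "v \<in> {-e..e}" "J' t = J' v"
      then have "- t = - v" by (intro inj_onD[OF Ji]) (auto simp: J'_def)
      then show "t = v" by simp
    qed
    have J'im: "J' ` A = J ` uminus ` A" for A by (simp add: J'_def image_image)
    have "J' ` {-e<..<e} \<inter> (P \<union> Q) = {}" unfolding J'im im by (rule JPQ)
    then have "splits (P \<union> Q \<union> J' ` {-e..e}) (a y) (b y) p (P \<union> J' ` {-e..0}) (Q \<union> J' ` {0..e})"
      using 2 J0 by (intro splits_insert_arc PQ J' J'i e) (simp_all add: J'_def)
    then show ?thesis unfolding cover J'im im by blast
  qed
qed

lemma level_chain: assumes "y \<in> {m..M}" shows "cut_chain (level f y) (a y) (b y)"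
proof -
  consider "m < y" "y < M" | "y \<in> {m, M}" using assms by force
  then show ?thesis
  proof cases
    case 1
    then show ?thesis unfolding cut_chain_def
      using closed_level connected_level[OF assms] a_on[OF assms] b_on[OF assms] level_splits
      by (auto simp: level_def)
  next
    case 2
    then show ?thesis using end_chain[OF 2] top_level bottom_level by auto
  qed
qed

section \<open>The order along the levels and its openness\<close>

lemma f_range: "norm w \<le> 1 \<Longrightarrow> f w \<in> {m..M}"
  using f_le f_ge by auto

lemma chain_at: "norm w \<le> 1 \<Longrightarrow> cut_chain (level f (f w)) (a (f w)) (b (f w))"
  using level_chain f_range by blast

lemma in_level: "norm w \<le> 1 \<Longrightarrow> w \<in> level f (f w)"
  by (simp add: level_def)

lemma initial_closed: "norm w \<le> 1 \<Longrightarrow> closed (initial f a w)"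
  and initial_connected: "norm w \<le> 1 \<Longrightarrow> connected (initial f a w)"
  and initial_subset: "norm w \<le> 1 \<Longrightarrow> initial f a w \<subseteq> level f (f w)"
  and initial_start: "norm w \<le> 1 \<Longrightarrow> a (f w) \<in> initial f a w"
  and initial_end: "norm w \<le> 1 \<Longrightarrow> w \<in> initial f a w"
  unfolding initial_def using segment_from_closed_connected[OF chain_at in_level] by blast+

lemma initial_compact: "norm w \<le> 1 \<Longrightarrow> compact (initial f a w)"
  using initial_closed initial_subset bounded_subset[OF bounded_cball, of "initial f a w" 0 1]
  by (auto simp: level_def compact_eq_bounded_closed subset_eq)

lemma initial_level:
  "norm w \<le> 1 \<Longrightarrow> x \<in> initial f a w \<Longrightarrow> norm x \<le> 1 \<and> f x = f w"
  using initial_subset by (auto simp: level_def subset_eq)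

lemma initial_mono:
  assumes "norm w \<le> 1" "x \<in> initial f a w"
  shows "initial f a x \<subseteq> initial f a w"
  using segment_from_mono[OF chain_at in_level, OF assms(1,1)] initial_level[OF assms] assms(2)
  unfolding initial_def by auto

lemma initial_swap:
  assumes "norm p \<le> 1" "norm q \<le> 1" "f p = f q"
  shows "q \<in> initial f a p \<longleftrightarrow> p \<in> initial f b q"
  using segment_from_swap[OF chain_at in_level, OF assms(1,1), of q] in_level[OF assms(2)] assms(3)
  unfolding initial_def by auto

lemma initial_disjoint:
  assumes "norm p \<le> 1" "norm q \<le> 1" "f p = f q" "q \<notin> initial f a p"
  shows "initial f a p \<inter> initial f b q = {}"
  using segment_from_disjoint[OF chain_at in_level, OF assms(1,1), of q] in_level[OF assms(2)] assms(3,4)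
  unfolding initial_def by auto

lemma initial_between:
  assumes "norm p \<le> 1" "norm q \<le> 1" "f p = f q" "q \<notin> initial f a p"
  shows "\<exists>s\<in>level f (f p). s \<notin> initial f a p \<and> s \<notin> initial f b q"
  using segment_from_between[OF chain_at in_level, OF assms(1,1), of q] in_level[OF assms(2)] assms(3,4)
  unfolding initial_def by auto

lemma initial_Int:
  assumes "norm w \<le> 1"
  shows "initial f a w \<inter> initial f b w = {w}"
  using cut_chain_segment[OF chain_at in_level, OF assms assms] unfolding initial_def splits_def by blast

lemma initial_Un:
  assumes "norm w \<le> 1"
  shows "initial f a w \<union> initial f b w = level f (f w)"
  using cut_chain_segment[OF chain_at in_level, OF assms assms] unfolding initial_def splits_def by blast

lemma initial_antisym:
  assumes "norm w \<le> 1" "x \<in> initial f a w" "w \<in> initial f a x"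
  shows "x = w"
proof -
  have x: "norm x \<le> 1" "f w = f x" using initial_level[OF assms(1,2)] by auto
  then have "w \<in> initial f b x" using initial_swap[OF assms(1), of x] assms(2) by blast
  then have "w \<in> initial f a x \<inter> initial f b x" using assms(3) by blast
  then show ?thesis unfolding initial_Int[OF x(1)] by simp
qed

lemma initial_total:
  assumes "norm p \<le> 1" "norm q \<le> 1" "f p = f q" "q \<notin> initial f a p"
  shows "p \<in> initial f a q"
  using initial_Un[OF assms(1)] in_level[OF assms(2)] assms initial_swap[OF assms(2,1)]
  by (metis Un_iff)

text \<open>Suppose a lower point \<open>w'\<close> near \<open>w\<close> did not come after the
  point \<open>q\<close> of \<open>S\<close> on its level. Consider the part of its level from
  \<open>a\<close> to \<open>w'\<close>, a small convex neighbourhood of \<open>w\<close>, and the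
  part of the level of \<open>w\<close> from \<open>w\<close> to \<open>b\<close>. Their union has
  to cross \<open>S\<close> prolonged by a sublevel set below and by the initial segment of
  \<open>s\<close> above, yet all these pieces are disjoint. This is why a point cannot change
  sides.\<close>

lemma beyond_section:
  assumes S: "section_through f s S" and w: "norm w \<le> 1" "f w = f s" "w \<notin> initial f a s"
  shows "\<exists>e>0. \<forall>w'. norm w' \<le> 1 \<longrightarrow> dist w' w < e \<longrightarrow> f w' < f w \<longrightarrow>
    (\<exists>q\<in>S. f q = f w' \<and> w' \<notin> initial f a q)"
proof -
  obtain q0 where S': "compact S" "connected S" "S \<subseteq> cball 0 1" "inj_on f S" "s \<in> S" "q0 \<in> S" "f q0 < f s"
    using S unfolding section_through_def by blast
  have s: "norm s \<le> 1" using S' by auto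
  have q0: "norm q0 \<le> 1" using S' by auto
  define low where "low = {x \<in> cball 0 1. f x \<le> f q0}"
  \<comment> \<open>\<open>Z\<close> is the obstacle \<open>H\<close> of the crossing argument; a
    neighbourhood \<open>N\<close> chosen away from it leaves only the two levels to be checked.
    Avoiding \<open>low\<close> also keeps the level of \<open>w'\<close> within the range of
    \<open>f\<close> on \<open>S\<close>.\<close>
  define Z where "Z = S \<union> initial f a s \<union> low"
  have "closed Z" unfolding Z_def low_def
    using compact_imp_closed[OF S'(1)] initial_closed[OF s] closed_ge by (intro closed_Un)
  have "w \<notin> S" using w initial_end[OF s] inj_onD[OF S'(4), of w s] S' by blast
  then have "w \<notin> Z" unfolding Z_def low_def using w S' by auto
  then obtain e where e: "e > 0" "ball w e \<subseteq> - Z" using \<open>closed Z\<close> by (metis ComplI open_Compl openE)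
  define N where "N = cball w (e/2) \<inter> cball 0 1"
  have N: "compact N" "connected N" "N \<inter> Z = {}" "w \<in> N"
    using e w unfolding N_def by (auto intro!: compact_Int convex_connected convex_Int simp: subset_eq)
  have "w' \<notin> initial f a q" if w': "norm w' \<le> 1" "dist w' w < e/2" "f w' < f w" and q: "q \<in> S" "f q = f w'" for w' q
  proof
    assume w'q: "w' \<in> initial f a q"
    have nq: "norm q \<le> 1" using q S' by auto
    have w'N: "w' \<in> N" using w' unfolding N_def by (simp add: dist_commute)
    then have w'Z: "w' \<notin> Z" using N by blast
    then have y': "f q0 < f w'" using w' by (auto simp: Z_def low_def)
    have qw': "q \<notin> initial f a w'"
      using initial_antisym[OF nq w'q] q w'Z by (auto simp: Z_def)
    define G where "G = (initial f a w' \<union> N) \<union> initial f b w"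
    define H where "H = (low \<union> S) \<union> initial f a s"
    note bprops = disc_flow.initial_compact[OF swap w(1)] disc_flow.initial_connected[OF swap w(1)]
      disc_flow.initial_level[OF swap w(1)] disc_flow.initial_start[OF swap w(1)] disc_flow.initial_end[OF swap w(1)]
    have "compact G" unfolding G_def using initial_compact[OF w'(1)] N bprops by blast
    moreover have "connected (initial f a w' \<union> N)"
      using initial_connected[OF w'(1)] N initial_end[OF w'(1)] w'N by (intro connected_Un) auto
    then have "connected G" unfolding G_def
      by (rule connected_Un[OF _ bprops(2)]) (use bprops(5) N in blast)
    moreover have "G \<subseteq> cball 0 1" unfolding G_def N_def using initial_level[OF w'(1)] bprops(3) by auto
    moreover have "connected low" unfolding low_def using connected_ge f_ge[OF q0] by blast
    then have "connected (low \<union> S)" using S' q0 by (intro connected_Un) (auto simp: low_def)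
    then have "connected H" unfolding H_def
      by (rule connected_Un[OF _ initial_connected[OF s]]) (use initial_end[OF s] S' in blast)
    moreover have "H \<subseteq> cball 0 1" unfolding H_def low_def using S' initial_level[OF s] by auto
    moreover have "a (f w') \<in> G" "b (f w) \<in> G" unfolding G_def using initial_start[OF w'(1)] bprops(4) by blast+
    moreover have "a (f s) \<in> H" "a (f s) \<in> a ` {f w'..M}"
      using initial_start[OF s] f_le[OF s] w w' by (auto simp: H_def)
    moreover have "a m \<in> H" "a m \<in> level f m"
      using a_on[of m] mM f_ge[OF q0] by (auto simp: H_def low_def level_def)
    ultimately have "G \<inter> H \<noteq> {}"
      using crossing[of "f w'" "f w" G H "a (f s)" "a m"] f_ge[OF w'(1)] f_le[OF w(1)] w'(3) by auto
    moreover have "G \<inter> H = {}"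
    proof (rule ccontr)
      assume "G \<inter> H \<noteq> {}"
      then obtain x where x: "x \<in> G" "x \<in> H" by blast
      have "x \<notin> N" using x(2) N unfolding H_def Z_def by blast
      then consider "x \<in> initial f a w'" | "x \<in> initial f b w" using x(1) unfolding G_def by blast
      then show False
      proof cases
        case 1
        then have "f x = f w'" using initial_level[OF w'(1)] by blast
        then have "x \<notin> low" "x \<notin> initial f a s" using y' w w'(3) initial_level[OF s] by (force simp: low_def)+
        then have "x \<in> S" using x(2) unfolding H_def by blast
        then have "x = q" using inj_onD[OF S'(4), of x q] q \<open>f x = f w'\<close> by simp
        then show False using 1 qw' by blast
      next
        case 2
        then have fx: "f x = f w" using bprops by blast
        have "initial f a s \<inter> initial f b w = {}" using initial_disjoint[OF s w(1)] w by simp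
        then have "x \<notin> initial f a s" "s \<notin> initial f b w" using 2 initial_end[OF s] by blast+
        moreover have "x \<notin> low" using fx w S' by (simp add: low_def)
        ultimately have "x \<in> S" using x(2) unfolding H_def by blast
        then have "x = s" using inj_onD[OF S'(4), of x s] fx w S' by simp
        then show False using 2 \<open>s \<notin> initial f b w\<close> by blast
      qed
    qed
    ultimately show False by blast
  qed
  moreover have "\<exists>q\<in>S. f q = f w'" if w': "norm w' \<le> 1" "dist w' w < e/2" "f w' < f w" for w'
  proof -
    have "w' \<in> N" using w' unfolding N_def by (simp add: dist_commute)
    then have "f q0 < f w'" using N w' by (auto simp: Z_def low_def)
    moreover have "connected (f ` S)"
      using S' continuous_on_subset[OF cont_f] by (intro connected_continuous_image) auto
    ultimately have "f w' \<in> f ` S"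
      using connectedD_interval[of "f ` S" "f q0" "f s" "f w'"] S' w w' by auto
    then show ?thesis by force
  qed
  ultimately show ?thesis using e(1) by (intro exI[of _ "e/2"]) (metis half_gt_zero)
qed

text \<open>The section is the chart image of the real segment from \<open>-r/2\<close> to
  0.\<close>

lemma interior_section:
  assumes "norm s < 1"
  shows "\<exists>S. section_through f s S"
proof -
  obtain r \<phi> where r: "r > 0" and \<phi>: "continuous_on (ball 0 r) \<phi>" "\<phi> 0 = s" "\<phi> ` ball 0 r \<subseteq> ball 0 1"
    "\<And>z. z \<in> ball 0 r \<Longrightarrow> f (\<phi> z) = Re z + f s" using chart[OF assms] by metis
  define S where "S = (\<lambda>t. \<phi> (complex_of_real t)) ` {-r/2..0}"
  have inb: "complex_of_real t \<in> ball 0 r" if "t \<in> {-r/2..0}" for t using that r by auto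
  have con: "continuous_on {-r/2..0} (\<lambda>t. \<phi> (complex_of_real t))"
    by (rule continuous_on_compose2[OF \<phi>(1)]) (use inb in \<open>auto intro!: continuous_intros\<close>)
  have fS: "f (\<phi> (complex_of_real t)) = t + f s" if "t \<in> {-r/2..0}" for t using \<phi>(4)[OF inb[OF that]] by simp
  have "compact S" "connected S" unfolding S_def
    by (intro compact_continuous_image connected_continuous_image con compact_Icc connected_Icc)+
  moreover have "S \<subseteq> cball 0 1"
  proof -
    have "S \<subseteq> ball 0 1" unfolding S_def using inb \<phi>(3) by blast
    then show ?thesis using ball_subset_cball by blast
  qed
  moreover have "inj_on f S" unfolding S_def inj_on_def using fS by auto
  moreover have "s \<in> S" unfolding S_def using r \<phi>(2) by (auto intro!: image_eqI[of _ _ 0])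
  moreover have "\<exists>q\<in>S. f q < f s" unfolding S_def
    using fS[of "-r/2"] r
    by (intro bexI[of _ "\<phi> (complex_of_real (-r/2))"]) (auto intro!: image_eqI[of _ _ "-r/2"])
  ultimately show ?thesis unfolding section_through_def by blast
qed

text \<open>Between \<open>t\<close> and \<open>w\<close> there is a point \<open>s\<close> with a
  section descending from it, unless the level is the lowest one. By \<open>beyond_section\<close>
  and its mirror image under \<open>swap\<close>, \<open>w'\<close> stays after and
  \<open>t'\<close> before the same point of the section on their common level.\<close>

lemma order_open_below:
  assumes t: "norm t \<le> 1" and w: "norm w \<le> 1" "f t = f w" "w \<notin> initial f a t"
  shows "\<exists>e>0. \<forall>t' w'. norm t' \<le> 1 \<longrightarrow> norm w' \<le> 1 \<longrightarrow> dist t' t < e \<longrightarrow> dist w' w < e \<longrightarrow>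
    f t' = f w' \<longrightarrow> f w' < f w \<longrightarrow> w' \<notin> initial f a t'"
proof -
  obtain s0 where s0: "norm s0 \<le> 1" "f s0 = f w" "s0 \<notin> initial f a t" "s0 \<notin> initial f b w"
    using initial_between[OF t w] w(2) by (auto simp: level_def)
  have s0ab: "s0 \<noteq> a (f w)" "s0 \<noteq> b (f w)"
    using s0 initial_start[OF t] disc_flow.initial_start[OF swap w(1)] w by auto
  have "f w = m \<or> (\<exists>s S. f s = f w \<and> s \<notin> initial f a t \<and> s \<notin> initial f b w \<and> section_through f s S)"
  proof -
    consider "f w = m" | "f w = M" | "m < f w" "f w < M" using f_range[OF w(1)] by force
    then show ?thesis
    proof cases
      case 2
      \<comment> \<open>On the top level there is no chart. Density of the points with a transversal
        moves \<open>s0\<close> to such a point within the open gap between \<open>t\<close> and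
        \<open>w\<close>; from the maximal level the transversal can only descend.\<close>
      have "norm s0 = 1" using s0 2 f_less[of s0] by force
      moreover have "open (- (initial f a t \<union> initial f b w))"
        using initial_closed[OF t] disc_flow.initial_closed[OF swap w(1)] by blast
      ultimately obtain s S where s: "s \<notin> initial f a t" "s \<notin> initial f b w" "f s = M" "transversal f s S"
        using end_sections[of M s0 "- (initial f a t \<union> initial f b w)"] s0 s0ab 2 by auto
      then obtain q where q: "q \<in> S" "q \<noteq> s" unfolding transversal_def by blast
      then have "f q < f s" using s inj_onD[of f S q s] f_le[of q] unfolding transversal_def by force
      then have "section_through f s S" using s(4) q unfolding transversal_def section_through_def by blast
      then show ?thesis using s 2 by auto
    next
      case 3
      have "norm s0 \<noteq> 1" using circle_cover[of s0] a_on b_on s0 s0ab 3 by auto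
      then show ?thesis using interior_section[of s0] s0 by auto
    qed auto
  qed
  then show ?thesis
  proof
    assume "f w = m"
    \<comment> \<open>Nothing lies below the bottom level, so any radius will do.\<close>
    then show ?thesis using f_ge by (intro exI[of _ 1]) force
  next
    assume "\<exists>s S. f s = f w \<and> s \<notin> initial f a t \<and> s \<notin> initial f b w \<and> section_through f s S"
    then obtain s S where s: "f s = f w" "s \<notin> initial f a t" "s \<notin> initial f b w" and S: "section_through f s S"
      by blast
    have S1: "S \<subseteq> cball 0 1" "inj_on f S" "norm s \<le> 1" using S unfolding section_through_def by auto
    have "w \<notin> initial f a s" using initial_swap[OF S1(3) w(1)] s by simp
    then obtain e1 where e1: "e1 > 0" "\<And>w'. norm w' \<le> 1 \<Longrightarrow> dist w' w < e1 \<Longrightarrow> f w' < f w \<Longrightarrow>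
        \<exists>q\<in>S. f q = f w' \<and> w' \<notin> initial f a q"
      using beyond_section[OF S w(1)] s by metis
    have "t \<notin> initial f b s" using initial_swap[OF t S1(3)] s w by simp
    then obtain e2 where e2: "e2 > 0" "\<And>w'. norm w' \<le> 1 \<Longrightarrow> dist w' t < e2 \<Longrightarrow> f w' < f t \<Longrightarrow>
        \<exists>q\<in>S. f q = f w' \<and> w' \<notin> initial f b q"
      using disc_flow.beyond_section[OF swap S t] s w by metis
    show ?thesis
    proof (intro exI[of _ "min e1 e2"] conjI allI impI)
      fix t' w' assume *: "norm t' \<le> 1" "norm w' \<le> 1" "dist t' t < min e1 e2" "dist w' w < min e1 e2"
        "f t' = f w'" "f w' < f w"
      obtain q where q: "q \<in> S" "f q = f w'" "w' \<notin> initial f a q" using e1(2)[of w'] * by auto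
      obtain q' where q': "q' \<in> S" "f q' = f t'" "t' \<notin> initial f b q'" using e2(2)[of t'] * w by auto
      have "q' = q" using inj_onD[OF S1(2)] q q' * by simp
      have nq: "norm q \<le> 1" using q S1 by auto
      have "t' \<in> initial f a q"
        using initial_Un[OF nq] q' \<open>q' = q\<close> in_level[OF *(1)] by auto
      then show "w' \<notin> initial f a t'" using initial_mono[OF nq] q by blast
    qed (use e1 e2 in auto)
  qed
qed

text \<open>Lower levels are covered by \<open>order_open_below\<close>, higher ones by the same
  lemma for \<open>-f\<close>. On the level itself a point strictly between \<open>t\<close> and
  \<open>w\<close> has closed sides, which neither point enters under a small move.\<close>

lemma order_open:
  assumes t: "norm t \<le> 1" and w: "norm w \<le> 1" "f t = f w" "w \<notin> initial f a t"
  obtains e where "e > 0" "\<And>t' w'. norm t' \<le> 1 \<Longrightarrow> norm w' \<le> 1 \<Longrightarrow> dist t' t < e \<Longrightarrow> dist w' w < e \<Longrightarrow>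
    f t' = f w' \<Longrightarrow> w' \<notin> initial f a t'"
proof -
  obtain e1 where e1: "e1 > 0" "\<And>t' w'. norm t' \<le> 1 \<Longrightarrow> norm w' \<le> 1 \<Longrightarrow> dist t' t < e1 \<Longrightarrow> dist w' w < e1 \<Longrightarrow>
    f t' = f w' \<Longrightarrow> f w' < f w \<Longrightarrow> w' \<notin> initial f a t'" using order_open_below[OF assms] by metis
  obtain e2 where e2: "e2 > 0" "\<And>t' w'. norm t' \<le> 1 \<Longrightarrow> norm w' \<le> 1 \<Longrightarrow> dist t' t < e2 \<Longrightarrow> dist w' w < e2 \<Longrightarrow>
    f t' = f w' \<Longrightarrow> f w < f w' \<Longrightarrow> w' \<notin> initial f a t'"
    using disc_flow.order_open_below[OF flip, of t w] assms by (simp add: initial_uminus) metis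
  obtain s where s: "norm s \<le> 1" "f s = f w" "s \<notin> initial f a t" "s \<notin> initial f b w"
    using initial_between[OF t w] w(2) by (auto simp: level_def)
  have "w \<notin> initial f a s" "t \<notin> initial f b s"
    using initial_swap[OF s(1) w(1)] initial_swap[OF t s(1)] s w by simp_all
  then obtain e3 e4 where e3: "e3 > 0" "ball w e3 \<subseteq> - initial f a s" and e4: "e4 > 0" "ball t e4 \<subseteq> - initial f b s"
    using initial_closed[OF s(1)] disc_flow.initial_closed[OF swap s(1)] by (metis ComplI open_Compl openE)
  show thesis
  proof (rule that[of "min (min e1 e2) (min e3 e4)"])
    fix t' w' assume *: "norm t' \<le> 1" "norm w' \<le> 1" "dist t' t < min (min e1 e2) (min e3 e4)"
      "dist w' w < min (min e1 e2) (min e3 e4)" "f t' = f w'"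
    consider "f w' < f w" | "f w < f w'" | "f w' = f w" by linarith
    then show "w' \<notin> initial f a t'"
    proof cases
      case 3
      have "w' \<notin> initial f a s" "t' \<notin> initial f b s"
        using e3 e4 * by (auto simp: subset_eq dist_commute)
      moreover then have "t' \<in> initial f a s" using initial_Un[OF s(1)] in_level[OF *(1)] * 3 s by auto
      ultimately show ?thesis using initial_mono[OF s(1)] by blast
    qed (use e1 e2 * in auto)
  qed (use e1 e2 e3 e4 in auto)
qed

section \<open>A continuous function that increases along the levels\<close>

text \<open>As \<open>f\<close> has no local extremum at intermediate values, the connected trace of
  a small ball on the disc already covers the values around \<open>f t\<close>; at \<open>M\<close>
  and \<open>m\<close> only one side is asked for.\<close>

lemma level_nearby:
  assumes t: "norm t \<le> 1" and V: "open V" "t \<in> V"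
  obtains d where "d > 0" "\<And>y. y \<in> {m..M} \<Longrightarrow> \<bar>y - f t\<bar> < d \<Longrightarrow> \<exists>t'\<in>V. norm t' \<le> 1 \<and> f t' = y"
proof -
  obtain r where r: "r > 0" "ball t r \<subseteq> V" using V openE by blast
  define C where "C = ball t r \<inter> cball 0 1"
  have C: "connected C" "t \<in> C" unfolding C_def using r t by (auto intro!: convex_connected convex_Int)
  have "connected (f ` C)"
    by (rule connected_continuous_image[OF continuous_on_subset[OF cont_f] C(1)]) (simp add: C_def)
  note iv = connectedD_interval[OF this]
  have "\<exists>d>0. \<forall>y. f t \<le> y \<longrightarrow> y \<le> M \<longrightarrow> y < f t + d \<longrightarrow> y \<in> f ` C"
  proof (cases "f t < M")
    case True
    then obtain q where q: "q \<in> ball t r" "norm q \<le> 1" "f t < f q" using above[OF t True, of "ball t r"] r by auto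
    then have qC: "f q \<in> f ` C" "f t \<in> f ` C" using C unfolding C_def by auto
    show ?thesis using q by (intro exI[of _ "f q - f t"]) (auto intro: iv[of "f t" "f q"] simp: qC)
  next
    case False
    then have "f t = M" using f_le[OF t] by simp
    then show ?thesis using C by (intro exI[of _ 1]) auto
  qed
  then obtain d1 where d1: "d1 > 0" "\<And>y. f t \<le> y \<Longrightarrow> y \<le> M \<Longrightarrow> y < f t + d1 \<Longrightarrow> y \<in> f ` C" by blast
  have "\<exists>d>0. \<forall>y. y \<le> f t \<longrightarrow> m \<le> y \<longrightarrow> f t - d < y \<longrightarrow> y \<in> f ` C"
  proof (cases "m < f t")
    case True
    then obtain q where q: "q \<in> ball t r" "norm q \<le> 1" "f q < f t"
      using disc_flow.above[OF flip t, of "ball t r"] r by auto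
    then have qC: "f q \<in> f ` C" "f t \<in> f ` C" using C unfolding C_def by auto
    show ?thesis using q by (intro exI[of _ "f t - f q"]) (auto intro: iv[of "f q" "f t"] simp: qC)
  next
    case False
    then have "f t = m" using f_ge[OF t] by simp
    then show ?thesis using C by (intro exI[of _ 1]) auto
  qed
  then obtain d2 where d2: "d2 > 0" "\<And>y. y \<le> f t \<Longrightarrow> m \<le> y \<Longrightarrow> f t - d2 < y \<Longrightarrow> y \<in> f ` C" by blast
  show thesis
  proof (rule that[of "min d1 d2"])
    fix y assume y: "y \<in> {m..M}" "\<bar>y - f t\<bar> < min d1 d2"
    then have "y \<in> f ` C" using d1(2)[of y] d2(2)[of y] by (cases "f t \<le> y") auto
    then show "\<exists>t'\<in>V. norm t' \<le> 1 \<and> f t' = y" using r unfolding C_def by auto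
  qed (use d1 d2 in auto)
qed

text \<open>A violation of the order in the limit would, by \<open>order_open\<close>, persist at
  nearby pairs of points.\<close>

lemma closed_order:
  assumes u: "u \<longlonglongrightarrow> w" "\<And>n. norm (u n) \<le> 1" and t: "t \<longlonglongrightarrow> t0" "\<And>n. t n \<in> initial f a (u n)"
  shows "t0 \<in> initial f a w" "norm w \<le> 1"
proof -
  have t1: "norm (t n) \<le> 1" "f (t n) = f (u n)" for n using initial_level[OF u(2) t(2)] by auto
  show w: "norm w \<le> 1" using closed_sequentially[OF closed_cball[of 0 1], of u] u by simp
  have t0: "norm t0 \<le> 1" using closed_sequentially[OF closed_cball[of 0 1], of t] t t1 by simp
  have "(\<lambda>n. f (u n)) \<longlonglongrightarrow> f w" "(\<lambda>n. f (t n)) \<longlonglongrightarrow> f t0"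
    using u t w t0 t1(1) by (auto intro!: continuous_on_tendsto_compose[OF cont_f] always_eventually)
  then have eq: "f w = f t0" using t1(2) LIMSEQ_unique by simp
  show "t0 \<in> initial f a w"
  proof (rule ccontr)
    assume "t0 \<notin> initial f a w"
    then obtain e where e: "e > 0" "\<And>t' w'. norm t' \<le> 1 \<Longrightarrow> norm w' \<le> 1 \<Longrightarrow> dist t' w < e \<Longrightarrow> dist w' t0 < e \<Longrightarrow>
        f t' = f w' \<Longrightarrow> w' \<notin> initial f a t'" using order_open[OF w t0 eq] by metis
    have "\<forall>\<^sub>F n in sequentially. dist (u n) w < e \<and> dist (t n) t0 < e"
      using u(1) t(1) e(1) by (intro eventually_conj) (auto simp: tendsto_iff)
    then obtain n where "dist (u n) w < e" "dist (t n) t0 < e"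
      using eventually_happens'[OF sequentially_bot] by blast
    then show False using e(2)[of "u n" "t n"] u(2) t1 t(2) by auto
  qed
qed

text \<open>This is lower semicontinuity of the distance: nearest points in the approximating
  segments accumulate, and by \<open>closed_order\<close> they do so in the segment of the
  limit.\<close>

lemma closed_infdist_le: "closed {w \<in> cball 0 1. infdist x (initial f a w) \<le> c}"
  unfolding closed_sequential_limits
proof (intro allI impI, elim conjE)
  fix u w assume u: "\<forall>n. u n \<in> {w \<in> cball 0 1. infdist x (initial f a w) \<le> c}" "u \<longlonglongrightarrow> w"
  have u1: "norm (u n) \<le> 1" "infdist x (initial f a (u n)) \<le> c" for n using u(1) by auto
  have "\<exists>t. t \<in> initial f a (u n) \<and> infdist x (initial f a (u n)) = dist x t" for n
    using infdist_attains_inf[OF initial_closed[OF u1(1)]] initial_end[OF u1(1)] by (metis empty_iff)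
  then obtain t where t: "\<And>n. t n \<in> initial f a (u n)" "\<And>n. infdist x (initial f a (u n)) = dist x (t n)" by metis
  have "\<forall>n. t n \<in> cball 0 1" using initial_level[OF u1(1) t(1)] by simp
  then obtain t0 r where r: "strict_mono r" "(t \<circ> r) \<longlonglongrightarrow> t0"
    using compact_cball[of "0::complex" 1] unfolding compact_def by metis
  have "t0 \<in> initial f a w" "norm w \<le> 1"
    using closed_order[OF LIMSEQ_subseq_LIMSEQ[OF u(2) r(1)] _ r(2)] u1(1) t(1) by (auto simp: comp_def)
  moreover have "(\<lambda>n. dist x ((t \<circ> r) n)) \<longlonglongrightarrow> dist x t0" by (intro tendsto_intros r)
  then have "dist x t0 \<le> c" using LIMSEQ_le_const2 t(2) u1(2) by (metis (no_types, lifting) comp_apply)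
  ultimately show "w \<in> {w \<in> cball 0 1. infdist x (initial f a w) \<le> c}"
    using infdist_le2 by auto
qed

text \<open>Lower semicontinuity is \<open>closed_infdist_le\<close>. For the upper bound the
  nearest point \<open>t\<close> has to be approximated from nearby segments:
  \<open>level_nearby\<close> supplies a point \<open>t'\<close> close to \<open>t\<close> on the
  level of \<open>w'\<close>, and openness of the order keeps \<open>t'\<close> before
  \<open>w'\<close>.\<close>

lemma continuous_infdist_initial: "continuous_on (cball 0 1) (\<lambda>w. infdist x (initial f a w))"
  unfolding continuous_on_iff
proof (intro ballI allI impI)
  fix w :: complex and e :: real assume w: "w \<in> cball 0 1" and "e > 0"
  define I where "I = infdist x (initial f a w)"
  have w1: "norm w \<le> 1" using w by simp
  have "open (- {w \<in> cball 0 1. infdist x (initial f a w) \<le> I - e})" using closed_infdist_le by blast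
  moreover have "w \<in> - {w \<in> cball 0 1. infdist x (initial f a w) \<le> I - e}" using \<open>e > 0\<close> by (simp add: I_def)
  ultimately obtain d1 where d1: "d1 > 0" "ball w d1 \<subseteq> - {w \<in> cball 0 1. infdist x (initial f a w) \<le> I - e}"
    using openE by blast
  obtain t where t: "t \<in> initial f a w" "I = dist x t"
    unfolding I_def using infdist_attains_inf[OF initial_closed[OF w1]] initial_end[OF w1] by (metis empty_iff)
  have t1: "norm t \<le> 1" "f t = f w" using initial_level[OF w1 t(1)] by auto
  have "\<exists>d>0. \<forall>w'. norm w' \<le> 1 \<longrightarrow> dist w' w < d \<longrightarrow> infdist x (initial f a w') < I + e"
  proof (cases "t = w")
    \<comment> \<open>Openness says nothing about two equal points, but here \<open>w'\<close>
      itself approximates the nearest point.\<close>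
    case True
    show ?thesis
    proof (intro exI[of _ e] conjI allI impI)
      fix w' assume "norm w' \<le> 1" "dist w' w < e"
      then have "infdist x (initial f a w') \<le> dist x w'" using infdist_le initial_end by blast
      also have "\<dots> \<le> dist x w + dist w w'" by (rule dist_triangle)
      finally show "infdist x (initial f a w') < I + e"
        using \<open>dist w' w < e\<close> t True by (simp add: dist_commute)
    qed fact
  next
    case False
    then have "w \<notin> initial f a t" using initial_antisym[OF w1 t(1)] by auto
    then obtain d where d: "d > 0" "\<And>t' w'. norm t' \<le> 1 \<Longrightarrow> norm w' \<le> 1 \<Longrightarrow> dist t' t < d \<Longrightarrow> dist w' w < d \<Longrightarrow>
        f t' = f w' \<Longrightarrow> w' \<notin> initial f a t'" using order_open[OF t1(1) w1 t1(2)] by metis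
    define r where "r = min d e"
    have r: "r > 0" using d \<open>e > 0\<close> by (simp add: r_def)
    obtain \<delta> where \<delta>: "\<delta> > 0" "\<And>y. y \<in> {m..M} \<Longrightarrow> \<bar>y - f t\<bar> < \<delta> \<Longrightarrow> \<exists>t'\<in>ball t r. norm t' \<le> 1 \<and> f t' = y"
      using level_nearby[OF t1(1), of "ball t r"] r by auto
    obtain \<eta> where \<eta>: "\<eta> > 0" "\<And>w'. norm w' \<le> 1 \<Longrightarrow> dist w' w < \<eta> \<Longrightarrow> \<bar>f w' - f w\<bar> < \<delta>"
      using cont_f w \<delta>(1) unfolding continuous_on_iff dist_real_def by (metis mem_cball_0)
    show ?thesis
    proof (intro exI[of _ "min \<eta> d"] conjI allI impI)
      fix w' assume w': "norm w' \<le> 1" "dist w' w < min \<eta> d"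
      obtain t' where t': "dist t t' < r" "norm t' \<le> 1" "f t' = f w'"
        using \<delta>(2)[OF f_range[OF w'(1)]] \<eta>(2)[OF w'(1)] w' t1 by auto
      then have "w' \<notin> initial f a t'" using d(2)[of t' w'] w' by (auto simp: r_def dist_commute)
      then have "t' \<in> initial f a w'" using initial_total[OF t'(2) w'(1) t'(3)] by blast
      then have "infdist x (initial f a w') \<le> dist x t'" using infdist_le by blast
      also have "\<dots> \<le> dist x t + dist t t'" by (rule dist_triangle)
      finally show "infdist x (initial f a w') < I + e" using t' t by (simp add: r_def)
    qed (use \<eta> d in auto)
  qed
  then obtain d2 where d2: "d2 > 0" "\<And>w'. norm w' \<le> 1 \<Longrightarrow> dist w' w < d2 \<Longrightarrow> infdist x (initial f a w') < I + e"
    by blast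
  show "\<exists>d>0. \<forall>w'\<in>cball 0 1. dist w' w < d \<longrightarrow> dist (infdist x (initial f a w')) (infdist x (initial f a w)) < e"
  proof (intro exI[of _ "min d1 d2"] conjI ballI impI)
    fix w' :: complex assume w': "w' \<in> cball 0 1" "dist w' w < min d1 d2"
    then have "w' \<in> ball w d1" by (simp add: dist_commute)
    then have "\<not> infdist x (initial f a w') \<le> I - e" using d1 w' by blast
    moreover have "infdist x (initial f a w') < I + e" using d2(2)[of w'] w' by simp
    ultimately show "dist (infdist x (initial f a w')) (infdist x (initial f a w)) < e"
      by (simp add: dist_real_def I_def[symmetric] abs_less_iff)
  qed (use d1 d2 in auto)
qed

text \<open>
  As in Whitney's parametrisation of curves, \<open>w\<close> is measured by a weighted sum of the distances
  from a dense sequence of points to the part of the level that precedes \<open>w\<close>.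
\<close>

lemma order_function:
  obtains u where "continuous_on (cball 0 1) u"
    "\<And>p q. norm p \<le> 1 \<Longrightarrow> norm q \<le> 1 \<Longrightarrow> f p = f q \<Longrightarrow> q \<notin> initial f a p \<Longrightarrow> u p < (u q :: real)"
proof -
  obtain X :: "complex set" where X: "countable X" "X \<subseteq> cball 0 1" "cball 0 1 \<subseteq> closure X"
    using separable[of "cball 0 1"] by metis
  have "X \<noteq> {}" using X(3) by auto
  define x where "x = from_nat_into X"
  have rx: "range x = X" unfolding x_def using X \<open>X \<noteq> {}\<close> by simp
  then have nx: "norm (x n) \<le> 1" for n using X(2) by (metis mem_cball_0 rangeI subsetD)
  define g where "g n w = (1/2)^n * infdist (x n) (initial f a w)" for n w
  have bound: "norm (g n w) \<le> (1/2)^n * 2" if "w \<in> cball 0 1" for n w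
  proof -
    have "norm w \<le> 1" using that by simp
    then have "infdist (x n) (initial f a w) \<le> dist (x n) w" using infdist_le initial_end by blast
    also have "\<dots> \<le> 2" using norm_triangle_ineq4[of "x n" w] nx[of n] \<open>norm w \<le> 1\<close> by (simp add: dist_norm)
    finally show ?thesis unfolding g_def by (simp add: abs_mult infdist_nonneg)
  qed
  have smb: "summable (\<lambda>n. (1/2)^n * 2 :: real)" by (intro summable_mult2 summable_geometric) simp
  have sm: "summable (\<lambda>n. g n w)" if "w \<in> cball 0 1" for w
    by (rule summable_comparison_test'[OF smb, of 0]) (rule bound[OF that])
  have "uniform_limit (cball 0 1) (\<lambda>n w. \<Sum>i<n. g i w) (\<lambda>w. suminf (\<lambda>i. g i w)) sequentially"
    by (rule Weierstrass_m_test[OF bound smb])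
  then have cont: "continuous_on (cball 0 1) (\<lambda>w. suminf (\<lambda>i. g i w))"
    by (rule uniform_limit_theorem[rotated])
      (auto simp: g_def intro!: always_eventually continuous_intros continuous_infdist_initial)
  show thesis
  \<comment> \<open>The sign is negative because a longer initial segment is closer to every
    point.\<close>
  proof (rule that[of "\<lambda>w. - suminf (\<lambda>i. g i w)"])
    show "continuous_on (cball 0 1) (\<lambda>w. - (\<Sum>i. g i w))" by (intro continuous_intros cont)
    fix p q assume pq: "norm p \<le> 1" "norm q \<le> 1" "f p = f q" "q \<notin> initial f a p"
    have sub: "initial f a p \<subseteq> initial f a q"
      using initial_mono[OF pq(2)] initial_total[OF pq] by blast
    have ne: "initial f a p \<noteq> {}" using initial_end[OF pq(1)] by blast
    define \<delta> where "\<delta> = infdist q (initial f a p)"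
    have "\<delta> > 0" unfolding \<delta>_def by (rule infdist_pos_not_in_closed[OF initial_closed[OF pq(1)] ne pq(4)])
    \<comment> \<open>Strictness comes from a single term: \<open>x k\<close> is within
      \<open>\<delta>/2\<close> of \<open>q\<close>, hence of the initial segment of
      \<open>q\<close>, but farther than that from the one of \<open>p\<close>.\<close>
    have "q \<in> closure X" using X(3) pq(2) by auto
    then obtain y where "y \<in> X" "dist y q < \<delta>/2" using \<open>\<delta> > 0\<close> closure_approachable by (metis half_gt_zero)
    then obtain k where k: "dist (x k) q < \<delta>/2" using rx by blast
    have "infdist (x k) (initial f a q) \<le> dist (x k) q" using infdist_le initial_end[OF pq(2)] by blast
    moreover have "\<delta> \<le> infdist (x k) (initial f a p) + dist q (x k)" unfolding \<delta>_def by (rule infdist_triangle)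
    ultimately have "g k q < g k p" using k unfolding g_def by (simp add: dist_commute)
    moreover have "g n q \<le> g n p" for n unfolding g_def
      using infdist_mono[OF sub ne] by (simp add: mult_left_mono)
    ultimately have "0 < suminf (\<lambda>i. g i p - g i q)"
      using sm pq by (intro suminf_pos2[of _ k] summable_diff) auto
    also have "\<dots> = suminf (\<lambda>i. g i p) - suminf (\<lambda>i. g i q)" using sm pq by (simp add: suminf_diff)
    finally show "- (\<Sum>i. g i p) < - (\<Sum>i. g i q)" by simp
  qed
qed

end

section \<open>Coordinates along the levels and straightening onto the model domain\<close>

text \<open>Off \<open>T\<close> the factor \<Phi> may be discontinuous, but it is bounded while
  \<open>L\<close> tends to 0. In the application these are the one-point end levels, and
  \<open>L\<close> is the width of the model domain.\<close>

lemma continuous_on_mult_vanishing: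
  fixes L \<Phi> :: "'a::metric_space \<Rightarrow> real"
  assumes L: "continuous_on S L" and \<Phi>: "continuous_on T \<Phi>" "openin (top_of_set S) T"
    and bound: "\<And>x. x \<in> S \<Longrightarrow> \<bar>\<Phi> x\<bar> \<le> 1" and vanish: "\<And>x. x \<in> S \<Longrightarrow> x \<notin> T \<Longrightarrow> L x = 0"
  shows "continuous_on S (\<lambda>x. L x * \<Phi> x)"
  unfolding continuous_on_def
proof
  fix x assume x: "x \<in> S"
  show "((\<lambda>x. L x * \<Phi> x) \<longlongrightarrow> L x * \<Phi> x) (at x within S)"
  proof (cases "x \<in> T")
    case True
    obtain V where V: "open V" "T = S \<inter> V" using \<Phi>(2) by (auto simp: openin_open)
    then have "at x within S = at x within T" using True by (intro at_within_nhd[of x V]) auto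
    then have "(\<Phi> \<longlongrightarrow> \<Phi> x) (at x within S)" using \<Phi>(1) True by (simp add: continuous_on_def)
    then show ?thesis using L x by (auto simp: continuous_on_def intro: tendsto_mult)
  next
    case False
    have "(L \<longlongrightarrow> 0) (at x within S)" using L x vanish[OF x False] by (force simp: continuous_on_def)
    then have 0: "((\<lambda>x. \<bar>L x\<bar>) \<longlongrightarrow> 0) (at x within S)" by (simp add: tendsto_rabs_zero_iff)
    have "((\<lambda>x. L x * \<Phi> x) \<longlongrightarrow> 0) (at x within S)"
    proof (rule Lim_null_comparison[OF _ 0])
      have "\<bar>L y * \<Phi> y\<bar> \<le> \<bar>L y\<bar>" if "y \<in> S" for y
        using bound[OF that] by (simp add: abs_mult mult_left_le)
      then show "\<forall>\<^sub>F y in at x within S. norm (L y * \<Phi> y) \<le> \<bar>L y\<bar>"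
        by (auto simp: eventually_at_filter)
    qed
    then show ?thesis using vanish[OF x False] by simp
  qed
qed

context disc_flow
begin

text \<open>The order function is normalised on each level to run from 0 at \<open>a\<close> to 1 at
  \<open>b\<close>. If \<open>a y = b y\<close>, a further point \<open>p\<close> of the level would
  satisfy \<open>u (a y) < u p < u (b y)\<close>; hence such a level is a single point.\<close>

lemma level_coordinate:
  obtains U :: "complex \<Rightarrow> real" where "\<And>w. norm w \<le> 1 \<Longrightarrow> U w \<in> {0..1}"
    "continuous_on {w \<in> cball 0 1. a (f w) \<noteq> b (f w)} U"
    "\<And>y. y \<in> {m..M} \<Longrightarrow> a y \<noteq> b y \<Longrightarrow> U (a y) = 0 \<and> U (b y) = 1"
    "\<And>p q. norm p \<le> 1 \<Longrightarrow> norm q \<le> 1 \<Longrightarrow> f p = f q \<Longrightarrow> U p = U q \<Longrightarrow> p = q"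
    "\<And>p. norm p \<le> 1 \<Longrightarrow> a (f p) = b (f p) \<Longrightarrow> p = a (f p)"
proof -
  obtain u where u: "continuous_on (cball 0 1) u"
    "\<And>p q. norm p \<le> 1 \<Longrightarrow> norm q \<le> 1 \<Longrightarrow> f p = f q \<Longrightarrow> q \<notin> initial f a p \<Longrightarrow> u p < (u q :: real)"
    using order_function by metis
  have neq: "p = q" if "norm p \<le> 1" "norm q \<le> 1" "f p = f q" "u p = u q" for p q
    using u(2)[of p q] u(2)[of q p] that initial_antisym[of p q] by force
  have A: "norm (a (f p)) \<le> 1" "f (a (f p)) = f p" "norm (b (f p)) \<le> 1" "f (b (f p)) = f p" if "norm p \<le> 1" for p
    using a_on[OF f_range[OF that]] b_on[OF f_range[OF that]] by auto
  have ua: "u (a (f p)) < u p" if "norm p \<le> 1" "p \<noteq> a (f p)" for p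
    using u(2)[OF A(1)[OF that(1)] that(1)] A[OF that(1)] that
      initial_antisym[OF that(1) initial_start[OF that(1)]] by auto
  have ub: "u p < u (b (f p))" if "norm p \<le> 1" "p \<noteq> b (f p)" for p
  proof (rule u(2)[OF that(1)])
    have "b (f p) \<in> initial f b p" using disc_flow.initial_start[OF swap that(1)] .
    then have "b (f p) \<in> initial f a p \<Longrightarrow> b (f p) \<in> {p}" unfolding initial_Int[OF that(1), symmetric] by blast
    then show "b (f p) \<notin> initial f a p" using that(2) by auto
  qed (use A that in auto)
  have deg: "p = a (f p)" if "norm p \<le> 1" "a (f p) = b (f p)" for p
    using ua[OF that(1)] ub[OF that(1)] that(2) by force
  \<comment> \<open>On a one-point level numerator and denominator both vanish, and division by zero
    yields 0, so \<open>U\<close> has values in \<open>{0..1}\<close> everywhere.\<close>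
  define U where "U w = (u w - u (a (f w))) / (u (b (f w)) - u (a (f w)))" for w
  have pos: "u (a (f p)) < u (b (f p))" if "norm p \<le> 1" "a (f p) \<noteq> b (f p)" for p
    using ua[of "b (f p)"] A[OF that(1)] that by auto
  show thesis
  proof (rule that[of U])
    fix w :: complex assume w: "norm w \<le> 1"
    have "u (a (f w)) \<le> u w" "u w \<le> u (b (f w))" using ua[OF w] ub[OF w] by force+
    then show "U w \<in> {0..1}" unfolding U_def by (auto simp: divide_simps)
  next
    let ?T = "{w \<in> cball 0 1. a (f w) \<noteq> b (f w)}"
    have f: "continuous_on ?T f" by (rule continuous_on_subset[OF cont_f]) auto
    have uT: "continuous_on ?T u" by (rule continuous_on_subset[OF u(1)]) auto
    have ab: "continuous_on ?T (\<lambda>w. a (f w))" "continuous_on ?T (\<lambda>w. b (f w))"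
      using f_range by (intro continuous_on_compose2[OF cont_a f] continuous_on_compose2[OF cont_b f]; force)+
    have "continuous_on ?T (\<lambda>w. u (a (f w)))" "continuous_on ?T (\<lambda>w. u (b (f w)))"
      using A by (intro continuous_on_compose2[OF u(1) ab(1)] continuous_on_compose2[OF u(1) ab(2)]; force)+
    moreover have "\<forall>w\<in>?T. u (b (f w)) - u (a (f w)) \<noteq> 0"
    proof
      fix w assume "w \<in> ?T"
      then show "u (b (f w)) - u (a (f w)) \<noteq> 0" using pos[of w] by simp
    qed
    ultimately show "continuous_on ?T U" unfolding U_def by (intro continuous_intros uT)
  next
    fix y assume y: "y \<in> {m..M}" "a y \<noteq> b y"
    then show "U (a y) = 0 \<and> U (b y) = 1"
      unfolding U_def using a_on[of y] b_on[of y] pos[of "a y"] by auto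
  next
    fix p q assume pq: "norm p \<le> 1" "norm q \<le> 1" "f p = f q" "U p = U q"
    show "p = q"
    proof (cases "a (f p) = b (f p)")
      case True then show ?thesis using deg[of p] deg[of q] pq by auto
    next
      case False
      then have "u p = u q" using pq pos[OF pq(1)] unfolding U_def by simp
      then show ?thesis using neq pq by blast
    qed
  qed (use deg in auto)
qed

end

text \<open>\<open>U\<close> maps the end level homeomorphically onto the unit interval, so
  \<open>g\<close> becomes a continuous injective function of \<open>U\<close>, and its values at
  the ends make it increasing. In the application \<open>g\<close> is the horizontal coordinate of
  the prescribed boundary map.\<close>

lemma end_reparametrisation:
  fixes U :: "complex \<Rightarrow> real" and L :: "complex set" and g :: "complex \<Rightarrow> real"
  assumes L: "compact L" "connected L" "p0 \<in> L" "p1 \<in> L" and U: "continuous_on L U" "inj_on U L" "U ` L \<subseteq> {0..1}"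
    "U p0 = 0" "U p1 = 1" and g: "continuous_on L g" "inj_on g L" "g p0 = l" "g p1 = r" "l < r"
  obtains \<alpha> where "continuous_on {0..1} \<alpha>" "strict_mono_on {0..1} \<alpha>" "\<alpha> 0 = 0" "\<alpha> 1 = (1::real)"
    "\<And>p. p \<in> L \<Longrightarrow> g p = l + (r - l) * \<alpha> (U p)"
proof -
  have "connected (U ` L)" using L U by (intro connected_continuous_image)
  then have "{0..1} \<subseteq> U ` L"
    using connected_contains_Icc[of "U ` L" 0 1] U L by (metis imageI)
  then have im: "U ` L = {0..1}" using U(3) by blast
  obtain \<sigma> where \<sigma>: "homeomorphism L {0..1} U \<sigma>"
    using homeomorphism_compact[OF L(1) U(1) im U(2)] by blast
  have s01: "\<sigma> 0 = p0" "\<sigma> 1 = p1" using homeomorphism_apply1[OF \<sigma>] L U by metis+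
  define \<alpha> where "\<alpha> t = (g (\<sigma> t) - l) / (r - l)" for t
  have \<sigma>c: "continuous_on {0..1} \<sigma>" and \<sigma>i: "\<sigma> ` {0..1} = L" using \<sigma> by (auto simp: homeomorphism_def)
  have c: "continuous_on {0..1} \<alpha>" unfolding \<alpha>_def
    by (intro continuous_intros continuous_on_compose2[OF g(1) \<sigma>c]) (use \<sigma>i g(5) in auto)
  have "inj_on \<sigma> {0..1}" using homeomorphism_apply2[OF \<sigma>] by (metis inj_on_inverseI)
  have "inj_on \<alpha> {0..1}"
  proof (rule inj_onI)
    fix s t :: real assume st: "s \<in> {0..1}" "t \<in> {0..1}" "\<alpha> s = \<alpha> t"
    then have "g (\<sigma> s) = g (\<sigma> t)" using g(5) by (simp add: \<alpha>_def)
    then have "\<sigma> s = \<sigma> t" using inj_onD[OF g(2)] \<sigma>i st by blast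
    then show "s = t" using inj_onD[OF \<open>inj_on \<sigma> {0..1}\<close>] st by blast
  qed
  then have "strict_mono_on {0..1} \<alpha> \<or> strict_antimono_on {0..1} \<alpha>"
    using injective_eq_monotone_map[OF _ c] by auto
  moreover have \<alpha>01: "\<alpha> 0 = 0" "\<alpha> 1 = 1" unfolding \<alpha>_def s01 using g by auto
  ultimately have "strict_mono_on {0..1} \<alpha>"
    using monotone_onD[of "{0..1}" "(<)" "(>)" \<alpha> 0 1] by auto
  moreover have "g p = l + (r - l) * \<alpha> (U p)" if "p \<in> L" for p
    using homeomorphism_apply1[OF \<sigma> that] g(5) by (simp add: \<alpha>_def)
  ultimately show thesis using that c \<alpha>01 by blast
qed

context disc_flow
begin

text \<open>Heights are affine in \<open>f\<close>. Horizontally, \<Phi> is a convex combination of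
  the reparametrisations \<open>\<alpha>0\<close> and \<open>\<alpha>1\<close> that reproduce \<psi>
  on the two end levels, so it still increases along every level; it is then scaled to the slice of
  the model domain. Surjectivity holds because each level is connected and its ends go to the two
  graphs.\<close>

lemma straighten:
  fixes \<psi> :: "complex \<Rightarrow> complex" and l r :: "real \<Rightarrow> real"
  assumes y: "y0 < y1" and cl: "continuous_on {y0..y1} l" and cr: "continuous_on {y0..y1} r"
    and lr: "\<And>y. y0 < y \<Longrightarrow> y < y1 \<Longrightarrow> l y < r y"
    and E: "E = {z. y0 \<le> Im z \<and> Im z \<le> y1 \<and> l (Im z) \<le> Re z \<and> Re z \<le> r (Im z)}"
    and \<psi>: "continuous_on (sphere 0 1) \<psi>" "inj_on \<psi> (sphere (0::complex) 1)"
    and top: "\<And>p. norm p = 1 \<Longrightarrow> f p = M \<Longrightarrow> Im (\<psi> p) = y1"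
    and bot: "\<And>p. norm p = 1 \<Longrightarrow> f p = m \<Longrightarrow> Im (\<psi> p) = y0"
    and corners: "\<psi> (a M) = Complex (l y1) y1" "\<psi> (b M) = Complex (r y1) y1"
      "\<psi> (a m) = Complex (l y0) y0" "\<psi> (b m) = Complex (r y0) y0"
  shows "\<exists>H H'. homeomorphism (cball 0 1) E H H' \<and> (\<forall>p. norm p = 1 \<longrightarrow> f p \<in> {m, M} \<longrightarrow> H p = \<psi> p) \<and>
    (\<forall>z\<in>E. f (H' z) = m + (M - m) * (Im z - y0) / (y1 - y0))"
proof -
  obtain U :: "complex \<Rightarrow> real" where U: "\<And>w. norm w \<le> 1 \<Longrightarrow> U w \<in> {0..1}"
    "continuous_on {w \<in> cball 0 1. a (f w) \<noteq> b (f w)} U"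
    "\<And>y. y \<in> {m..M} \<Longrightarrow> a y \<noteq> b y \<Longrightarrow> U (a y) = 0 \<and> U (b y) = 1"
    "\<And>p q. norm p \<le> 1 \<Longrightarrow> norm q \<le> 1 \<Longrightarrow> f p = f q \<Longrightarrow> U p = U q \<Longrightarrow> p = q"
    and deg: "\<And>p. norm p \<le> 1 \<Longrightarrow> a (f p) = b (f p) \<Longrightarrow> p = a (f p)"
    by (rule level_coordinate, rule that)
  \<comment> \<open>Obtained by passing to the limit; at heights \<open>y0\<close> and
    \<open>y1\<close> the graphs may touch.\<close>
  have lr_le: "l y \<le> r y" if "y \<in> {y0..y1}" for y
  proof -
    have cl': "closure {y0<..<y1} = {y0..y1}" using y by simp
    have c: "continuous_on (closure {y0<..<y1}) (\<lambda>x. r x - l x)"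
      unfolding cl' by (rule continuous_on_diff[OF cr cl])
    have "0 \<le> r y - l y"
    proof (rule continuous_ge_on_closure[OF c])
      show "y \<in> closure {y0<..<y1}" unfolding cl' by (rule that)
      show "0 \<le> r x - l x" if "x \<in> {y0<..<y1}" for x using lr[of x] that by simp
    qed
    then show ?thesis by simp
  qed
  have "\<exists>\<alpha>. continuous_on {0..1} \<alpha> \<and> strict_mono_on {0..1} \<alpha> \<and> \<alpha> 0 = 0 \<and> \<alpha> 1 = (1::real) \<and>
      (\<forall>p. norm p = 1 \<longrightarrow> f p = e \<longrightarrow> Re (\<psi> p) = l \<eta> + (r \<eta> - l \<eta>) * \<alpha> (U p))"
    if e: "e \<in> {m, M}" and \<eta>: "\<And>p. norm p = 1 \<Longrightarrow> f p = e \<Longrightarrow> Im (\<psi> p) = \<eta>" "\<eta> \<in> {y0..y1}"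
      "\<psi> (a e) = Complex (l \<eta>) \<eta>" "\<psi> (b e) = Complex (r \<eta>) \<eta>" for e \<eta>
  proof (cases "a e = b e")
    case True
    then have eq: "l \<eta> = r \<eta>" using \<eta> by simp
    have "p = a e" if "norm p = 1" "f p = e" for p using deg[of p] that True by auto
    \<comment> \<open>A one-point end level faces a slice of width 0, so any reparametrisation fits;
      the identity is taken.\<close>
    then show ?thesis using \<eta> eq by (intro exI[of _ "\<lambda>t. t"]) (auto simp: strict_mono_on_def)
  next
    case False
    have em: "e \<in> {m..M}" using e mM by auto
    let ?L = "level f e"
    have L: "p \<in> ?L \<longleftrightarrow> norm p = 1 \<and> f p = e" for p
      using e top_level bottom_level by (auto simp: set_eq_iff)
    have Lc: "connected ?L" by (rule connected_level[OF em])
    have "?L \<subseteq> cball 0 1" by (auto simp: level_def)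
    then have Lk: "compact ?L" using closed_level bounded_subset[OF bounded_cball]
      by (metis compact_eq_bounded_closed)
    have ab: "a e \<in> ?L" "b e \<in> ?L" unfolding L using a_on[OF em] b_on[OF em] by auto
    have neq: "l \<eta> \<noteq> r \<eta>"
      using inj_onD[OF \<psi>(2), of "a e" "b e"] \<eta> False a_on[OF em] b_on[OF em] by auto
    have Uc: "continuous_on ?L U" by (rule continuous_on_subset[OF U(2)]) (use False in \<open>auto simp: level_def\<close>)
    have Ui: "inj_on U ?L" using U(4) by (auto simp: inj_on_def level_def)
    have Ur: "U ` ?L \<subseteq> {0..1}" using U(1) by (auto simp: level_def)
    have gc: "continuous_on ?L (\<lambda>p. Re (\<psi> p))"
      by (intro continuous_intros continuous_on_subset[OF \<psi>(1)]) (auto simp: L)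
    have gi: "inj_on (\<lambda>p. Re (\<psi> p)) ?L"
    proof (rule inj_onI)
      fix p q assume "p \<in> ?L" "q \<in> ?L" "Re (\<psi> p) = Re (\<psi> q)"
      then have "\<psi> p = \<psi> q" "norm p = 1" "norm q = 1" using \<eta>(1) by (auto simp: L complex_eq_iff)
      then show "p = q" using inj_onD[OF \<psi>(2)] by simp
    qed
    have "l \<eta> < r \<eta>" using lr_le[OF \<eta>(2)] neq by simp
    then obtain \<alpha> where "continuous_on {0..1} \<alpha>" "strict_mono_on {0..1} \<alpha>" "\<alpha> 0 = 0" "\<alpha> 1 = (1::real)"
      "\<And>p. p \<in> ?L \<Longrightarrow> Re (\<psi> p) = l \<eta> + (r \<eta> - l \<eta>) * \<alpha> (U p)"
      using end_reparametrisation[OF Lk Lc ab Uc Ui Ur _ _ gc gi] U(3)[OF em False] \<eta> by auto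
    then show ?thesis unfolding L by blast
  qed
  note ex = this
  obtain \<alpha>1 where \<alpha>1: "continuous_on {0..1} \<alpha>1" "strict_mono_on {0..1} \<alpha>1" "\<alpha>1 0 = 0" "\<alpha>1 1 = (1::real)"
      "\<And>p. norm p = 1 \<Longrightarrow> f p = M \<Longrightarrow> Re (\<psi> p) = l y1 + (r y1 - l y1) * \<alpha>1 (U p)"
    using ex[of M y1] top corners y by auto
  obtain \<alpha>0 where \<alpha>0: "continuous_on {0..1} \<alpha>0" "strict_mono_on {0..1} \<alpha>0" "\<alpha>0 0 = 0" "\<alpha>0 1 = (1::real)"
      "\<And>p. norm p = 1 \<Longrightarrow> f p = m \<Longrightarrow> Re (\<psi> p) = l y0 + (r y0 - l y0) * \<alpha>0 (U p)"
    using ex[of m y0] bot corners y by auto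
  have range: "\<alpha> t \<in> {0..1}" if "strict_mono_on {0..1} \<alpha>" "\<alpha> 0 = 0" "\<alpha> 1 = (1::real)" "t \<in> {0..1}" for \<alpha> :: "real \<Rightarrow> real" and t
    using strict_mono_on_leD[OF that(1), of 0 t] strict_mono_on_leD[OF that(1), of t 1] that by auto
  define s where "s w = (f w - m) / (M - m)" for w
  define Y where "Y w = y0 + s w * (y1 - y0)" for w
  define \<Phi> where "\<Phi> w = (1 - s w) * \<alpha>0 (U w) + s w * \<alpha>1 (U w)" for w
  define H where "H w = Complex (l (Y w) + (r (Y w) - l (Y w)) * \<Phi> w) (Y w)" for w
  have s01: "s w \<in> {0..1}" if "norm w \<le> 1" for w
    using f_range[OF that] mM by (auto simp: s_def divide_simps)
  have Yr: "Y w \<in> {y0..y1}" if "norm w \<le> 1" for w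
  proof -
    have "0 \<le> s w * (y1 - y0)" "s w * (y1 - y0) \<le> y1 - y0"
      using s01[OF that] y by (auto intro: mult_left_le_one_le)
    then show ?thesis unfolding Y_def by auto
  qed
  have Yeq: "f p = f q" if "Y p = Y q" for p q
    using that y mM unfolding Y_def s_def by (simp add: divide_simps)
  have \<Phi>01: "\<Phi> w \<in> {0..1}" if "norm w \<le> 1" for w
  proof -
    have r: "\<alpha>0 (U w) \<in> {0..1}" "\<alpha>1 (U w) \<in> {0..1}"
      using range \<alpha>0 \<alpha>1 U(1)[OF that] by blast+
    have "\<Phi> w \<le> (1 - s w) * 1 + s w * 1" unfolding \<Phi>_def
      using r s01[OF that] by (intro add_mono mult_left_mono) auto
    then show ?thesis using r s01[OF that] unfolding \<Phi>_def by auto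
  qed
  have scont: "continuous_on (cball 0 1) s" unfolding s_def using mM by (intro continuous_intros cont_f) auto
  have Ycont: "continuous_on (cball 0 1) Y" unfolding Y_def by (intro continuous_intros scont)
  let ?T = "{w \<in> cball 0 1. a (f w) \<noteq> b (f w)}"
  \<comment> \<open>The corner conditions turn a one-point end level into a one-point slice of the
    model domain.\<close>
  have vanish: "r (Y w) - l (Y w) = 0" if "norm w \<le> 1" "a (f w) = b (f w)" for w
  proof -
    have "f w = m \<or> f w = M" using a_neq_b[of "f w"] f_range[OF that(1)] that(2) by force
    moreover have "Y w = y0" if "f w = m" using that by (simp add: Y_def s_def)
    moreover have "Y w = y1" if "f w = M" using that mM by (simp add: Y_def s_def)
    ultimately show ?thesis using corners that(2) by auto
  qed
  have Hcont: "continuous_on (cball 0 1) H"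
  proof -
    have lY: "continuous_on (cball 0 1) (\<lambda>w. l (Y w))" "continuous_on (cball 0 1) (\<lambda>w. r (Y w))"
      using Yr by (auto intro!: continuous_on_compose2[OF cl Ycont] continuous_on_compose2[OF cr Ycont])
    have T: "?T \<subseteq> cball 0 1" by auto
    have \<alpha>U: "continuous_on ?T (\<lambda>w. \<alpha>0 (U w))" "continuous_on ?T (\<lambda>w. \<alpha>1 (U w))"
      using U(1) by (intro continuous_on_compose2[OF \<alpha>0(1) U(2)] continuous_on_compose2[OF \<alpha>1(1) U(2)]; force)+
    have "continuous_on ?T \<Phi>" unfolding \<Phi>_def
      by (intro continuous_intros \<alpha>U continuous_on_subset[OF scont T])
    moreover have "openin (top_of_set (cball 0 1)) ?T"
    proof -
      have c: "continuous_on (cball 0 1) (\<lambda>w. a (f w) - b (f w))"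
        by (intro continuous_intros continuous_on_compose2[OF cont_a cont_f] continuous_on_compose2[OF cont_b cont_f])
          (use f_range in auto)
      have "?T = cball 0 1 \<inter> (\<lambda>w. a (f w) - b (f w)) -` (- {0})" by auto
      then show ?thesis using continuous_openin_preimage_gen[OF c, of "- {0}"] by auto
    qed
    moreover have "continuous_on (cball 0 1) (\<lambda>w. r (Y w) - l (Y w))" by (intro continuous_intros lY)
    ultimately have P: "continuous_on (cball 0 1) (\<lambda>w. (r (Y w) - l (Y w)) * \<Phi> w)"
      using \<Phi>01 vanish by (intro continuous_on_mult_vanishing[of _ _ ?T]) auto
    show ?thesis unfolding H_def Complex_eq
      by (intro continuous_on_add continuous_on_mult continuous_on_const continuous_on_of_real lY(1) Ycont P)
  qed
  have mono: "\<Phi> p \<noteq> \<Phi> q" if "norm p \<le> 1" "norm q \<le> 1" "f p = f q" "U p < U q" for p q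
  proof -
    have u: "U p \<in> {0..1}" "U q \<in> {0..1}" using U(1) that by auto
    have d: "\<alpha>0 (U p) < \<alpha>0 (U q)" "\<alpha>1 (U p) < \<alpha>1 (U q)"
      using strict_mono_onD[OF \<alpha>0(2) u that(4)] strict_mono_onD[OF \<alpha>1(2) u that(4)] by auto
    have "s p = s q" using that by (simp add: s_def)
    moreover have "(1 - s q) * \<alpha>0 (U p) + s q * \<alpha>1 (U p) < (1 - s q) * \<alpha>0 (U q) + s q * \<alpha>1 (U q)"
    \<comment> \<open>In each case one weight is certainly positive: that of
      \<open>\<alpha>0\<close> if \<open>s q = 0\<close>, that of \<open>\<alpha>1\<close>
      otherwise.\<close>
    proof (cases "s q = 0")
      case False
      then have "0 < s q" "s q \<le> 1" using s01[OF that(2)] by auto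
      then show ?thesis using d by (intro add_le_less_mono mult_left_mono mult_strict_left_mono) auto
    qed (use d in simp)
    ultimately show ?thesis unfolding \<Phi>_def by simp
  qed
  have Hinj: "inj_on H (cball 0 1)"
  proof (rule inj_onI)
    fix p q :: complex assume pq: "p \<in> cball 0 1" "q \<in> cball 0 1" "H p = H q"
    then have n: "norm p \<le> 1" "norm q \<le> 1" by auto
    have eq: "Y p = Y q" "(r (Y p) - l (Y p)) * \<Phi> p = (r (Y q) - l (Y q)) * \<Phi> q"
      using pq(3) unfolding H_def by auto
    have fe: "f p = f q" using Yeq eq(1) by blast
    show "p = q"
    proof (cases "a (f p) = b (f p)")
      case True
      then show ?thesis using deg[OF n(1)] deg[OF n(2)] fe by simp
    next
      case False
      \<comment> \<open>Converse of \<open>vanish\<close>: on an end level with two distinct ends,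
        injectivity of \<psi> separates the corners.\<close>
      have "r (Y p) - l (Y p) \<noteq> 0"
      proof (cases "f p = m \<or> f p = M")
        case True
        have "Y p = y0" if "f p = m" using that by (simp add: Y_def s_def)
        moreover have "Y p = y1" if "f p = M" using that mM by (simp add: Y_def s_def)
        ultimately show ?thesis using True False corners
            inj_onD[OF \<psi>(2), of "a (f p)" "b (f p)"] a_on[of "f p"] b_on[of "f p"] mM by auto
      next
        case nend: False
        then have "0 < s p" "s p < 1" using f_range[OF n(1)] by (auto simp: s_def divide_simps)
        then have "y0 < Y p" "Y p < y1" unfolding Y_def
            using y mult_strict_right_mono[of "s p" 1 "y1 - y0"] by (simp_all add: algebra_simps)
        then show ?thesis using lr by fastforce
      qed
      then have "\<Phi> p = \<Phi> q" using eq by simp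
      then have "U p = U q" using mono[of p q] mono[of q p] n fe by (metis linorder_less_linear)
      then show ?thesis using U(4) n fe by blast
    qed
  qed
  have HE: "H w \<in> E" if "norm w \<le> 1" for w
  proof -
    have "0 \<le> r (Y w) - l (Y w)" using lr_le[OF Yr[OF that]] by simp
    moreover have "(r (Y w) - l (Y w)) * \<Phi> w \<le> r (Y w) - l (Y w)"
      using calculation \<Phi>01[OF that] by (intro mult_left_le) auto
    ultimately show ?thesis using Yr[OF that] \<Phi>01[OF that] unfolding E H_def by auto
  qed
  have "E \<subseteq> H ` cball 0 1"
  proof
    fix z assume "z \<in> E"
    then have z: "Im z \<in> {y0..y1}" "l (Im z) \<le> Re z" "Re z \<le> r (Im z)" unfolding E by auto
    \<comment> \<open>Solves \<open>Y w = Im z\<close> for the value \<open>e\<close> of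
      \<open>f\<close>.\<close>
    define \<theta> where "\<theta> = (Im z - y0) / (y1 - y0)"
    define e where "e = m + (M - m) * \<theta>"
    have "0 \<le> \<theta>" "\<theta> \<le> 1" using z y by (auto simp: \<theta>_def divide_simps)
    then have "0 \<le> (M - m) * \<theta>" "(M - m) * \<theta> \<le> M - m"
      using mM by (auto intro: mult_left_le)
    then have e: "e \<in> {m..M}" unfolding e_def by auto
    have Ye: "Y w = Im z" if "f w = e" for w using that mM y unfolding Y_def s_def e_def \<theta>_def by simp
    have ab: "a e \<in> level f e" "b e \<in> level f e" using a_on[OF e] b_on[OF e] by (auto simp: level_def)
    have H01: "Re (H (a e)) = l (Im z)" "Re (H (b e)) = r (Im z)"
    proof -
      have "a (f (a e)) = a e" "b (f (a e)) = b e" "f (a e) = e" "f (b e) = e" "norm (a e) = 1"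
        using a_on[OF e] b_on[OF e] by auto
      then have "a e = b e \<Longrightarrow> r (Im z) - l (Im z) = 0" using vanish[of "a e"] Ye[of "a e"] by simp
      moreover have "a e \<noteq> b e \<Longrightarrow> \<Phi> (a e) = 0 \<and> \<Phi> (b e) = 1"
        using U(3)[OF e] \<alpha>0 \<alpha>1 unfolding \<Phi>_def by simp
      ultimately show "Re (H (a e)) = l (Im z)" "Re (H (b e)) = r (Im z)"
        using Ye[of "a e"] Ye[of "b e"] \<open>f (a e) = e\<close> \<open>f (b e) = e\<close> unfolding H_def
        by (cases "a e = b e"; auto)+
    qed
    have "continuous_on (level f e) (\<lambda>w. Re (H w))"
      by (intro continuous_intros continuous_on_subset[OF Hcont]) (auto simp: level_def)
    then have "connected ((\<lambda>w. Re (H w)) ` level f e)"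
      using connected_level[OF e] by (rule connected_continuous_image)
    then have "Re z \<in> (\<lambda>w. Re (H w)) ` level f e"
      using connectedD_interval[of _ "Re (H (a e))" "Re (H (b e))" "Re z"] imageI[OF ab(1)] imageI[OF ab(2)]
        z H01 by metis
    then obtain w where "w \<in> level f e" "Re (H w) = Re z" by force
    then have "norm w \<le> 1" "H w = z" using Ye[of w] unfolding level_def H_def by (auto simp: complex_eq_iff)
    then show "z \<in> H ` cball 0 1" by auto
  qed
  then have Him: "H ` cball 0 1 = E" using HE by auto
  obtain H' where H': "homeomorphism (cball 0 1) E H H'"
    using homeomorphism_compact[OF compact_cball Hcont Him Hinj] by blast
  have "H p = \<psi> p" if "norm p = 1" "f p \<in> {m, M}" for p
  proof -
    have "f p = m \<or> f p = M" using that(2) by blast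
    then show ?thesis
    proof (elim disjE)
      assume 1: "f p = m"
      then have "s p = 0" "Y p = y0" unfolding Y_def s_def by auto
      then show ?thesis unfolding H_def \<Phi>_def using \<alpha>0(5) bot that 1 by (simp add: complex_eq_iff)
    next
      assume 2: "f p = M"
      then have "s p = 1" "Y p = y1" unfolding Y_def s_def using mM by auto
      then show ?thesis unfolding H_def \<Phi>_def using \<alpha>1(5) top that 2 by (simp add: complex_eq_iff)
    qed
  qed
  moreover have "f (H' z) = m + (M - m) * (Im z - y0) / (y1 - y0)" if "z \<in> E" for z
  proof -
    have "Y (H' z) = Im z" using homeomorphism_apply2[OF H' that] unfolding H_def by (metis complex.sel(2))
    then have "s (H' z) * (y1 - y0) = Im z - y0" unfolding Y_def by simp
    then have "s (H' z) = (Im z - y0) / (y1 - y0)" using y by (simp add: field_simps)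
    then have "(f (H' z) - m) / (M - m) = (Im z - y0) / (y1 - y0)" unfolding s_def .
    then have "f (H' z) - m = (M - m) * ((Im z - y0) / (y1 - y0))" using mM by (simp add: field_simps)
    then show ?thesis by simp
  qed
  ultimately show ?thesis using H' by blast
qed

end

lemma connected_two_valued:
  fixes g :: "'a::topological_space \<Rightarrow> real"
  assumes "connected S" "continuous_on S g" "\<And>x. x \<in> S \<Longrightarrow> g x = c \<or> g x = d"
  shows "(\<forall>x\<in>S. g x = c) \<or> (\<forall>x\<in>S. g x = d)"
proof (rule ccontr)
  assume "\<not> ?thesis"
  then obtain x y where xy: "x \<in> S" "y \<in> S" "g x = d" "g y = c" "c \<noteq> d" using assms(3) by metis
  have "connected (g ` S)" by (rule connected_continuous_image[OF assms(2,1)])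
  moreover have "g ` S = {c, d}" using assms(3) xy by auto
  ultimately have "connected {c, d}" by simp
  then show False using connected_finite_iff_sing[of "{c, d}"] xy(5) by (auto simp: doubleton_eq_iff)
qed

context disc_flow
begin

text \<open>The sides are prescribed over intermediate values only; the four corner conditions of
  \<open>straighten\<close> follow by continuity at \<open>m\<close> and \<open>M\<close>.\<close>

lemma straighten_sided:
  fixes \<psi> :: "complex \<Rightarrow> complex" and l r :: "real \<Rightarrow> real"
  assumes y: "y0 < y1" and cl: "continuous_on {y0..y1} l" and cr: "continuous_on {y0..y1} r"
    and lr: "\<And>y. y0 < y \<Longrightarrow> y < y1 \<Longrightarrow> l y < r y"
    and E: "E = {z. y0 \<le> Im z \<and> Im z \<le> y1 \<and> l (Im z) \<le> Re z \<and> Re z \<le> r (Im z)}"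
    and \<psi>: "continuous_on (sphere 0 1) \<psi>" "inj_on \<psi> (sphere (0::complex) 1)"
    and top: "\<And>p. norm p = 1 \<Longrightarrow> f p = M \<Longrightarrow> Im (\<psi> p) = y1"
    and bot: "\<And>p. norm p = 1 \<Longrightarrow> f p = m \<Longrightarrow> Im (\<psi> p) = y0"
    and left: "\<And>y. m < y \<Longrightarrow> y < M \<Longrightarrow> \<psi> (a y) \<in> E \<and> Re (\<psi> (a y)) = l (Im (\<psi> (a y)))"
    and right: "\<And>y. m < y \<Longrightarrow> y < M \<Longrightarrow> \<psi> (b y) \<in> E \<and> Re (\<psi> (b y)) = r (Im (\<psi> (b y)))"
  shows "\<exists>H H'. homeomorphism (cball 0 1) E H H' \<and> (\<forall>p. norm p = 1 \<longrightarrow> f p \<in> {m, M} \<longrightarrow> H p = \<psi> p) \<and>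
    (\<forall>z\<in>E. f (H' z) = m + (M - m) * (Im z - y0) / (y1 - y0))"
proof -
  have side: "Re (\<psi> (g e)) = k (Im (\<psi> (g e)))"
    if g: "continuous_on {m..M} g" "\<And>y. y \<in> {m..M} \<Longrightarrow> norm (g y) = 1 \<and> f (g y) = y"
      and k: "continuous_on {y0..y1} k"
      and s: "\<And>y. m < y \<Longrightarrow> y < M \<Longrightarrow> \<psi> (g y) \<in> E \<and> Re (\<psi> (g y)) = k (Im (\<psi> (g y)))"
      and e: "e \<in> {m..M}" for g k e
  proof -
    have c: "continuous_on {m..M} (\<lambda>y. \<psi> (g y))"
      by (rule continuous_on_compose2[OF \<psi>(1) g(1)]) (use g(2) in auto)
    have Imr: "Im (\<psi> (g y)) \<in> {y0..y1}" if "y \<in> {m..M}" for y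
    proof -
      consider "y = m" | "y = M" | "m < y" "y < M" using \<open>y \<in> {m..M}\<close> by force
      then show ?thesis using top[of "g y"] bot[of "g y"] g(2)[OF that] s[of y] y unfolding E by cases auto
    qed
    have c2: "continuous_on {m..M} (\<lambda>y. Re (\<psi> (g y)) - k (Im (\<psi> (g y))))"
      by (intro continuous_intros c continuous_on_compose2[OF k]) (use Imr in auto)
    have "closure {m<..<M} = {m..M}" using mM by simp
    then have "Re (\<psi> (g e)) - k (Im (\<psi> (g e))) = 0"
      using continuous_constant_on_closure[of "{m<..<M}" "\<lambda>y. Re (\<psi> (g y)) - k (Im (\<psi> (g y)))" 0 e]
        c2 s e by simp
    then show ?thesis by simp
  qed
  have em: "m \<in> {m..M}" "M \<in> {m..M}" using mM by auto
  have "\<psi> (a M) = Complex (l y1) y1" "\<psi> (a m) = Complex (l y0) y0"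
    using side[OF cont_a a_on cl left] em top[of "a M"] bot[of "a m"] a_on[OF em(1)] a_on[OF em(2)]
    by (auto simp: complex_eq_iff)
  moreover have "\<psi> (b M) = Complex (r y1) y1" "\<psi> (b m) = Complex (r y0) y0"
    using side[OF cont_b b_on cr right] em top[of "b M"] bot[of "b m"] b_on[OF em(1)] b_on[OF em(2)]
    by (auto simp: complex_eq_iff)
  ultimately show ?thesis using straighten[OF y cl cr lr E \<psi> top bot] by blast
qed

text \<open>Connectedness puts the image of each section on one graph. They cannot share a graph,
  because the image contains the points of both graphs at the middle height; if left and right are
  interchanged, \<open>swap\<close> exchanges the roles of \<open>a\<close> and
  \<open>b\<close>.\<close>

lemma straighten_oriented:
  fixes \<psi> :: "complex \<Rightarrow> complex" and l r :: "real \<Rightarrow> real"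
  assumes y: "y0 < y1" and cl: "continuous_on {y0..y1} l" and cr: "continuous_on {y0..y1} r"
    and lr: "\<And>y. y0 < y \<Longrightarrow> y < y1 \<Longrightarrow> l y < r y"
    and E: "E = {z. y0 \<le> Im z \<and> Im z \<le> y1 \<and> l (Im z) \<le> Re z \<and> Re z \<le> r (Im z)}"
    and \<psi>: "continuous_on (sphere 0 1) \<psi>" "inj_on \<psi> (sphere (0::complex) 1)"
    and top: "\<And>p. norm p = 1 \<Longrightarrow> f p = M \<Longrightarrow> Im (\<psi> p) = y1"
    and bot: "\<And>p. norm p = 1 \<Longrightarrow> f p = m \<Longrightarrow> Im (\<psi> p) = y0"
    and im: "\<psi> ` {p \<in> sphere 0 1. m < f p \<and> f p < M} =
      {z \<in> E. y0 < Im z \<and> Im z < y1 \<and> (Re z = l (Im z) \<or> Re z = r (Im z))}"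
  shows "\<exists>H H'. homeomorphism (cball 0 1) E H H' \<and> (\<forall>p. norm p = 1 \<longrightarrow> f p \<in> {m, M} \<longrightarrow> H p = \<psi> p) \<and>
    (\<forall>z\<in>E. f (H' z) = m + (M - m) * (Im z - y0) / (y1 - y0))"
proof -
  have sides: "(\<forall>y\<in>{m<..<M}. Re (\<psi> (g y)) = l (Im (\<psi> (g y)))) \<or> (\<forall>y\<in>{m<..<M}. Re (\<psi> (g y)) = r (Im (\<psi> (g y))))"
    "\<And>y. m < y \<Longrightarrow> y < M \<Longrightarrow> \<psi> (g y) \<in> E \<and> y0 < Im (\<psi> (g y)) \<and> Im (\<psi> (g y)) < y1"
    if g: "continuous_on {m..M} g" "\<And>y. y \<in> {m..M} \<Longrightarrow> norm (g y) = 1 \<and> f (g y) = y" for g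
  proof -
    have *: "\<psi> (g y) \<in> {z \<in> E. y0 < Im z \<and> Im z < y1 \<and> (Re z = l (Im z) \<or> Re z = r (Im z))}" if "m < y" "y < M" for y
      using g(2)[of y] that unfolding im[symmetric] by auto
    then show "\<And>y. m < y \<Longrightarrow> y < M \<Longrightarrow> \<psi> (g y) \<in> E \<and> y0 < Im (\<psi> (g y)) \<and> Im (\<psi> (g y)) < y1" by blast
    have c: "continuous_on {m<..<M} (\<lambda>y. \<psi> (g y))"
      by (rule continuous_on_compose2[OF \<psi>(1) continuous_on_subset[OF g(1)]]) (use g(2) in auto)
    \<comment> \<open>The relative position between the graphs, 0 on the left and 1 on the right
      one; being continuous and two-valued on an interval, it is constant.\<close>
    let ?q = "\<lambda>y. (Re (\<psi> (g y)) - l (Im (\<psi> (g y)))) / (r (Im (\<psi> (g y))) - l (Im (\<psi> (g y))))"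
    have pos: "r (Im (\<psi> (g y))) - l (Im (\<psi> (g y))) > 0" if "y \<in> {m<..<M}" for y
      using lr[of "Im (\<psi> (g y))"] *[of y] that by auto
    have lc: "continuous_on {m<..<M} (\<lambda>y. l (Im (\<psi> (g y))))" "continuous_on {m<..<M} (\<lambda>y. r (Im (\<psi> (g y))))"
      by (rule continuous_on_compose2[OF cl], use * in \<open>force intro!: continuous_intros c\<close>, use * in force)
         (rule continuous_on_compose2[OF cr], use * in \<open>force intro!: continuous_intros c\<close>, use * in force)
    have "continuous_on {m<..<M} ?q"
      by (intro continuous_intros c lc) (use pos in force)
    moreover have "?q y = 0 \<or> ?q y = 1" if "y \<in> {m<..<M}" for y
      using *[of y] pos[OF that] that by auto
    ultimately have "(\<forall>y\<in>{m<..<M}. ?q y = 0) \<or> (\<forall>y\<in>{m<..<M}. ?q y = 1)"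
      by (intro connected_two_valued) auto
    then show "(\<forall>y\<in>{m<..<M}. Re (\<psi> (g y)) = l (Im (\<psi> (g y)))) \<or> (\<forall>y\<in>{m<..<M}. Re (\<psi> (g y)) = r (Im (\<psi> (g y))))"
      using pos by (fastforce simp: divide_simps)
  qed
  note a = sides[OF cont_a a_on] and b = sides[OF cont_b b_on]
  define y2 where "y2 = (y0 + y1) / 2"
  have y2: "y0 < y2" "y2 < y1" using y by (auto simp: y2_def)
  have hit: "\<exists>y. m < y \<and> y < M \<and> (\<psi> (a y) = z \<or> \<psi> (b y) = z)"
    if "z = Complex (l y2) y2 \<or> z = Complex (r y2) y2" for z
  proof -
    have "z \<in> \<psi> ` {p \<in> sphere 0 1. m < f p \<and> f p < M}"
      unfolding im E using that y2 lr[OF y2] by auto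
    then obtain p where p: "norm p = 1" "m < f p" "f p < M" "\<psi> p = z" by auto
    then show ?thesis using circle_cover[of p] a_on b_on by auto
  qed
  have "\<not> ((\<forall>y\<in>{m<..<M}. Re (\<psi> (a y)) = r (Im (\<psi> (a y)))) \<and> (\<forall>y\<in>{m<..<M}. Re (\<psi> (b y)) = r (Im (\<psi> (b y)))))"
  proof -
    obtain y where "m < y" "y < M" "\<psi> (a y) = Complex (l y2) y2 \<or> \<psi> (b y) = Complex (l y2) y2"
      using hit[of "Complex (l y2) y2"] by blast
    then show ?thesis using lr[OF y2] by (auto intro!: bexI[of _ y])
  qed
  moreover have "\<not> ((\<forall>y\<in>{m<..<M}. Re (\<psi> (a y)) = l (Im (\<psi> (a y)))) \<and> (\<forall>y\<in>{m<..<M}. Re (\<psi> (b y)) = l (Im (\<psi> (b y)))))"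
  proof -
    obtain y where "m < y" "y < M" "\<psi> (a y) = Complex (r y2) y2 \<or> \<psi> (b y) = Complex (r y2) y2"
      using hit[of "Complex (r y2) y2"] by blast
    then show ?thesis using lr[OF y2] by (auto intro!: bexI[of _ y])
  qed
  ultimately consider "\<forall>y\<in>{m<..<M}. Re (\<psi> (a y)) = l (Im (\<psi> (a y)))" "\<forall>y\<in>{m<..<M}. Re (\<psi> (b y)) = r (Im (\<psi> (b y)))"
    | "\<forall>y\<in>{m<..<M}. Re (\<psi> (a y)) = r (Im (\<psi> (a y)))" "\<forall>y\<in>{m<..<M}. Re (\<psi> (b y)) = l (Im (\<psi> (b y)))"
    using a(1) b(1) by blast
  then show ?thesis
  proof cases
    case 1
    show ?thesis
      by (rule straighten_sided[OF y cl cr lr E \<psi> top bot]) (use 1 a(2) b(2) in auto)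
  next
    case 2
    show ?thesis
      by (rule disc_flow.straighten_sided[OF swap y cl cr lr E \<psi> top bot]) (use 2 a(2) b(2) in auto)
  qed
qed

text \<open>Each end level is connected and is mapped into the two extreme heights, so it stays at
  one of them, and both heights occur. If \<psi> turns the end levels upside down,
  \<open>flip\<close> applies and the slope becomes negative.\<close>

lemma straighten_to:
  fixes \<psi> :: "complex \<Rightarrow> complex" and l r :: "real \<Rightarrow> real"
  assumes y: "y0 < y1" and cl: "continuous_on {y0..y1} l" and cr: "continuous_on {y0..y1} r"
    and lr: "\<And>y. y0 < y \<Longrightarrow> y < y1 \<Longrightarrow> l y < r y" "l y0 \<le> r y0" "l y1 \<le> r y1"
    and E: "E = {z. y0 \<le> Im z \<and> Im z \<le> y1 \<and> l (Im z) \<le> Re z \<and> Re z \<le> r (Im z)}"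
    and \<psi>: "continuous_on (sphere 0 1) \<psi>" "inj_on \<psi> (sphere (0::complex) 1)"
    and im: "\<psi> ` sphere 0 1 = {z \<in> E. Im z \<in> {y0, y1} \<or> Re z \<in> {l (Im z), r (Im z)}}"
    and ends: "\<psi> ` {p \<in> sphere 0 1. f p \<in> {m, M}} = {z \<in> E. Im z \<in> {y0, y1}}"
  shows "\<exists>H H' \<alpha> \<beta>. homeomorphism (cball 0 1) E H H' \<and> (\<forall>p. norm p = 1 \<longrightarrow> f p \<in> {m, M} \<longrightarrow> H p = \<psi> p) \<and>
    \<alpha> \<noteq> 0 \<and> (\<forall>z\<in>E. f (H' z) = \<alpha> * Im z + \<beta>)"
proof -
  have const: "(\<forall>p\<in>level f e. Im (\<psi> p) = y0) \<or> (\<forall>p\<in>level f e. Im (\<psi> p) = y1)" if e: "e \<in> {m, M}" for e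
  proof (rule connected_two_valued)
    have sub: "level f e \<subseteq> {p \<in> sphere 0 1. f p \<in> {m, M}}" using e top_level bottom_level by auto
    show "connected (level f e)" using e connected_level mM by auto
    show "continuous_on (level f e) (\<lambda>p. Im (\<psi> p))"
      using sub by (intro continuous_intros continuous_on_subset[OF \<psi>(1)]) auto
    show "Im (\<psi> p) = y0 \<or> Im (\<psi> p) = y1" if "p \<in> level f e" for p
    proof -
      have "\<psi> p \<in> {z \<in> E. Im z \<in> {y0, y1}}" unfolding ends[symmetric] using sub that by blast
      then show ?thesis by blast
    qed
  qed
  have endp: "\<exists>p. p \<in> level f m \<union> level f M \<and> \<psi> p = z" if "z \<in> E" "Im z \<in> {y0, y1}" for z
  proof -
    have "z \<in> \<psi> ` {p \<in> sphere 0 1. f p \<in> {m, M}}" unfolding ends using that by blast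
    then show ?thesis using top_level bottom_level by auto
  qed
  have "\<not> ((\<forall>p\<in>level f m. Im (\<psi> p) = y0) \<and> (\<forall>p\<in>level f M. Im (\<psi> p) = y0))"
  proof -
    obtain p where "p \<in> level f m \<union> level f M" "\<psi> p = Complex (l y1) y1"
      using endp[of "Complex (l y1) y1"] y lr by (auto simp: E)
    then show ?thesis using y by force
  qed
  moreover have "\<not> ((\<forall>p\<in>level f m. Im (\<psi> p) = y1) \<and> (\<forall>p\<in>level f M. Im (\<psi> p) = y1))"
  proof -
    obtain p where "p \<in> level f m \<union> level f M" "\<psi> p = Complex (l y0) y0"
      using endp[of "Complex (l y0) y0"] y lr by (auto simp: E)
    then show ?thesis using y by force
  qed
  ultimately have cases: "((\<forall>p\<in>level f m. Im (\<psi> p) = y0) \<and> (\<forall>p\<in>level f M. Im (\<psi> p) = y1)) \<or>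
      ((\<forall>p\<in>level f m. Im (\<psi> p) = y1) \<and> (\<forall>p\<in>level f M. Im (\<psi> p) = y0))"
    using const[of m] const[of M] by blast
  have im': "\<psi> ` {p \<in> sphere 0 1. m < f p \<and> f p < M} =
      {z \<in> E. y0 < Im z \<and> Im z < y1 \<and> (Re z = l (Im z) \<or> Re z = r (Im z))}" (is "_ = ?R")
  proof -
    have "{p \<in> sphere 0 1. m < f p \<and> f p < M} = sphere 0 1 - {p \<in> sphere 0 1. f p \<in> {m, M}}"
      using f_le f_ge by (force simp: order_less_le)
    then have "\<psi> ` {p \<in> sphere 0 1. m < f p \<and> f p < M} =
        \<psi> ` (sphere 0 1 - {p \<in> sphere 0 1. f p \<in> {m, M}})" by (simp only:)
    also have "\<dots> = \<psi> ` sphere 0 1 - \<psi> ` {p \<in> sphere 0 1. f p \<in> {m, M}}"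
      by (rule inj_on_image_set_diff[OF \<psi>(2)]) blast+
    also have "\<dots> = ?R" unfolding im ends by (auto simp: E)
    finally show ?thesis .
  qed
  from cases show ?thesis
  proof (elim disjE conjE)
    assume "\<forall>p\<in>level f m. Im (\<psi> p) = y0" "\<forall>p\<in>level f M. Im (\<psi> p) = y1"
    then have t: "\<And>p. norm p = 1 \<Longrightarrow> f p = M \<Longrightarrow> Im (\<psi> p) = y1" "\<And>p. norm p = 1 \<Longrightarrow> f p = m \<Longrightarrow> Im (\<psi> p) = y0"
      by (auto simp: level_def)
    obtain H H' where H: "homeomorphism (cball 0 1) E H H'" "\<forall>p. norm p = 1 \<longrightarrow> f p \<in> {m, M} \<longrightarrow> H p = \<psi> p"
      "\<And>z. z \<in> E \<Longrightarrow> f (H' z) = m + (M - m) * (Im z - y0) / (y1 - y0)"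
      using straighten_oriented[OF y cl cr lr(1) E \<psi> t im'] by blast
    have "f (H' z) = (M - m) / (y1 - y0) * Im z + (m - (M - m) / (y1 - y0) * y0)" if "z \<in> E" for z
      unfolding H(3)[OF that] times_divide_eq_left[symmetric] by (simp only: right_diff_distrib)
    moreover have "(M - m) / (y1 - y0) \<noteq> 0" using mM y by simp
    moreover have "\<forall>p. norm p = 1 \<longrightarrow> f p \<in> {m, M} \<longrightarrow> H p = \<psi> p" using H(2) by simp
    ultimately show ?thesis using H(1) by blast
  next
    assume "\<forall>p\<in>level f m. Im (\<psi> p) = y1" "\<forall>p\<in>level f M. Im (\<psi> p) = y0"
    then have t: "\<And>p. norm p = 1 \<Longrightarrow> - f p = - m \<Longrightarrow> Im (\<psi> p) = y1" "\<And>p. norm p = 1 \<Longrightarrow> - f p = - M \<Longrightarrow> Im (\<psi> p) = y0"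
      by (auto simp: level_def)
    have im'': "\<psi> ` {p \<in> sphere 0 1. - M < - f p \<and> - f p < - m} =
        {z \<in> E. y0 < Im z \<and> Im z < y1 \<and> (Re z = l (Im z) \<or> Re z = r (Im z))}"
      unfolding im'[symmetric] by (rule arg_cong[of _ _ "image \<psi>"]) auto
    obtain H H' where H: "homeomorphism (cball 0 1) E H H'" "\<forall>p. norm p = 1 \<longrightarrow> - f p \<in> {- M, - m} \<longrightarrow> H p = \<psi> p"
      "\<And>z. z \<in> E \<Longrightarrow> - f (H' z) = - M + (- m - - M) * (Im z - y0) / (y1 - y0)"
      using disc_flow.straighten_oriented[OF flip y cl cr lr(1) E \<psi> t im''] by blast
    have "f (H' z) = - ((M - m) / (y1 - y0)) * Im z + (M + (M - m) / (y1 - y0) * y0)" if "z \<in> E" for z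
    proof -
      have "- f (H' z) = - M + (M - m) / (y1 - y0) * (Im z - y0)" using H(3)[OF that] by simp
      then show ?thesis unfolding right_diff_distrib by simp
    qed
    moreover have "- ((M - m) / (y1 - y0)) \<noteq> 0" using mM y by simp
    moreover have "\<forall>p. norm p = 1 \<longrightarrow> f p \<in> {m, M} \<longrightarrow> H p = \<psi> p" using H(2) by simp
    ultimately show ?thesis using H(1) by blast
  qed
qed

end

section \<open>Disc flows from four arcs of a parametrised circle\<close>

lemma cut_chain_arc:
  fixes \<kappa> :: "real \<Rightarrow> complex"
  assumes "p \<le> q" "continuous_on {p..q} \<kappa>" "inj_on \<kappa> {p..q}"
  shows "cut_chain (\<kappa> ` {p..q}) (\<kappa> p) (\<kappa> q)"
proof -
  have cl: "closed (\<kappa> ` {u..v})" if "p \<le> u" "v \<le> q" for u v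
    using that by (intro compact_imp_closed compact_continuous_image continuous_on_subset[OF assms(2)]) auto
  have "\<exists>P Q. splits (\<kappa> ` {p..q}) (\<kappa> p) (\<kappa> q) x P Q" if "x \<in> \<kappa> ` {p..q}" for x
  proof -
    obtain s where s: "x = \<kappa> s" "s \<in> {p..q}" using \<open>x \<in> \<kappa> ` {p..q}\<close> by blast
    have "{p..q} = {p..s} \<union> {s..q}" "{p..s} \<inter> {s..q} = {s}" using s by auto
    then have "\<kappa> ` {p..s} \<union> \<kappa> ` {s..q} = \<kappa> ` {p..q}" "\<kappa> ` {p..s} \<inter> \<kappa> ` {s..q} = {x}"
      using inj_on_image_Int[OF assms(3), of "{p..s}" "{s..q}"] s by (auto simp: image_Un[symmetric])
    then show ?thesis using s unfolding splits_def
      by (intro exI[of _ "\<kappa> ` {p..s}"] exI[of _ "\<kappa> ` {s..q}"]) (auto intro: cl)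
  qed
  moreover have "connected (\<kappa> ` {p..q})" using assms(2) by (intro connected_continuous_image) auto
  ultimately show ?thesis unfolding cut_chain_def using assms(1) cl[of p q] by auto
qed

lemma interval_inverse:
  fixes g :: "real \<Rightarrow> real"
  assumes "continuous_on {p..q} g" "inj_on g {p..q}" "g ` {p..q} = T"
  obtains \<sigma> where "continuous_on T \<sigma>" "\<And>y. y \<in> T \<Longrightarrow> \<sigma> y \<in> {p..q} \<and> g (\<sigma> y) = y"
    "\<And>s. s \<in> {p..q} \<Longrightarrow> \<sigma> (g s) = s"
proof -
  obtain \<sigma> where \<sigma>: "homeomorphism {p..q} T g \<sigma>"
    using homeomorphism_compact[OF _ assms(1,3,2)] by auto
  then have im: "\<sigma> ` T = {p..q}" "continuous_on T \<sigma>" unfolding homeomorphism_def by auto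
  show thesis
  proof (rule that[OF im(2)])
    show "\<sigma> y \<in> {p..q} \<and> g (\<sigma> y) = y" if "y \<in> T" for y
      using homeomorphism_apply2[OF \<sigma> that] im(1) that by blast
  qed (rule homeomorphism_apply1[OF \<sigma>])
qed

text \<open>The sections are inverse functions of \<open>F\<close> along the monotone arcs:
  \<open>a\<close> on the rising first arc, \<open>b\<close> on the falling third one. The end arcs
  then run from \<open>a M\<close> to \<open>b M\<close> and from \<open>b m\<close> to
  \<open>a m\<close>, the latter because \<kappa> closes up at \<open>t5\<close>.\<close>

lemma circle_flow:
  fixes F :: "complex \<Rightarrow> real" and \<kappa> :: "real \<Rightarrow> complex"
  assumes t: "t1 < t2" "t2 \<le> t3" "t3 < t4" "t4 \<le> t5"
    and F: "continuous_on (cball 0 1) F"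
    and \<kappa>: "continuous_on {t1..t5} \<kappa>" "\<kappa> ` {t1..t5} = sphere 0 1" "inj_on \<kappa> {t1..<t5}" "\<kappa> t5 = \<kappa> t1"
    and mono: "strict_mono_on {t1..t2} (\<lambda>s. F (\<kappa> s))" "strict_antimono_on {t3..t4} (\<lambda>s. F (\<kappa> s))"
    and const: "\<And>s. s \<in> {t2..t3} \<Longrightarrow> F (\<kappa> s) = F (\<kappa> t2)" "\<And>s. s \<in> {t4..t5} \<Longrightarrow> F (\<kappa> s) = F (\<kappa> t1)"
    and regular: "\<And>p. norm p < 1 \<Longrightarrow> regular_point (ball 0 1) F p"
    and sec: "\<And>s V. s \<in> {t2<..<t3} \<union> {t4<..<t5} \<Longrightarrow> open V \<Longrightarrow> \<kappa> s \<in> V \<Longrightarrow>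
      \<exists>x\<in>V. F x = F (\<kappa> s) \<and> (\<exists>S. transversal F x S)"
  shows "\<exists>a b. disc_flow F (F (\<kappa> t1)) (F (\<kappa> t2)) a b"
proof -
  define m M where "m = F (\<kappa> t1)" and "M = F (\<kappa> t2)"
  define g where "g s = F (\<kappa> s)" for s
  have sph: "\<kappa> s \<in> sphere 0 1" if "s \<in> {t1..t5}" for s using \<kappa>(2) that by blast
  have gc: "continuous_on {t1..t5} g" unfolding g_def
    by (rule continuous_on_compose2[OF F \<kappa>(1)]) (use sph in auto)
  have g1: "g s < g s'" if "t1 \<le> s" "s < s'" "s' \<le> t2" for s s'
    using strict_mono_onD[OF mono(1), of s s'] that unfolding g_def by auto
  have g3: "g s' < g s" if "t3 \<le> s" "s < s'" "s' \<le> t4" for s s'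
    using monotone_onD[OF mono(2), of s s'] that unfolding g_def by auto
  have gM: "g s = M" if "s \<in> {t2..t3}" for s using const(1)[OF that] by (simp add: g_def M_def)
  have gm: "g s = m" if "s \<in> {t4..t5}" for s using const(2)[OF that] by (simp add: g_def m_def)
  have gt: "g t1 = m" "g t2 = M" "g t3 = M" "g t4 = m" using gM gm t by (auto simp: g_def m_def)
  have mM: "m < M" using g1[of t1 t2] t gt by auto
  have i1: "g ` {t1..t2} = {m..M}"
  proof
    show "g ` {t1..t2} \<subseteq> {m..M}" using g1[of t1] g1[of _ t2] gt by (force simp: le_less)
    have "connected (g ` {t1..t2})"
      using t by (intro connected_continuous_image continuous_on_subset[OF gc]) auto
    then show "{m..M} \<subseteq> g ` {t1..t2}"
      using connected_contains_Icc[of _ m M] gt t by (metis atLeastAtMost_iff imageI less_imp_le order_refl)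
  qed
  have i3: "g ` {t3..t4} = {m..M}"
  proof
    show "g ` {t3..t4} \<subseteq> {m..M}" using g3[of t3] g3[of _ t4] gt by (force simp: le_less)
    have "connected (g ` {t3..t4})"
      using t by (intro connected_continuous_image continuous_on_subset[OF gc]) auto
    then show "{m..M} \<subseteq> g ` {t3..t4}"
      using connected_contains_Icc[of _ m M] gt t by (metis atLeastAtMost_iff imageI less_imp_le order_refl)
  qed
  have c1: "continuous_on {t1..t2} g" "continuous_on {t3..t4} g"
    using t by (auto intro: continuous_on_subset[OF gc])
  have inj: "inj_on g {t1..t2}" "inj_on g {t3..t4}"
  proof -
    show "inj_on g {t1..t2}"
    proof (rule linorder_inj_onI)
      show "g x \<noteq> g y" if "x < y" "x \<in> {t1..t2}" "y \<in> {t1..t2}" for x y using g1[of x y] that by auto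
    qed auto
    show "inj_on g {t3..t4}"
    proof (rule linorder_inj_onI)
      show "g x \<noteq> g y" if "x < y" "x \<in> {t3..t4}" "y \<in> {t3..t4}" for x y using g3[of x y] that by auto
    qed auto
  qed
  obtain \<sigma>1 where \<sigma>1: "continuous_on {m..M} \<sigma>1" "\<And>y. y \<in> {m..M} \<Longrightarrow> \<sigma>1 y \<in> {t1..t2} \<and> g (\<sigma>1 y) = y"
    "\<And>s. s \<in> {t1..t2} \<Longrightarrow> \<sigma>1 (g s) = s" using interval_inverse[OF c1(1) inj(1) i1] by metis
  obtain \<sigma>3 where \<sigma>3: "continuous_on {m..M} \<sigma>3" "\<And>y. y \<in> {m..M} \<Longrightarrow> \<sigma>3 y \<in> {t3..t4} \<and> g (\<sigma>3 y) = y"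
    "\<And>s. s \<in> {t3..t4} \<Longrightarrow> \<sigma>3 (g s) = s" using interval_inverse[OF c1(2) inj(2) i3] by metis
  define a b where "a y = \<kappa> (\<sigma>1 y)" and "b y = \<kappa> (\<sigma>3 y)" for y
  have ends: "a m = \<kappa> t1" "a M = \<kappa> t2" "b M = \<kappa> t3" "b m = \<kappa> t4"
    unfolding a_def b_def using \<sigma>1(3)[of t1] \<sigma>1(3)[of t2] \<sigma>3(3)[of t3] \<sigma>3(3)[of t4] gt t by auto
  have lM: "{p \<in> sphere 0 1. F p = M} = \<kappa> ` {t2..t3}"
  proof
    show "{p \<in> sphere 0 1. F p = M} \<subseteq> \<kappa> ` {t2..t3}"
    proof
      fix p :: complex assume "p \<in> {p \<in> sphere 0 1. F p = M}"
      then have "p \<in> sphere 0 1" "F p = M" by blast+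
      then obtain s where s: "s \<in> {t1..t5}" "p = \<kappa> s" "g s = M" unfolding \<kappa>(2)[symmetric] g_def by auto
      have "\<not> s < t2" using g1[of s t2] s gt by auto
      moreover have "\<not> t3 < s" using g3[of t3 s] gm[of s] s gt mM by fastforce
      ultimately show "p \<in> \<kappa> ` {t2..t3}" using s by auto
    qed
    show "\<kappa> ` {t2..t3} \<subseteq> {p \<in> sphere 0 1. F p = M}" using gM sph t by (auto simp: g_def)
  qed
  have lm: "{p \<in> sphere 0 1. F p = m} = \<kappa> ` {t4..t5}"
  proof
    show "{p \<in> sphere 0 1. F p = m} \<subseteq> \<kappa> ` {t4..t5}"
    proof
      fix p :: complex assume "p \<in> {p \<in> sphere 0 1. F p = m}"
      then have "p \<in> sphere 0 1" "F p = m" by blast+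
      then obtain s where s: "s \<in> {t1..t5}" "p = \<kappa> s" "g s = m" unfolding \<kappa>(2)[symmetric] g_def by auto
      show "p \<in> \<kappa> ` {t4..t5}"
      proof (cases "s = t1")
        case True then show ?thesis using \<kappa>(4) s t by (auto intro!: image_eqI[of _ _ t5])
      next
        case False
        have "\<not> s \<le> t2" using g1[of t1 s] s gt False by auto
        moreover have "\<not> s \<in> {t2..t3}" using gM[of s] s mM by auto
        moreover have "\<not> (t3 \<le> s \<and> s < t4)" using g3[of s t4] s gt by auto
        ultimately show ?thesis using s by auto
      qed
    qed
    show "\<kappa> ` {t4..t5} \<subseteq> {p \<in> sphere 0 1. F p = m}" using gm sph t by (auto simp: g_def)
  qed
  have inj2: "inj_on \<kappa> {t2..t3}" by (rule inj_on_subset[OF \<kappa>(3)]) (use t in auto)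
  \<comment> \<open>Injectivity is given on the half-open interval; at \<open>t5\<close> the value
    is \<open>\<kappa> t1\<close>, and \<open>t1 < t4\<close>.\<close>
  have inj4: "inj_on \<kappa> {t4..t5}"
  proof (rule linorder_inj_onI)
    fix s s' assume "s < s'" "s \<in> {t4..t5}" "s' \<in> {t4..t5}"
    then show "\<kappa> s \<noteq> \<kappa> s'"
      using inj_onD[OF \<kappa>(3), of s s'] inj_onD[OF \<kappa>(3), of s t1] \<kappa>(4) t by (cases "s' = t5") auto
  qed auto
  have "disc_flow F m M a b"
  proof
    show "m < M" by (rule mM)
    show "continuous_on (cball 0 1) F" by (rule F)
    show "continuous_on {m..M} a" unfolding a_def
      by (rule continuous_on_compose2[OF \<kappa>(1) \<sigma>1(1)]) (use \<sigma>1(2) t in fastforce)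
    show "continuous_on {m..M} b" unfolding b_def
      by (rule continuous_on_compose2[OF \<kappa>(1) \<sigma>3(1)]) (use \<sigma>3(2) t in fastforce)
    show "norm (a y) = 1 \<and> F (a y) = y" if "y \<in> {m..M}" for y
      using \<sigma>1(2)[OF that] sph[of "\<sigma>1 y"] t by (auto simp: a_def g_def)
    show "norm (b y) = 1 \<and> F (b y) = y" if "y \<in> {m..M}" for y
      using \<sigma>3(2)[OF that] sph[of "\<sigma>3 y"] t by (auto simp: b_def g_def)
    show "p \<in> a ` {m..M} \<or> p \<in> b ` {m..M} \<or> F p = m \<or> F p = M" if "norm p = 1" for p
    proof -
      have "p \<in> \<kappa> ` {t1..t5}" unfolding \<kappa>(2) using that by simp
      then obtain s where s: "s \<in> {t1..t5}" "p = \<kappa> s" by blast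
      consider "s \<in> {t1..t2}" | "s \<in> {t2..t3}" | "s \<in> {t3..t4}" | "s \<in> {t4..t5}" using s by force
      then show ?thesis
      proof cases
        case 1
        then have "p = a (g s)" "g s \<in> {m..M}" unfolding a_def using \<sigma>1(3) s i1 by auto
        then show ?thesis by blast
      next
        case 2 then show ?thesis using gM s by (auto simp: g_def)
      next
        case 3
        then have "p = b (g s)" "g s \<in> {m..M}" unfolding b_def using \<sigma>3(3) s i3 by auto
        then show ?thesis by blast
      next
        case 4 then show ?thesis using gm s by (auto simp: g_def)
      qed
    qed
    show "a y \<noteq> b y" if "m < y" "y < M" for y
    proof
      assume "a y = b y"
      have 1: "\<sigma>1 y \<in> {t1..t2}" "g (\<sigma>1 y) = y" "\<sigma>3 y \<in> {t3..t4}" "g (\<sigma>3 y) = y" using \<sigma>1(2) \<sigma>3(2) that by auto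
      then have "\<sigma>1 y \<noteq> t2" "\<sigma>3 y \<noteq> t4" using gt that by auto
      then have "\<sigma>1 y = \<sigma>3 y" using inj_onD[OF \<kappa>(3), of "\<sigma>1 y" "\<sigma>3 y"] 1 \<open>a y = b y\<close> t by (auto simp: a_def b_def)
      then show False using 1 t \<open>\<sigma>1 y \<noteq> t2\<close> by auto
    qed
    show "regular_point (ball 0 1) F p" if "norm p < 1" for p by (rule regular[OF that])
    show "cut_chain {p \<in> sphere 0 1. F p = y} (a y) (b y)" if "y \<in> {m, M}" for y
    proof -
      have "cut_chain (\<kappa> ` {t2..t3}) (\<kappa> t2) (\<kappa> t3)"
        using t by (intro cut_chain_arc inj2 continuous_on_subset[OF \<kappa>(1)]) auto
      moreover have "cut_chain (\<kappa> ` {t4..t5}) (\<kappa> t4) (\<kappa> t5)"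
        using t by (intro cut_chain_arc inj4 continuous_on_subset[OF \<kappa>(1)]) auto
      ultimately show ?thesis using that ends lM lm cut_chain_sym \<kappa>(4) by auto
    qed
    show "\<exists>s\<in>V. F s = y \<and> (\<exists>S. transversal F s S)"
      if y: "y \<in> {m, M}" and p: "norm p = 1" "F p = y" "p \<notin> {a y, b y}" and V: "open V" "p \<in> V" for y p V
    proof -
      have "p \<in> \<kappa> ` {t2..t3} \<or> p \<in> \<kappa> ` {t4..t5}" unfolding lM[symmetric] lm[symmetric] using p y by auto
      then have "\<exists>s. p = \<kappa> s \<and> (s \<in> {t2..t3} \<and> y = M \<or> s \<in> {t4..t5} \<and> y = m)"
        using p(2) gM gm unfolding g_def by fastforce
      then obtain s where s: "p = \<kappa> s" "s \<in> {t2..t3} \<and> y = M \<or> s \<in> {t4..t5} \<and> y = m" by blast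
      then have "s \<noteq> t2 \<or> y \<noteq> M" "s \<noteq> t3 \<or> y \<noteq> M" "s \<noteq> t4 \<or> y \<noteq> m" "s \<noteq> t5 \<or> y \<noteq> m"
        using p(3) ends \<kappa>(4) by auto
      then have "s \<in> {t2<..<t3} \<union> {t4<..<t5}" using s(2) mM by auto
      then show ?thesis using sec[of s V] V s p(2) by auto
    qed
  qed
  then show ?thesis unfolding m_def M_def by blast
qed

text \<open>A continuous locally injective function is locally strictly monotone and has no interior
  extremum. If \<open>g u = g v\<close>, maximum and minimum between \<open>u\<close> and
  \<open>v\<close> would both be attained at the ends, so \<open>g\<close> would be constant there
  and the midpoint an extremum. Regular boundary points supply this local information along an
  arc.\<close>

lemma locally_injective_imp_inj:
  fixes g :: "real \<Rightarrow> real"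
  assumes g: "continuous_on {p..q} g"
    and loc: "\<And>s. s \<in> {p<..<q} \<Longrightarrow> \<exists>\<delta>>0. inj_on g ({s-\<delta><..<s+\<delta>} \<inter> {p<..<q})"
  shows "inj_on g {p..q}"
proof (rule linorder_inj_onI)
  fix u v assume uv: "u < v" "u \<in> {p..q}" "v \<in> {p..q}"
  show "g u \<noteq> g v"
  proof
    assume eq: "g u = g v"
    have no_ext: False if x: "x \<in> {u<..<v}" and ext: "(\<forall>s\<in>{u..v}. g s \<le> g x) \<or> (\<forall>s\<in>{u..v}. g x \<le> g s)" for x
    proof -
      obtain \<delta> where \<delta>: "\<delta> > 0" "inj_on g ({x-\<delta><..<x+\<delta>} \<inter> {p<..<q})" using loc[of x] x uv by auto
      define e where "e = min (\<delta>/2) (min ((x - u)/2) ((v - x)/2))"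
      have "0 < \<delta>/2" "0 < (x - u)/2" "0 < (v - x)/2" using \<delta> x by auto
      then have e: "0 < e" unfolding e_def by (simp only: min_less_iff_conj)
      have "e \<le> \<delta>/2" "e \<le> (x - u)/2" "e \<le> (v - x)/2" unfolding e_def by linarith+
      then have e': "e < \<delta>" "u < x - e" "x + e < v" using \<delta>(1) x by auto
      have sub: "{x-e..x+e} \<subseteq> {x-\<delta><..<x+\<delta>} \<inter> {p<..<q}" using e' uv by auto
      have "continuous_on {x-e..x+e} g" using e' uv by (intro continuous_on_subset[OF g]) auto
      then have "strict_mono_on {x-e..x+e} g \<or> strict_antimono_on {x-e..x+e} g"
        using injective_eq_monotone_map[of "{x-e..x+e}" g] inj_on_subset[OF \<delta>(2) sub] by (simp add: is_interval_cc)
      then have "g (x - e) < g x \<and> g x < g (x + e) \<or> g (x + e) < g x \<and> g x < g (x - e)"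
        using e unfolding monotone_on_def by auto
      moreover have "x - e \<in> {u..v}" "x + e \<in> {u..v}" using e e' by auto
      ultimately show False using ext by fastforce
    qed
    have c: "continuous_on {u..v} g" using uv by (intro continuous_on_subset[OF g]) auto
    obtain x where x: "x \<in> {u..v}" "\<And>s. s \<in> {u..v} \<Longrightarrow> g s \<le> g x"
      using continuous_attains_sup[OF _ _ c] uv by auto
    obtain y where y: "y \<in> {u..v}" "\<And>s. s \<in> {u..v} \<Longrightarrow> g y \<le> g s"
      using continuous_attains_inf[OF _ _ c] uv by auto
    have "x = u \<or> x = v" using no_ext[of x] x by fastforce
    then have "g x = g u" using eq by auto
    define z where "z = (u + v) / 2"
    have "z \<in> {u<..<v}" "\<forall>s\<in>{u..v}. g s \<le> g u" using uv x(2) \<open>g x = g u\<close> by (auto simp: z_def)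
    moreover have "y = u \<or> y = v" using no_ext[of y] y by fastforce
    then have "\<forall>s\<in>{u..v}. g u \<le> g s" using eq y(2) by auto
    ultimately show False using no_ext[of z] by force
  qed
qed auto

section \<open>Arcs of the frontier, transport to the disc, and the model domains\<close>

lemma cis_eq_iff: "cis x = cis y \<longleftrightarrow> (\<exists>n::int. x = y + 2 * pi * n)"
  using sin_cos_eq_iff[of x y] by (auto simp: complex_eq_iff)

lemma inj_on_cis: "inj_on cis {t..<t + 2 * pi}"
proof (rule inj_onI)
  fix x y assume xy: "x \<in> {t..<t + 2 * pi}" "y \<in> {t..<t + 2 * pi}" "cis x = cis y"
  then obtain n :: int where n: "x = y + 2 * pi * n" unfolding cis_eq_iff by blast
  then have "\<bar>2 * pi * real_of_int n\<bar> < 2 * pi * 1" using xy by auto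
  then have "\<bar>real_of_int n\<bar> < 1" by (simp add: abs_mult)
  then have "n = 0" by linarith
  then show "x = y" using n by simp
qed

lemma cis_image: "cis ` {t..t + 2 * pi} = sphere 0 1"
proof
  show "sphere 0 1 \<subseteq> cis ` {t..t + 2 * pi}"
  proof
    fix z :: complex assume "z \<in> sphere 0 1"
    then have z: "norm z = 1" by simp
    then have "z \<noteq> 0" by auto
    then have A: "cis (Arg z) = z" using z by (simp add: cis_Arg sgn_div_norm)
    define n where "n = \<lfloor>(Arg z - t) / (2 * pi)\<rfloor>"
    have "real_of_int n \<le> (Arg z - t) / (2 * pi)" "(Arg z - t) / (2 * pi) < real_of_int n + 1"
      unfolding n_def by linarith+
    then have "2 * pi * n \<le> Arg z - t" "Arg z - t < 2 * pi * n + 2 * pi"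
      by (auto simp: field_simps)
    moreover have "cis (Arg z) = cis (Arg z - 2 * pi * n)"
      unfolding cis_eq_iff by (intro exI[of _ n]) simp
    ultimately show "z \<in> cis ` {t..t + 2 * pi}" using A by (intro image_eqI[of _ _ "Arg z - 2 * pi * n"]) auto
  qed
qed auto

text \<open>The angles of the end points are determined only modulo \<open>2 * pi\<close>. Both
  angular lengths are nonnegative and less than \<open>2 * pi\<close>, so the shifts at the two ends
  agree.\<close>

lemma positive_arc_eq:
  assumes c: "inj_on c (sphere 0 1)" and pq: "p \<le> q" "q < p + 2 * pi"
  shows "positive_arc c (c (cis p)) (c (cis q)) = (\<lambda>s. c (cis s)) ` {p..q}"
proof
  show "(\<lambda>s. c (cis s)) ` {p..q} \<subseteq> positive_arc c (c (cis p)) (c (cis q))"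
    unfolding positive_arc_def using pq(2) by force
  show "positive_arc c (c (cis p)) (c (cis q)) \<subseteq> (\<lambda>s. c (cis s)) ` {p..q}"
  proof
    fix x assume "x \<in> positive_arc c (c (cis p)) (c (cis q))"
    then obtain s a b where s: "x = c (cis s)" "c (cis p) = c (cis a)" "c (cis q) = c (cis b)"
      "a \<le> s" "s \<le> b" "b < a + 2 * pi" unfolding positive_arc_def by blast
    have "cis p = cis a" "cis q = cis b" using inj_onD[OF c] s by auto
    then obtain n n' :: int where n: "p = a + 2 * pi * n" "q = b + 2 * pi * n'" unfolding cis_eq_iff by blast
    have "2 * pi * (n' - n) = (q - p) - (b - a)" using n by (simp add: algebra_simps)
    then have "\<bar>2 * pi * real_of_int (n' - n)\<bar> < 2 * pi * 1" using pq s by auto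
    then have "\<bar>real_of_int (n' - n)\<bar> < 1" by (simp add: abs_mult)
    then have "n' = n" by linarith
    moreover have "cis s = cis (s + 2 * pi * n)" unfolding cis_eq_iff by (intro exI[of _ "- n"]) simp
    ultimately show "x \<in> (\<lambda>s. c (cis s)) ` {p..q}" using n s by (intro image_eqI[of _ _ "s + 2 * pi * n"]) auto
  qed
qed

lemma open_positive_arc_eq:
  assumes c: "inj_on c (sphere 0 1)" and pq: "p \<le> q" "q < p + 2 * pi"
  shows "positive_arc c (c (cis p)) (c (cis q)) - {c (cis p), c (cis q)} = (\<lambda>s. c (cis s)) ` {p<..<q}"
proof -
  have "inj_on (\<lambda>s. c (cis s)) {p..q}"
  proof (rule inj_onI)
    fix x y assume "x \<in> {p..q}" "y \<in> {p..q}" "c (cis x) = c (cis y)"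
    then show "x = y" using inj_onD[OF c, of "cis x" "cis y"] inj_onD[OF inj_on_cis, of x y p] pq by auto
  qed
  then have "(\<lambda>s. c (cis s)) ` ({p..q} - {p, q}) = (\<lambda>s. c (cis s)) ` {p..q} - (\<lambda>s. c (cis s)) ` {p, q}"
    by (rule inj_on_image_set_diff) (use pq in auto)
  moreover have "{p..q} - {p, q} = {p<..<q}" by auto
  ultimately show ?thesis unfolding positive_arc_eq[OF assms] by simp
qed

text \<open>The boundary chart straightens the frontier near \<open>z\<close> to a real interval, on
  which \<open>f\<close> is strictly monotone.\<close>

lemma regular_boundary_point_locally_inj:
  assumes "regular_boundary_point W f z"
  obtains U where "openin (top_of_set (closure W)) U" "z \<in> U" "inj_on f (U \<inter> frontier W)"
proof -
  obtain U \<psi> \<psi>' where U: "openin (top_of_set (closure W)) U" "z \<in> U"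
      "homeomorphism U {z. cmod z < 1 \<and> Im z \<ge> 0} \<psi> \<psi>'"
      "\<psi> ` (U \<inter> frontier W) = {z. -1 < Re z \<and> Re z < 1 \<and> Im z = 0}"
      "strictly_monotone_on {-1<..<1} (\<lambda>x. f (\<psi>' (complex_of_real x)))"
    using assms unfolding regular_boundary_point_def by blast
  have inj: "inj_on (\<lambda>x. f (\<psi>' (complex_of_real x))) {-1<..<1}"
    using U(5) unfolding strictly_monotone_on_def
  proof
    assume "strict_mono_on {-1<..<1} (\<lambda>x. f (\<psi>' (complex_of_real x)))"
    then show ?thesis by (rule strict_mono_on_imp_inj_on)
  next
    assume "strict_antimono_on {-1<..<1} (\<lambda>x. f (\<psi>' (complex_of_real x)))"
    then have "strict_mono_on {-1<..<1} (\<lambda>x. - f (\<psi>' (complex_of_real x)))"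
      by (auto simp: monotone_on_def)
    then have "inj_on (\<lambda>x. - f (\<psi>' (complex_of_real x))) {-1<..<1}" by (rule strict_mono_on_imp_inj_on)
    then show ?thesis by (simp add: inj_on_def)
  qed
  show thesis
  proof (rule that[OF U(1,2)], rule inj_onI)
    fix x y assume xy: "x \<in> U \<inter> frontier W" "y \<in> U \<inter> frontier W" "f x = f y"
    have *: "\<psi>' (complex_of_real (Re (\<psi> w))) = w \<and> Re (\<psi> w) \<in> {-1<..<1}" if "w \<in> U \<inter> frontier W" for w
    proof -
      have "\<psi> w \<in> {z. -1 < Re z \<and> Re z < 1 \<and> Im z = 0}" unfolding U(4)[symmetric] using that by blast
      moreover then have "complex_of_real (Re (\<psi> w)) = \<psi> w" by (simp add: complex_eq_iff)
      ultimately show ?thesis using homeomorphism_apply1[OF U(3), of w] that by auto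
    qed
    then have "Re (\<psi> x) = Re (\<psi> y)" using inj_onD[OF inj, of "Re (\<psi> x)" "Re (\<psi> y)"] xy by auto
    then show "x = y" using *[OF xy(1)] *[OF xy(2)] by metis
  qed
qed

text \<open>Invariance of domain for \<open>h\<close> on the open disc gives one inclusion between
  the interiors, and for \<open>k\<close> on the interior of \<open>D\<close> the other; the
  frontier is what remains of the compact set \<open>D\<close>.\<close>

lemma disc_homeomorphism_interior:
  fixes h k :: "complex \<Rightarrow> complex"
  assumes h: "homeomorphism (cball 0 1) D h k"
  shows "h ` ball 0 1 = interior D" "h ` sphere 0 1 = frontier D" "closure (interior D) = D"
proof -
  have hc: "continuous_on (cball 0 1) h" "continuous_on D k" "h ` cball 0 1 = D" "k ` D = cball 0 1"
    and hi: "inj_on h (cball 0 1)" "inj_on k D"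
    using h unfolding homeomorphism_def by (auto intro: inj_on_inverseI)
  have cD: "compact D" using hc by (metis compact_cball compact_continuous_image)
  have "open (h ` ball 0 1)"
    using hc hi by (intro invariance_of_domain) (auto intro: continuous_on_subset inj_on_subset)
  then have 1: "h ` ball 0 1 \<subseteq> interior D" using hc(3) by (metis interior_maximal image_mono ball_subset_cball)
  have "open (k ` interior D)"
    by (intro invariance_of_domain continuous_on_subset[OF hc(2)] inj_on_subset[OF hi(2)] interior_subset) simp
  then have "k ` interior D \<subseteq> interior (cball 0 1)"
    using hc(4) interior_subset by (metis interior_maximal image_mono)
  then have kb: "k ` interior D \<subseteq> ball 0 1" by simp
  have 2: "interior D \<subseteq> h ` ball 0 1"
  proof
    fix x assume "x \<in> interior D"
    then have "k x \<in> ball 0 1" "h (k x) = x" using kb homeomorphism_apply2[OF h] interior_subset by blast+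
    then show "x \<in> h ` ball 0 1" by (metis imageI)
  qed
  show i: "h ` ball 0 1 = interior D" using 1 2 by blast
  have "sphere (0::complex) 1 = cball 0 1 - ball 0 1" by auto
  then have "h ` sphere 0 1 = h ` cball 0 1 - h ` ball 0 1"
    using inj_on_image_set_diff[OF hi(1), of "cball 0 1" "ball 0 1"] ball_subset_cball
    by (metis Diff_subset)
  then show "h ` sphere 0 1 = frontier D"
    unfolding frontier_def i hc(3) using cD by (simp add: compact_imp_closed)
  have "h ` closure (ball 0 1) \<subseteq> closure (h ` ball 0 1)"
    by (rule continuous_image_closure_subset[OF hc(1)]) simp
  then have "D \<subseteq> closure (interior D)" unfolding i using hc(3) by simp
  moreover have "closure (interior D) \<subseteq> D"
    using cD by (simp add: closure_minimal compact_imp_closed interior_subset)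
  ultimately show "closure (interior D) = D" by blast
qed

text \<open>By invariance of domain \<open>k\<close> takes the chart neighbourhood to an open set,
  so composition with \<open>h\<close> transports the chart.\<close>

lemma regular_point_homeomorphism:
  fixes h k :: "complex \<Rightarrow> complex"
  assumes h: "homeomorphism (cball 0 1) D h k" and p: "norm p < 1"
    and reg: "regular_point (interior D) f (h p)"
  shows "regular_point (ball 0 1) (\<lambda>x. f (h x)) p"
proof -
  obtain U r \<phi> \<phi>' where *: "open U" "h p \<in> U" "U \<subseteq> interior D" "r > 0"
      "homeomorphism U (ball 0 r) \<phi> \<phi>'" "\<phi> (h p) = 0" "\<And>z. z \<in> ball 0 r \<Longrightarrow> f (\<phi>' z) = Re z + f (h p)"
    using reg unfolding regular_point_def by blast
  have UD: "U \<subseteq> D" using * interior_subset by blast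
  have kc: "continuous_on D k" "inj_on k D" using h unfolding homeomorphism_def by (auto intro: inj_on_inverseI)
  have "open (k ` U)"
    using kc UD * by (intro invariance_of_domain) (auto intro: continuous_on_subset inj_on_subset)
  have kp: "k (h p) = p" using homeomorphism_apply1[OF h, of p] p by simp
  have ball: "k ` U \<subseteq> ball 0 1"
  proof
    fix x assume "x \<in> k ` U"
    then obtain u where u: "x = k u" "u \<in> U" by blast
    then have "u \<in> h ` ball 0 1" using disc_homeomorphism_interior(1)[OF h] * by blast
    then show "x \<in> ball 0 1" using homeomorphism_apply1[OF h] u by auto
  qed
  have im: "h ` k ` U = U" using homeomorphism_apply2[OF h] UD by (force simp: image_image)
  have "homeomorphism (k ` U) U h k"
    using ball by (intro homeomorphism_of_subsets[OF h _ UD im]) force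
  then have hom: "homeomorphism (k ` U) (ball 0 r) (\<phi> \<circ> h) (k \<circ> \<phi>')" using *(5) homeomorphism_compose by blast
  have "f (h ((k \<circ> \<phi>') z)) = Re z + f (h p)" if "z \<in> ball 0 r" for z
  proof -
    have "\<phi>' z \<in> D" using UD *(5) that unfolding homeomorphism_def by blast
    then show ?thesis using homeomorphism_apply2[OF h] *(7)[OF that] by simp
  qed
  then show ?thesis unfolding regular_point_def
    using p \<open>open (k ` U)\<close> kp *(2,4,6) ball hom
    by (intro conjI exI[of _ "k ` U"] exI[of _ r] exI[of _ "\<phi> \<circ> h"] exI[of _ "k \<circ> \<phi>'"]) (auto intro: rev_image_eqI)
qed

text \<open>An interior point can be moved a little in the four axis directions without leaving
  \<open>E\<close>, which makes all four inequalities strict.\<close>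

lemma frontier_between_graphs:
  fixes l r :: "real \<Rightarrow> real"
  assumes l: "continuous_on UNIV l" and r: "continuous_on UNIV r"
    and E: "E = {z. y0 \<le> Im z \<and> Im z \<le> y1 \<and> l (Im z) \<le> Re z \<and> Re z \<le> r (Im z)}"
  shows "frontier E = {z \<in> E. Im z \<in> {y0, y1} \<or> Re z \<in> {l (Im z), r (Im z)}}"
proof -
  have lr: "continuous_on UNIV (\<lambda>z. l (Im z))" "continuous_on UNIV (\<lambda>z. r (Im z))"
    by (auto intro!: continuous_on_compose2[OF l] continuous_on_compose2[OF r] continuous_intros)
  have "closed E" unfolding E
    by (intro closed_Collect_conj closed_Collect_le continuous_intros lr)
  define I where "I = {z. y0 < Im z \<and> Im z < y1 \<and> l (Im z) < Re z \<and> Re z < r (Im z)}"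
  have "open I" unfolding I_def
    by (intro open_Collect_conj open_Collect_less continuous_intros lr)
  then have "I \<subseteq> interior E" by (intro interior_maximal) (auto simp: I_def E)
  moreover have "interior E \<subseteq> I"
  proof
    fix z assume "z \<in> interior E"
    then obtain e where e: "e > 0" "ball z e \<subseteq> E" using mem_interior by blast
    have "z + d \<in> E" if "norm d < e" for d using e(2) that by (auto simp: dist_norm subset_eq)
    then have d: "z + of_real (e/2) \<in> E" "z - of_real (e/2) \<in> E" "z + \<i> * of_real (e/2) \<in> E" "z - \<i> * of_real (e/2) \<in> E"
      using e(1) by (simp_all add: norm_mult norm_divide diff_conv_add_uminus del: add_uminus_conv_diff)
    then show "z \<in> I" using e(1) unfolding I_def E by auto
  qed
  ultimately have "interior E = I" by blast
  then have "frontier E = E - I" unfolding frontier_def using \<open>closed E\<close> by simp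
  moreover have "z \<in> I \<longleftrightarrow> Im z \<notin> {y0, y1} \<and> Re z \<notin> {l (Im z), r (Im z)}" if "z \<in> E" for z
    using that by (simp add: I_def E order_less_le) metis
  ultimately show ?thesis by blast
qed

text \<open>The square lies between constants over heights 0 to 1, the disc and the half disc
  between the two halves of the circle over heights -1 to 1 and 0 to 1. With this common description
  the straightening treats the three cases at once.\<close>

lemma model_domain_between_graphs:
  obtains y0 y1 and l r :: "real \<Rightarrow> real" where "y0 < y1" "continuous_on UNIV l" "continuous_on UNIV r"
    "\<And>y. y0 < y \<Longrightarrow> y < y1 \<Longrightarrow> l y < r y" "l y0 \<le> r y0" "l y1 \<le> r y1"
    "model_domain A B = {z. y0 \<le> Im z \<and> Im z \<le> y1 \<and> l (Im z) \<le> Re z \<and> Re z \<le> r (Im z)}"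
proof -
  define s where "s y = sqrt (1 - y\<^sup>2)" for y :: real
  have s: "continuous_on UNIV s" "continuous_on UNIV (\<lambda>y. - s y)" unfolding s_def by (auto intro!: continuous_intros)
  have pos: "0 < s y" if "-1 < y" "y < 1" for y
    using that abs_square_less_1[of y] unfolding s_def by (auto simp: abs_less_iff)
  have nonneg: "0 \<le> s y" if "-1 \<le> y" "y \<le> 1" for y
    using that abs_square_le_1[of y] unfolding s_def by (auto simp: abs_le_iff)
  have disc: "norm z \<le> 1 \<longleftrightarrow> -1 \<le> Im z \<and> Im z \<le> 1 \<and> - s (Im z) \<le> Re z \<and> Re z \<le> s (Im z)" for z
  proof -
    have "norm z \<le> 1 \<longleftrightarrow> (Re z)\<^sup>2 \<le> 1 - (Im z)\<^sup>2"
      unfolding cmod_def by (auto simp: algebra_simps)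
    \<comment> \<open>The square root is extended as an odd increasing function, so for
      \<open>\<bar>Im z\<bar> > 1\<close> its value is negative and both sides are false.\<close>
    also have "\<dots> \<longleftrightarrow> \<bar>Re z\<bar> \<le> s (Im z)"
      unfolding s_def by (metis real_sqrt_abs real_sqrt_le_iff)
    finally have "norm z \<le> 1 \<longleftrightarrow> \<bar>Re z\<bar> \<le> s (Im z)" .
    then show ?thesis using abs_Im_le_cmod[of z] by auto
  qed
  consider "A \<noteq> {}" "B \<noteq> {}" | "A \<union> B = {}" | "\<not> (A \<noteq> {} \<and> B \<noteq> {})" "A \<union> B \<noteq> {}" by blast
  then show thesis
  proof cases
    case 1
    then show ?thesis by (intro that[of 0 1 "\<lambda>_. 0" "\<lambda>_. 1"]) (auto simp: model_domain_def)
  next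
    case 2
    show ?thesis
      by (rule that[OF _ s(2,1), of "-1" 1]) (use 2 pos nonneg disc in \<open>force simp: model_domain_def\<close>)+
  next
    case 3
    then have "model_domain A B = {z. norm z \<le> 1 \<and> 0 \<le> Im z}" unfolding model_domain_def by auto
    also have "\<dots> = {z. 0 \<le> Im z \<and> Im z \<le> 1 \<and> - s (Im z) \<le> Re z \<and> Re z \<le> s (Im z)}"
      unfolding disc by auto
    finally show ?thesis
      by (intro that[OF _ s(2,1), of 0 1]) (use pos nonneg in force)+
  qed
qed

lemma extremal_set_eq:
  assumes "\<And>x. x \<in> S \<Longrightarrow> m \<le> g x \<and> g x \<le> M" "p \<in> S" "g p = m" "q \<in> S" "g q = M"
  shows "extremal_set S g = {x \<in> S. g x \<in> {m, M}}"
proof -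
  have "(INF u\<in>S. g u) = m" using assms by (intro cInf_eq_minimum) auto
  moreover have "(SUP u\<in>S. g u) = M" using assms by (intro cSup_eq_maximum) auto
  ultimately show ?thesis unfolding extremal_set_def by simp
qed

text \<open>One set of angles serves all four points; the fourth arc ends at
  \<open>t1 + 2 * pi\<close>, the angle of \<open>z 1\<close> after a full turn.
  \<open>positive_arc_eq\<close> needs arcs shorter than a full turn, which follows from
  nonemptiness of the two odd arcs.\<close>

lemma weakly_regular_arcs:
  assumes c: "inj_on c (sphere 0 1)" and wr: "weakly_regular_with c D f 2 z"
  defines "\<gamma> \<equiv> \<lambda>s. c (cis s)"
  obtains t1 t2 t3 t4 where "t1 < t2" "t2 \<le> t3" "t3 < t4" "t4 \<le> t1 + 2 * pi"
    "open_bd_arc c z 1 = \<gamma> ` {t1<..<t2}" "open_bd_arc c z 2 = \<gamma> ` {t2<..<t3}"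
    "open_bd_arc c z 3 = \<gamma> ` {t3<..<t4}" "open_bd_arc c z 4 = \<gamma> ` {t4<..<t1 + 2 * pi}"
    "bd_arc c z 2 = \<gamma> ` {t2..t3}" "bd_arc c z 4 = \<gamma> ` {t4..t1 + 2 * pi}"
proof -
  have wr': "consecutive_points c (2 * 2) z" "z (2 * 2 + 1) = z 1"
    "\<And>k. k \<in> {1..2} \<Longrightarrow> open_bd_arc c z (2 * k - 1) \<noteq> {}"
    using wr unfolding weakly_regular_with_def by blast+
  have cp: "consecutive_points c 4 z" and z5: "z 5 = z 1"
    and ne: "open_bd_arc c z 1 \<noteq> {}" "open_bd_arc c z 3 \<noteq> {}"
    using wr'(1,2) wr'(3)[of 1] wr'(3)[of 2] by simp_all
  obtain t where t: "\<And>k. k \<in> {1..4} \<Longrightarrow> z k = c (cis (t k))" "mono_on {1..4} t" "t 4 \<le> t 1 + 2 * pi"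
    using cp unfolding consecutive_points_def by auto
  have z: "z 1 = \<gamma> (t 1)" "z 2 = \<gamma> (t 2)" "z 3 = \<gamma> (t 3)" "z 4 = \<gamma> (t 4)" "z 5 = \<gamma> (t 1 + 2 * pi)"
    using t(1) z5 by (auto simp: \<gamma>_def cis_mult[symmetric])
  have le: "t 1 \<le> t 2" "t 2 \<le> t 3" "t 3 \<le> t 4" using monotone_onD[OF t(2)] by auto
  \<comment> \<open>With equal end points the definition of \<open>positive_arc\<close> yields a
    single point, and removing the ends leaves nothing.\<close>
  have nd: False if k: "open_bd_arc c z k \<noteq> {}" "z k = z (k + 1)" for k
  proof -
    obtain s where s: "z k = c (cis s)"
      using k(1) unfolding open_bd_arc_def bd_arc_def positive_arc_def by blast
    have "bd_arc c z k = {z k}"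
      unfolding bd_arc_def k(2)[symmetric] s using positive_arc_eq[OF c, of s s] by simp
    then show False using k(1) unfolding open_bd_arc_def by auto
  qed
  have strict: "t 1 < t 2" "t 3 < t 4"
    using nd[of 1] nd[of 3] ne z le by (force simp: order_less_le numeral_eq_Suc)+
  have less: "t 2 < t 1 + 2 * pi" "t 4 < t 3 + 2 * pi"
  proof -
    have "\<gamma> (t 1 + 2 * pi) = \<gamma> (t 1)" by (simp add: \<gamma>_def cis_mult[symmetric])
    then have "t 2 \<noteq> t 1 + 2 * pi" using nd[of 1] ne z by (auto simp: numeral_eq_Suc)
    then show "t 2 < t 1 + 2 * pi" using le t(3) by auto
    show "t 4 < t 3 + 2 * pi" using strict le t(3) by auto
  qed
  have arc: "bd_arc c z k = \<gamma> ` {p..q}" "open_bd_arc c z k = \<gamma> ` {p<..<q}"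
    if "z k = \<gamma> p" "z (k + 1) = \<gamma> q" "p \<le> q" "q < p + 2 * pi" for k p q
    using positive_arc_eq[OF c that(3,4)] open_positive_arc_eq[OF c that(3,4)] that(1,2)
    unfolding bd_arc_def open_bd_arc_def \<gamma>_def by simp_all
  show thesis
  proof (rule that[of "t 1" "t 2" "t 3" "t 4"])
    show "open_bd_arc c z 1 = \<gamma> ` {t 1<..<t 2}" using arc(2)[of 1 "t 1" "t 2"] z le less by (simp add: numeral_eq_Suc)
    show "open_bd_arc c z 3 = \<gamma> ` {t 3<..<t 4}" using arc(2)[of 3 "t 3" "t 4"] z le less by (simp add: numeral_eq_Suc)
    show "open_bd_arc c z 2 = \<gamma> ` {t 2<..<t 3}" "bd_arc c z 2 = \<gamma> ` {t 2..t 3}"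
      using arc[of 2 "t 2" "t 3"] z le less strict t(3) by (simp_all add: numeral_eq_Suc)
    show "open_bd_arc c z 4 = \<gamma> ` {t 4<..<t 1 + 2 * pi}" "bd_arc c z 4 = \<gamma> ` {t 4..t 1 + 2 * pi}"
      using arc[of 4 "t 4" "t 1 + 2 * pi"] z le less strict t(3) by (simp_all add: numeral_eq_Suc)
  qed (use strict le t(3) in auto)
qed

section \<open>From regular functions to disc flows\<close>

text \<open>Everything is pulled back to the disc by \<open>h\<close>, and the circle is
  parametrised by the angle, starting at the first of the four points. If \<open>f\<close> falls
  along the first arc, the flow is built for \<open>-f\<close> and then flipped.\<close>

lemma regular_disc_flow:
  fixes D :: "complex set" and h k c c' :: "complex \<Rightarrow> complex"
  assumes h: "homeomorphism (cball 0 1) D h k"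
    and c: "homeomorphism (sphere 0 1) (frontier D) c c'"
    and reg: "regular_with c D f z"
  shows "\<exists>m M a b. disc_flow (\<lambda>x. f (h x)) m M a b"
proof -
  define F where "F x = f (h x)" for x
  define \<gamma> where "\<gamma> s = c (cis s)" for s
  define \<kappa> where "\<kappa> s = k (\<gamma> s)" for s
  have wr: "weakly_regular_with c D f 2 z" using reg unfolding regular_with_def by blast
  have ci: "inj_on c (sphere 0 1)" using c unfolding homeomorphism_def by (auto intro: inj_on_inverseI)
  obtain t1 t2 t3 t4 where t: "t1 < t2" "t2 \<le> t3" "t3 < t4" "t4 \<le> t1 + 2 * pi"
    and arcs: "open_bd_arc c z 1 = \<gamma> ` {t1<..<t2}" "open_bd_arc c z 2 = \<gamma> ` {t2<..<t3}"
    "open_bd_arc c z 3 = \<gamma> ` {t3<..<t4}" "open_bd_arc c z 4 = \<gamma> ` {t4<..<t1 + 2 * pi}"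
    "bd_arc c z 2 = \<gamma> ` {t2..t3}" "bd_arc c z 4 = \<gamma> ` {t4..t1 + 2 * pi}"
    unfolding \<gamma>_def by (rule weakly_regular_arcs[OF ci wr])
  have contf: "continuous_on D f" and regint: "\<And>w. w \<in> interior D \<Longrightarrow> regular_point (interior D) f w"
    and bd: "\<And>k w. k \<in> {1..2} \<Longrightarrow> w \<in> open_bd_arc c z (2 * k - 1) \<Longrightarrow> regular_boundary_point (interior D) f w"
    and comps: "\<And>k. k \<in> {1..2} \<Longrightarrow> \<exists>y. bd_arc c z (2 * k) \<in> components {w \<in> D. f w = y}"
    using wr unfolding weakly_regular_with_def by blast+
  have regbd: "regular_boundary_point (interior D) f w" if "w \<in> open_bd_arc c z 1 \<union> open_bd_arc c z 3" for w
    using bd[of 1 w] bd[of 2 w] that by auto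
  have comp: "\<exists>y. bd_arc c z 2 \<in> components {w \<in> D. f w = y}" "\<exists>y. bd_arc c z 4 \<in> components {w \<in> D. f w = y}"
    using comps[of 1] comps[of 2] by simp_all
  have hD: "h ` cball 0 1 = D" "k ` D = cball 0 1" and hc: "continuous_on (cball 0 1) h" "continuous_on D k"
    using h unfolding homeomorphism_def by auto
  have ki: "inj_on k D" by (rule inj_on_inverseI[of _ h]) (rule homeomorphism_apply2[OF h])
  note disc = disc_homeomorphism_interior[OF h]
  have frD: "frontier D \<subseteq> D" unfolding disc(2)[symmetric] using hD(1) sphere_cball by blast
  have \<gamma>fr: "\<gamma> s \<in> frontier D" for s using c unfolding \<gamma>_def homeomorphism_def by auto
  have \<gamma>D: "\<gamma> s \<in> D" for s using \<gamma>fr frD by blast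
  have F\<kappa>: "F (\<kappa> s) = f (\<gamma> s)" for s unfolding F_def \<kappa>_def using homeomorphism_apply2[OF h \<gamma>D] by simp
  have c\<gamma>: "continuous_on S \<gamma>" for S unfolding \<gamma>_def
    by (rule continuous_on_compose2[of "sphere 0 1" c]) (use c in \<open>auto simp: homeomorphism_def intro!: continuous_intros\<close>)
  have c\<kappa>: "continuous_on S \<kappa>" for S unfolding \<kappa>_def
    by (rule continuous_on_compose2[OF hc(2) c\<gamma>]) (use \<gamma>D in auto)
  have i\<gamma>: "inj_on \<gamma> {t..<t + 2 * pi}" for t
  proof (rule inj_onI)
    fix x y assume "x \<in> {t..<t + 2 * pi}" "y \<in> {t..<t + 2 * pi}" "\<gamma> x = \<gamma> y"
    then show "x = y" using inj_onD[OF ci, of "cis x" "cis y"] inj_onD[OF inj_on_cis, of x y t] by (auto simp: \<gamma>_def)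
  qed
  have i\<kappa>: "inj_on \<kappa> {t1..<t1 + 2 * pi}"
    unfolding \<kappa>_def using comp_inj_on[OF i\<gamma> inj_on_subset[OF ki], of t1] \<gamma>D by (auto simp: comp_def)
  have \<kappa>im: "\<kappa> ` {t1..t1 + 2 * pi} = sphere 0 1"
  proof -
    have "\<kappa> ` {t1..t1 + 2 * pi} = k ` c ` cis ` {t1..t1 + 2 * pi}" by (simp add: \<kappa>_def \<gamma>_def image_image)
    also have "\<dots> = k ` h ` sphere 0 1" using c disc(2) cis_image unfolding homeomorphism_def by simp
    also have "\<dots> = sphere 0 1" using homeomorphism_apply1[OF h] by (force simp: image_image)
    finally show ?thesis .
  qed
  have \<kappa>per: "\<kappa> (t1 + 2 * pi) = \<kappa> t1" by (simp add: \<kappa>_def \<gamma>_def cis_mult[symmetric])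
  have Fc: "continuous_on (cball 0 1) F" unfolding F_def
    by (rule continuous_on_compose2[OF contf hc(1)]) (use hD in auto)
  have gc: "continuous_on S (\<lambda>s. f (\<gamma> s))" for S
    by (rule continuous_on_compose2[OF contf c\<gamma>]) (use \<gamma>D in auto)
  have inj: "inj_on (\<lambda>s. f (\<gamma> s)) {p..q}"
    if bd: "\<And>s. s \<in> {p<..<q} \<Longrightarrow> regular_boundary_point (interior D) f (\<gamma> s)" and pq: "q \<le> p + 2 * pi" for p q
  proof (rule locally_injective_imp_inj[OF gc])
    fix s assume s: "s \<in> {p<..<q}"
    obtain U where U: "openin (top_of_set (closure (interior D))) U" "\<gamma> s \<in> U" "inj_on f (U \<inter> frontier (interior D))"
      using regular_boundary_point_locally_inj[OF bd[OF s]] by metis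
    have fr: "frontier (interior D) = frontier D"
      using disc(3) closure_closed[of D] unfolding frontier_def by (metis closure_closure interior_interior)
    obtain V where V: "open V" "U = D \<inter> V" using U(1) unfolding disc(3) openin_open by blast
    have "open (\<gamma> -` V)" using c\<gamma>[of UNIV] V(1) by (simp add: continuous_on_open_vimage)
    then obtain \<delta> where \<delta>: "\<delta> > 0" "ball s \<delta> \<subseteq> \<gamma> -` V" using U(2) V(2) by (metis IntD2 openE vimageI)
    have sub: "\<gamma> x \<in> U \<inter> frontier (interior D)" if "x \<in> {s-\<delta><..<s+\<delta>}" for x
    proof -
      have "x \<in> ball s \<delta>" using that by (auto simp: dist_real_def)
      then show ?thesis using \<delta>(2) \<gamma>D \<gamma>fr V(2) fr by auto
    qed
    have "inj_on (\<lambda>s. f (\<gamma> s)) ({s-\<delta><..<s+\<delta>} \<inter> {p<..<q})"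
    proof (rule inj_onI)
      fix x y assume xy: "x \<in> {s-\<delta><..<s+\<delta>} \<inter> {p<..<q}" "y \<in> {s-\<delta><..<s+\<delta>} \<inter> {p<..<q}" "f (\<gamma> x) = f (\<gamma> y)"
      then have "\<gamma> x = \<gamma> y" using inj_onD[OF U(3)] sub by blast
      then show "x = y" using inj_onD[OF i\<gamma>[of p], of x y] xy pq by auto
    qed
    then show "\<exists>\<delta>>0. inj_on (\<lambda>s. f (\<gamma> s)) ({s-\<delta><..<s+\<delta>} \<inter> {p<..<q})" using \<delta>(1) by blast
  qed
  have inj12: "inj_on (\<lambda>s. f (\<gamma> s)) {t1..t2}" using regbd arcs(1) t by (intro inj) auto
  have inj34: "inj_on (\<lambda>s. f (\<gamma> s)) {t3..t4}" using regbd arcs(3) t by (intro inj) auto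
  have const: "f (\<gamma> s) = f (\<gamma> s')" if "s \<in> {t2..t3} \<and> s' \<in> {t2..t3} \<or> s \<in> {t4..t1 + 2 * pi} \<and> s' \<in> {t4..t1 + 2 * pi}" for s s'
  proof -
    obtain y2 where y2: "bd_arc c z 2 \<subseteq> {w \<in> D. f w = y2}" using comp(1) in_components_subset by blast
    obtain y4 where y4: "bd_arc c z 4 \<subseteq> {w \<in> D. f w = y4}" using comp(2) in_components_subset by blast
    have "f (\<gamma> x) = y2" if "x \<in> {t2..t3}" for x using y2 that unfolding arcs by blast
    moreover have "f (\<gamma> x) = y4" if "x \<in> {t4..t1 + 2 * pi}" for x using y4 that unfolding arcs by blast
    ultimately show ?thesis using that by metis
  qed
  have const2: "F (\<kappa> s) = F (\<kappa> t2)" if "s \<in> {t2..t3}" for s using const[of s t2] that t by (simp add: F\<kappa>)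
  have const4: "F (\<kappa> s) = F (\<kappa> t1)" if "s \<in> {t4..t1 + 2 * pi}" for s
    using const[of s "t1 + 2 * pi"] that t \<kappa>per F\<kappa>[of "t1 + 2 * pi"] by (simp add: F\<kappa>)
  have eq: "f (\<gamma> t3) = f (\<gamma> t2)" "f (\<gamma> t4) = f (\<gamma> t1)" using const2[of t3] const4[of t4] t by (simp_all add: F\<kappa>)
  have regF: "regular_point (ball 0 1) F p" if "norm p < 1" for p
    unfolding F_def using disc(1) that by (intro regular_point_homeomorphism[OF h that] regint) auto
  obtain \<Gamma> where \<Gamma>: "\<Gamma> \<subseteq> open_bd_arc c z 2 \<union> open_bd_arc c z 4" "open_bd_arc c z 2 \<union> open_bd_arc c z 4 \<subseteq> closure \<Gamma>"
    "\<And>p. p \<in> \<Gamma> \<Longrightarrow> \<exists>g. U_trajectory D f g \<and> p \<in> path_image g"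
    using reg unfolding regular_with_def by blast
  have levels: "f (\<gamma> t1) \<noteq> f (\<gamma> t2)" using inj_onD[OF inj12, of t1 t2] t by auto
  have sec: "\<exists>x\<in>V. F x = F (\<kappa> s) \<and> (\<exists>S. transversal F x S)"
    if s: "s \<in> {t2<..<t3} \<union> {t4<..<t1 + 2 * pi}" and V: "open V" "\<kappa> s \<in> V" for s V
  proof -
    have val: "f w \<in> {f (\<gamma> t1), f (\<gamma> t2)}" if w: "w \<in> \<Gamma>" for w
    proof -
      obtain x where "w = \<gamma> x" "x \<in> {t2<..<t3} \<or> x \<in> {t4<..<t1 + 2 * pi}"
        using \<Gamma>(1) w unfolding arcs by blast
      then show ?thesis using const2[of x] const4[of x] unfolding F\<kappa> by auto
    qed
    define e where "e = f (\<gamma> s)"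
    \<comment> \<open>The neighbourhood \<open>V\<close> may also reach the other end arc. Removing
      the closed set of points with the other end value leaves only those points of the dense set
      that lie on the level of \<open>\<kappa> s\<close>.\<close>
    have "closed (cball 0 1 \<inter> F -` (- {e} \<inter> {f (\<gamma> t1), f (\<gamma> t2)}))"
      by (rule continuous_closed_preimage[OF Fc closed_cball]) (auto intro: finite_imp_closed)
    then have "open (V - cball 0 1 \<inter> F -` (- {e} \<inter> {f (\<gamma> t1), f (\<gamma> t2)}))" using V(1) by blast
    then obtain W where W: "open W" "k -` (V - cball 0 1 \<inter> F -` (- {e} \<inter> {f (\<gamma> t1), f (\<gamma> t2)})) \<inter> D = W \<inter> D"
      using hc(2) unfolding continuous_on_open_invariant by metis
    have "\<gamma> s \<in> W"
    proof -
      have "\<gamma> s \<in> k -` (V - cball 0 1 \<inter> F -` (- {e} \<inter> {f (\<gamma> t1), f (\<gamma> t2)})) \<inter> D"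
        using V(2) \<gamma>D F\<kappa>[of s] by (auto simp: \<kappa>_def e_def)
      then show ?thesis using W(2) by blast
    qed
    moreover have "\<gamma> s \<in> closure \<Gamma>" using \<Gamma>(2) s unfolding arcs by blast
    ultimately obtain w where w: "w \<in> \<Gamma>" "w \<in> W" using W(1) by (metis closure_iff_nhds_not_empty disjoint_iff order_refl)
    have wD: "w \<in> D" using \<Gamma>(1) w(1) \<gamma>D unfolding arcs by auto
    then have kw: "k w \<in> V" "\<not> (F (k w) \<noteq> e \<and> F (k w) \<in> {f (\<gamma> t1), f (\<gamma> t2)})"
      using W(2) w(2) hD by auto
    have Fw: "F (k w) = f w" unfolding F_def using homeomorphism_apply2[OF h wD] by simp
    then have "F (k w) = e" using kw(2) val[OF w(1)] by auto
    obtain g where g: "U_trajectory D f g" "w \<in> path_image g" using \<Gamma>(3)[OF w(1)] by blast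
    have g': "arc g" "path_image g \<subseteq> D" "strictly_monotone_on {0..1} (f \<circ> g)" using g(1) unfolding U_trajectory_def by auto
    have fi: "inj_on (f \<circ> g) {0..1}"
      using g'(3) unfolding strictly_monotone_on_def
    proof
      assume "strict_antimono_on {0..1} (f \<circ> g)"
      then have "strict_mono_on {0..1} (\<lambda>x. - (f \<circ> g) x)" by (auto simp: monotone_on_def)
      then have "inj_on (\<lambda>x. - (f \<circ> g) x) {0..1}" by (rule strict_mono_on_imp_inj_on)
      then show ?thesis by (simp add: inj_on_def)
    qed (rule strict_mono_on_imp_inj_on)
    have Fg: "F (k (g x)) = f (g x)" if "x \<in> {0..1}" for x
    proof -
      have "g x \<in> D" using g'(2) that unfolding path_image_def by blast
      then show ?thesis unfolding F_def using homeomorphism_apply2[OF h] by simp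
    qed
    have "transversal F (k w) (k ` path_image g)" unfolding transversal_def
    proof (intro conjI)
      have kc: "continuous_on (path_image g) k" using continuous_on_subset[OF hc(2) g'(2)] .
      show "compact (k ` path_image g)"
        using kc compact_path_image arc_imp_path[OF g'(1)] compact_continuous_image by blast
      show "connected (k ` path_image g)"
        using kc connected_path_image arc_imp_path[OF g'(1)] connected_continuous_image by blast
      show "k ` path_image g \<subseteq> cball 0 1" using g'(2) hD by auto
      show "inj_on F (k ` path_image g)"
        using fi Fg by (auto simp: inj_on_def path_image_def)
      show "k w \<in> k ` path_image g" using g(2) by blast
      have "k (g 0) \<noteq> k (g 1)"
      proof
        assume "k (g 0) = k (g 1)"
        then have "f (g 0) = f (g 1)" using Fg[of 0] Fg[of 1] by simp
        then show False using inj_onD[OF fi, of 0 1] by simp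
      qed
      moreover have "k (g 0) \<in> k ` path_image g" "k (g 1) \<in> k ` path_image g" by (auto simp: path_image_def)
      ultimately show "k ` path_image g \<noteq> {k w}" by (metis singletonD)
    qed
    then show ?thesis using kw(1) \<open>F (k w) = e\<close> F\<kappa>[of s] by (auto simp: e_def)
  qed
  have mono: "strict_mono_on {p..q} (\<lambda>s. f (\<gamma> s)) \<or> strict_antimono_on {p..q} (\<lambda>s. f (\<gamma> s))"
    if "inj_on (\<lambda>s. f (\<gamma> s)) {p..q}" for p q
    using injective_eq_monotone_map[OF _ gc, of "{p..q}"] that by (simp add: is_interval_cc)
  show ?thesis
  proof (cases "f (\<gamma> t1) < f (\<gamma> t2)")
    case True
    have "\<not> strict_antimono_on {t1..t2} (\<lambda>s. f (\<gamma> s))"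
      using True t monotone_onD[of "{t1..t2}" "(<)" "(>)" "\<lambda>s. f (\<gamma> s)" t1 t2] by auto
    \<comment> \<open>As \<open>f\<close> is constant on the second and fourth arcs, the third arc
      undoes the change along the first, so the two monotone arcs run in opposite
      directions.\<close>
    moreover have "\<not> strict_mono_on {t3..t4} (\<lambda>s. f (\<gamma> s))"
      using True t eq monotone_onD[of "{t3..t4}" "(<)" "(<)" "\<lambda>s. f (\<gamma> s)" t3 t4] by auto
    ultimately have "strict_mono_on {t1..t2} (\<lambda>s. F (\<kappa> s))" "strict_antimono_on {t3..t4} (\<lambda>s. F (\<kappa> s))"
      using mono[OF inj12] mono[OF inj34] by (auto simp: F\<kappa>)
    then have "\<exists>a b. disc_flow F (F (\<kappa> t1)) (F (\<kappa> t2)) a b"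
      by (rule circle_flow[OF t Fc c\<kappa> \<kappa>im i\<kappa> \<kappa>per _ _ const2 const4 regF sec])
    then show ?thesis unfolding F_def by blast
  next
    case False
    then have lt: "f (\<gamma> t2) < f (\<gamma> t1)" using levels by auto
    have "\<not> strict_mono_on {t1..t2} (\<lambda>s. f (\<gamma> s))"
      using lt t monotone_onD[of "{t1..t2}" "(<)" "(<)" "\<lambda>s. f (\<gamma> s)" t1 t2] by auto
    moreover have "\<not> strict_antimono_on {t3..t4} (\<lambda>s. f (\<gamma> s))"
      using lt t eq monotone_onD[of "{t3..t4}" "(<)" "(>)" "\<lambda>s. f (\<gamma> s)" t3 t4] by auto
    ultimately have "strict_antimono_on {t1..t2} (\<lambda>s. f (\<gamma> s))" "strict_mono_on {t3..t4} (\<lambda>s. f (\<gamma> s))"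
      using mono[OF inj12] mono[OF inj34] by auto
    then have "strict_mono_on {t1..t2} (\<lambda>s. - F (\<kappa> s))" "strict_antimono_on {t3..t4} (\<lambda>s. - F (\<kappa> s))"
      unfolding F\<kappa> by (auto simp: monotone_on_def)
    then have "\<exists>a b. disc_flow (\<lambda>x. - F x) (- F (\<kappa> t1)) (- F (\<kappa> t2)) a b"
    proof (rule circle_flow[OF t continuous_on_minus[OF Fc] c\<kappa> \<kappa>im i\<kappa> \<kappa>per])
      show "- F (\<kappa> s) = - F (\<kappa> t2)" if "s \<in> {t2..t3}" for s using const2[OF that] by simp
      show "- F (\<kappa> s) = - F (\<kappa> t1)" if "s \<in> {t4..t1 + 2 * pi}" for s using const4[OF that] by simp
      show "regular_point (ball 0 1) (\<lambda>x. - F x) p" if "norm p < 1" for p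
        by (rule regular_point_uminus[OF regF[OF that]])
      have tr: "transversal (\<lambda>x. - F x) = transversal F" by (auto simp: transversal_def inj_on_def fun_eq_iff)
      show "\<exists>x\<in>V. - F x = - F (\<kappa> s) \<and> (\<exists>S. transversal (\<lambda>x. - F x) x S)"
        if "s \<in> {t2<..<t3} \<union> {t4<..<t1 + 2 * pi}" "open V" "\<kappa> s \<in> V" for s V
        using sec[OF that] unfolding tr neg_equal_iff_equal .
    qed
    then obtain a b where "disc_flow (\<lambda>x. - F x) (- F (\<kappa> t1)) (- F (\<kappa> t2)) a b" by blast
    from disc_flow.flip[OF this] show ?thesis unfolding F_def by auto
  qed
qed

theorem theorem3p3:
  fixes D D' K K' :: "complex set"
    and f :: "complex \<Rightarrow> real"
    and c c' \<phi> \<phi>' :: "complex \<Rightarrow> complex"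
    and z :: "nat \<Rightarrow> complex"
  assumes "closed D" and "D homeomorphic (cball 0 1 :: complex set)"
    and orientation: "homeomorphism (sphere 0 1) (frontier D) c c'"
    and "regular_with c D f z"
    and "D' = model_domain (open_bd_arc c z 2) (open_bd_arc c z 4)"
    and "K = extremal_set D f"
    and "K' = extremal_set D' Im"
    and "homeomorphism (frontier D) (frontier D') \<phi> \<phi>'"
    and "\<phi> ` K = K'"
  shows "\<exists>H H' a b. homeomorphism D D' H H' \<and>
           (\<forall>w\<in>K. H w = \<phi> w) \<and>
           a \<noteq> 0 \<and> (\<forall>w\<in>D'. f (H' w) = a * Im w + b)"
proof -
  obtain h k where h: "homeomorphism (cball 0 1) D h (k :: complex \<Rightarrow> complex)"
    using assms(2) homeomorphic_sym unfolding homeomorphic_def by blast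
  have hD: "h ` cball 0 1 = D" "k ` D = cball 0 1" and hc: "continuous_on (cball 0 1) h"
    using h unfolding homeomorphism_def by auto
  note disc = disc_homeomorphism_interior[OF h]
  obtain m M a b where "disc_flow (\<lambda>x. f (h x)) m M a b"
    using regular_disc_flow[OF h orientation assms(4)] by blast
  then interpret disc_flow "\<lambda>x. f (h x)" m M a b .
  obtain y0 y1 and l r :: "real \<Rightarrow> real" where y: "y0 < y1"
    and lr: "continuous_on UNIV l" "continuous_on UNIV r" "\<And>y. y0 < y \<Longrightarrow> y < y1 \<Longrightarrow> l y < r y" "l y0 \<le> r y0" "l y1 \<le> r y1"
    and D': "D' = {z. y0 \<le> Im z \<and> Im z \<le> y1 \<and> l (Im z) \<le> Re z \<and> Re z \<le> r (Im z)}"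
  proof (rule model_domain_between_graphs[of "open_bd_arc c z 2" "open_bd_arc c z 4"])
    fix y0 y1 and l r :: "real \<Rightarrow> real"
    assume "y0 < y1" "continuous_on UNIV l" "continuous_on UNIV r"
      and "\<And>y. y0 < y \<Longrightarrow> y < y1 \<Longrightarrow> l y < r y" "l y0 \<le> r y0" "l y1 \<le> r y1"
      and "model_domain (open_bd_arc c z 2) (open_bd_arc c z 4) =
        {z. y0 \<le> Im z \<and> Im z \<le> y1 \<and> l (Im z) \<le> Re z \<and> Re z \<le> r (Im z)}"
    then show thesis using that[of y0 y1 l r] assms(5) by simp
  qed
  have em: "m \<in> {m..M}" "M \<in> {m..M}" using mM by auto
  have K: "K = {w \<in> D. f w \<in> {m, M}}" unfolding assms(6)
  proof (rule extremal_set_eq[where p = "h (a m)" and q = "h (a M)"])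
    show "m \<le> f x \<and> f x \<le> M" if x: "x \<in> D" for x
    proof -
      obtain p where "x = h p" "norm p \<le> 1" using hD(1) x by auto
      then show ?thesis using f_le[of p] f_ge[of p] by simp
    qed
  qed (use a_on[OF em(1)] a_on[OF em(2)] hD(1) in auto)
  have K': "K' = {w \<in> D'. Im w \<in> {y0, y1}}" unfolding assms(7)
    by (rule extremal_set_eq[where p = "Complex (l y0) y0" and q = "Complex (l y1) y1"]) (use y lr in \<open>auto simp: D'\<close>)
  \<comment> \<open>Interior points have intermediate values, so the extremal set lies on the
    frontier, where \<phi> is defined.\<close>
  have Kh: "K = h ` {p \<in> sphere 0 1. f (h p) \<in> {m, M}}"
  proof
    show "h ` {p \<in> sphere 0 1. f (h p) \<in> {m, M}} \<subseteq> K" unfolding K using hD(1) by auto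
    show "K \<subseteq> h ` {p \<in> sphere 0 1. f (h p) \<in> {m, M}}"
    proof
      fix w assume "w \<in> K"
      then obtain p where p: "w = h p" "norm p \<le> 1" "f (h p) \<in> {m, M}" unfolding K hD(1)[symmetric] by auto
      have "\<not> norm p < 1"
      proof
        assume "norm p < 1"
        then show False using f_less[of p] f_greater[of p] p(3) by simp
      qed
      then have "norm p = 1" using p(2) by simp
      then show "w \<in> h ` {p \<in> sphere 0 1. f (h p) \<in> {m, M}}" using p by auto
    qed
  qed
  define \<psi> where "\<psi> p = \<phi> (h p)" for p
  have \<phi>: "continuous_on (frontier D) \<phi>" "\<phi> ` frontier D = frontier D'" "inj_on \<phi> (frontier D)"
    using assms(8) unfolding homeomorphism_def by (auto intro: inj_on_inverseI)
  have \<psi>1: "continuous_on (sphere 0 1) \<psi>" unfolding \<psi>_def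
    by (rule continuous_on_compose2[OF \<phi>(1) continuous_on_subset[OF hc]]) (use disc(2) in auto)
  have \<psi>2: "inj_on \<psi> (sphere 0 1)"
  proof (rule inj_onI)
    fix p q :: complex assume pq: "p \<in> sphere 0 1" "q \<in> sphere 0 1" "\<psi> p = \<psi> q"
    then have "h p \<in> frontier D" "h q \<in> frontier D" unfolding disc(2)[symmetric] by blast+
    then have "h p = h q" using inj_onD[OF \<phi>(3)] pq(3) unfolding \<psi>_def by blast
    moreover have "k (h p) = p" "k (h q) = q" using homeomorphism_apply1[OF h] pq(1,2) by simp_all
    ultimately show "p = q" by metis
  qed
  have \<psi>3: "\<psi> ` sphere 0 1 = {z \<in> D'. Im z \<in> {y0, y1} \<or> Re z \<in> {l (Im z), r (Im z)}}"
  proof -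
    have "\<psi> ` sphere 0 1 = frontier D'" using \<phi>(2) disc(2) unfolding \<psi>_def by (metis image_image)
    then show ?thesis using frontier_between_graphs[OF lr(1,2) D'] by simp
  qed
  have \<psi>4: "\<psi> ` {p \<in> sphere 0 1. f (h p) \<in> {m, M}} = {z \<in> D'. Im z \<in> {y0, y1}}"
    using assms(9) unfolding Kh K' image_image \<psi>_def .
  have "\<exists>H H' \<alpha> \<beta>. homeomorphism (cball 0 1) D' H H' \<and>
      (\<forall>p. norm p = 1 \<longrightarrow> f (h p) \<in> {m, M} \<longrightarrow> H p = \<psi> p) \<and>
      \<alpha> \<noteq> 0 \<and> (\<forall>z\<in>D'. f (h (H' z)) = \<alpha> * Im z + \<beta>)"
    by (rule straighten_to[OF y continuous_on_subset[OF lr(1) subset_UNIV] continuous_on_subset[OF lr(2) subset_UNIV]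
        _ lr(4,5) D' \<psi>1 \<psi>2 \<psi>3 \<psi>4]) (rule lr(3))
  then obtain H H' \<alpha> \<beta> where H: "homeomorphism (cball 0 1) D' H H'"
    "\<And>p. norm p = 1 \<Longrightarrow> f (h p) \<in> {m, M} \<Longrightarrow> H p = \<psi> p"
    "\<alpha> \<noteq> 0" "\<And>z. z \<in> D' \<Longrightarrow> f (h (H' z)) = \<alpha> * Im z + \<beta>"
    by blast
  have "homeomorphism D D' (H \<circ> k) (h \<circ> H')"
    by (rule homeomorphism_compose[OF homeomorphism_symD[OF h] H(1)])
  moreover have "(H \<circ> k) w = \<phi> w" if w: "w \<in> K" for w
  proof -
    obtain p where p: "w = h p" "norm p = 1" "f (h p) \<in> {m, M}" using w unfolding Kh by auto
    then have "k w = p" using homeomorphism_apply1[OF h, of p] by simp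
    then show ?thesis using H(2)[OF p(2,3)] p(1) by (simp add: \<psi>_def)
  qed
  moreover have "\<forall>w\<in>D'. f ((h \<circ> H') w) = \<alpha> * Im w + \<beta>" using H(4) by simp
  ultimately show ?thesis using H(3) by blast
qed

end
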